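(* Let $(a,b)\in\Delta_{(0,1)}$, i.e. $a,b>0$ and $a+b<1$, and let $\Psi_0\in\mathcal H$ be any normalized initial state. Then the limiting distribution, as $t\to\infty$, of the scaled position $\boldsymbol X_t/t$ of the two-dimensional two-state quantum walk is the law of a random vector $(V_1,V_2)$ given by $$P(V_1\le u_1,V_2\le u_2)=\int_{-\infty}^{u_1}\int_{-\infty}^{u_2}\bigl[w_+(\boldsymbol v)f_+(\boldsymbol v)+w_-(\boldsymbol v)f_-(\boldsymbol v)\bigr]\,dv_1dv_2 ,$$ where the state-independent functions $f_\pm$ are $$f_\pm=\frac{F_0\pm\sqrt{F_1F_2}}{2\pi^2(1-v_1^2)(1-v_2^2)\sqrt{F_1F_2}}\,I_{E_1\cap E_2}$$ ($I_S$ is the indicator function of $S$) and the weight functions are, for $\bullet=\pm$, $$w_\bullet(\boldsymbol v)=\frac14\sum_{\star=\pm}\ \sum_{\lambda\in\{0,1\}^2}P_\star\bigl(\boldsymbol k_\lambda^\bullet(\boldsymbol v)\bigr).$$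
   Context: Model. $\mathcal H=\ell^2(\mathbb Z^2;\mathbb C^2)$, elements written $\Psi=(\Psi^{(+)},\Psi^{(-)})^{T}$. For $j=1,2$: $(S_j\Psi)^{(\pm)}(\boldsymbol x)=\Psi^{(\pm)}(\boldsymbol x\pm\boldsymbol e_j)$ with $\boldsymbol e_j$ the standard basis; $C_j=\begin{pmatrix}a_j&b_j\\-b_j&a_j\end{pmatrix}$ (acting pointwise), $a_j\in[0,1]$, $b_j=\sqrt{1-a_j^2}$; $U=S_2C_2S_1C_1$; $a=a_1a_2$, $b=b_1b_2$. The state at time $t$ is $\Psi_t=U^t\Psi_0$, and the position $\boldsymbol X_t$ has law $P(\boldsymbol X_t=\boldsymbol x)=\|\Psi_t(\boldsymbol x)\|_{\mathbb C^2}^2$. Functions. With $\boldsymbol v=(v_1,v_2)$, for $j=1,2$, $F_j(\boldsymbol v)=1-\frac{(v_1+v_2)^2}{4a_j^2}-\frac{(v_1-v_2)^2}{4b_j^2}$, $E_j=\{\boldsymbol v: F_j(\boldsymbol v)\ge0\}$, and $F_0(\boldsymbol v)=\frac{(a_1b_2)^2+(a_2b_1)^2}{2ab}\Bigl[1-\frac{(v_1+v_2)^2}{4a_0^2}-\frac{(v_1-v_2)^2}{4b_0^2}\Bigr]$ with $a_0^2=\frac{(a_1b_2)^2+(a_2b_1)^2}{b_1^2+b_2^2}$, $b_0^2=\frac{(a_1b_2)^2+(a_2b_1)^2}{a_1^2+a_2^2}$. Wave vector space. $\mathbb T=\mathbb R/2\pi\mathbb Z$, $\hat\Psi(\boldsymbol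 k)=\sum_{\boldsymbol x}e^{-i\boldsymbol k\cdot\boldsymbol x}\Psi(\boldsymbol x)$ for $\boldsymbol k=(k_1,k_2)\in\mathbb T^2$, $\hat U(\boldsymbol k)=D(k_2)C_2D(k_1)C_1$ with $D(\kappa)=\mathrm{diag}(e^{i\kappa},e^{-i\kappa})$. Put $l_1=k_2+k_1$, $l_2=k_2-k_1$, $c_i=\cos l_i$, $s_i=\sin l_i$, $\tau=ac_1-bc_2$, $\omega=\arccos\tau$. The eigenvalues of $\hat U(\boldsymbol k)$ are $e^{\pm i\omega(\boldsymbol k)}$, with unit eigenvectors $|\omega_\pm(\boldsymbol k)\rangle$; $P_\pm(\boldsymbol k)=|\langle\omega_\pm(\boldsymbol k)|\hat\Psi_0(\boldsymbol k)\rangle|^2$. The velocity map is $\boldsymbol v(\boldsymbol k)=(v_1,v_2)$ with $v_1=-\frac{as_1+bs_2}{\sqrt{1-\tau^2}}$, $v_2=-\frac{as_1-bs_2}{\sqrt{1-\tau^2}}$. Inverse branches. $\mathbb T^2$ is tiled (up to boundaries) by eight sets $K_n$, where $K_n$ consists of the $\boldsymbol k=(\frac{l_1-l_2}{2},\frac{l_1+l_2}{2})$ with $(l_1,l_2)$ in: $K_1:[0,\pi]\times[0,\pi]$; $K_2:[-\pi,0]\times[0,\pi]$; $K_3:[-\pi,0]\times[-\pi,0]$; $K_4:[0,\pi]\times[-\pi,0]$; $K_5:[-2\pi,-\pi]\times[0,\pi]$; $K_6:[-\pi,0]\times[-2\pi,-\pi]$; $K_7:[\pi,2\pi]\times[-\pi,0]$;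 $K_8:[0,\pi]\times[\pi,2\pi]$. Let $\varphi(c_1,c_2)=abc_1^2+(1-a^2-b^2)c_1c_2+abc_2^2$ and split $[-1,1]^2$ into $C^{(1)}=\{\varphi\le0,\ c_1\le0\le c_2\}$, $C^{(3)}=\{\varphi\le0,\ c_2\le0\le c_1\}$, $C^{(2)}=\{\varphi\ge0,\ c_1+c_2\le0\}$, $C^{(4)}=\{\varphi\ge0,\ c_1+c_2\ge0\}$. For $(\mu,\nu,\xi)\in\{0,1\}^3$ let $K_{(\mu,\nu,\xi)}$ be the set of $\boldsymbol k\in\bigcup_{n=1}^4K_{n+4\mu}$ with $(c_1,c_2)\in C^{(m)}$, $m=2(\nu+1)-\xi$. Up to null sets (boundaries), $\boldsymbol v$ maps each $K_{(\mu,\nu,\xi)}$ bijectively onto $E_1\cap E_2$; for $\lambda=(\mu,\nu)$, $\boldsymbol k_\lambda^+$ (resp. $\boldsymbol k_\lambda^-$) denotes the inverse of $\boldsymbol v|_{K_{(\mu,\nu,0)}}$ (resp. of $\boldsymbol v|_{K_{(\mu,\nu,1)}}$), defined a.e. on $E_1\cap E_2$. Outside $E_1\cap E_2$ the integrand is $0$.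
   Formalization: In the weights, P_⋆(k_λ^•(v)) is replaced by P_⋆(k_λ^•(⋆v)), so the minus term is evaluated at −v: the e^{−iω} component moves with −v(k), and the printed formula fails for Ψ_0=δ_0⊗(1,0), giving mean 0 where the true mean of V_2 is negative. *)

theory Defs
  imports "HOL-Probability.Probability"
begin

section \<open>The walk on position space\<close>

text \<open>A state is a function on the lattice with values in \<open>complex ^ 2\<close>; component 1 is the
  (+) part and component 2 the (-) part.\<close>

type_synonym state = "int \<times> int \<Rightarrow> complex ^ 2"

definition normalized :: "state \<Rightarrow> bool" where
  "normalized \<Psi> \<longleftrightarrow> ((\<lambda>x. (norm (\<Psi> x))\<^sup>2) has_sum 1) UNIV"

definition compl_coeff :: "real \<Rightarrow> real" where
  "compl_coeff \<alpha> = sqrt (1 - \<alpha>\<^sup>2)"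

definition coin :: "real \<Rightarrow> complex ^ 2 ^ 2" where
  "coin \<alpha> = vector [vector [of_real \<alpha>, of_real (compl_coeff \<alpha>)],
                    vector [- of_real (compl_coeff \<alpha>), of_real \<alpha>]]"

definition shift :: "int \<times> int \<Rightarrow> state \<Rightarrow> state" where
  "shift e \<Psi> = (\<lambda>x. vector [\<Psi> (x + e) $ 1, \<Psi> (x - e) $ 2])"

definition coin_op :: "real \<Rightarrow> state \<Rightarrow> state" where
  "coin_op \<alpha> \<Psi> = (\<lambda>x. coin \<alpha> *v \<Psi> x)"

definition walk :: "real \<Rightarrow> real \<Rightarrow> state \<Rightarrow> state" where
  "walk a1 a2 = shift (0, 1) \<circ> coin_op a2 \<circ> shift (1, 0) \<circ> coin_op a1"

definition position_law :: "real \<Rightarrow> real \<Rightarrow> state \<Rightarrow> nat \<Rightarrow> (int \<times> int) measure" where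
  "position_law a1 a2 \<Psi>0 t =
     density (count_space UNIV) (\<lambda>x. ennreal ((norm ((walk a1 a2 ^^ t) \<Psi>0 x))\<^sup>2))"

definition scaled_position_law :: "real \<Rightarrow> real \<Rightarrow> state \<Rightarrow> nat \<Rightarrow> (real \<times> real) measure" where
  "scaled_position_law a1 a2 \<Psi>0 t =
     distr (position_law a1 a2 \<Psi>0 t) borel
       (\<lambda>x. (of_int (fst x) / of_nat t, of_int (snd x) / of_nat t))"

definition converges_in_distribution ::
    "(nat \<Rightarrow> 'a :: topological_space measure) \<Rightarrow> 'a measure \<Rightarrow> bool" where
  "converges_in_distribution M N \<longleftrightarrow>
     (\<forall>g :: 'a \<Rightarrow> real. continuous_on UNIV g \<and> bounded (range g) \<longrightarrow>
        (\<lambda>t. \<integral>x. g x \<partial>M t) \<longlonglongrightarrow> (\<integral>x. g x \<partial>N))"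


section \<open>The functions \<open>F\<^sub>0\<close>, \<open>F\<^sub>j\<close> and \<open>f\<^sub>\<plusminus>\<close>\<close>

definition prod_a :: "real \<Rightarrow> real \<Rightarrow> real" where
  "prod_a a1 a2 = a1 * a2"

definition prod_b :: "real \<Rightarrow> real \<Rightarrow> real" where
  "prod_b a1 a2 = compl_coeff a1 * compl_coeff a2"

definition F :: "real \<Rightarrow> real \<times> real \<Rightarrow> real" where
  "F \<alpha> = (\<lambda>(v1, v2).
     1 - (v1 + v2)\<^sup>2 / (4 * \<alpha>\<^sup>2) - (v1 - v2)\<^sup>2 / (4 * (compl_coeff \<alpha>)\<^sup>2))"

definition E :: "real \<Rightarrow> (real \<times> real) set" where
  "E \<alpha> = {v. F \<alpha> v \<ge> 0}"

definition cross_sq :: "real \<Rightarrow> real \<Rightarrow> real" where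
  "cross_sq a1 a2 = (a1 * compl_coeff a2)\<^sup>2 + (a2 * compl_coeff a1)\<^sup>2"

definition a0_sq :: "real \<Rightarrow> real \<Rightarrow> real" where
  "a0_sq a1 a2 = cross_sq a1 a2 / ((compl_coeff a1)\<^sup>2 + (compl_coeff a2)\<^sup>2)"

definition b0_sq :: "real \<Rightarrow> real \<Rightarrow> real" where
  "b0_sq a1 a2 = cross_sq a1 a2 / (a1\<^sup>2 + a2\<^sup>2)"

definition F0 :: "real \<Rightarrow> real \<Rightarrow> real \<times> real \<Rightarrow> real" where
  "F0 a1 a2 = (\<lambda>(v1, v2).
     cross_sq a1 a2 / (2 * prod_a a1 a2 * prod_b a1 a2) *
     (1 - (v1 + v2)\<^sup>2 / (4 * a0_sq a1 a2) - (v1 - v2)\<^sup>2 / (4 * b0_sq a1 a2)))"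

text \<open>Signs \<open>\<plusminus>\<close> are represented by the real numbers \<open>1\<close> and \<open>- 1\<close>.\<close>

definition f :: "real \<Rightarrow> real \<Rightarrow> real \<Rightarrow> real \<times> real \<Rightarrow> real" where
  "f a1 a2 s v =
     (F0 a1 a2 v + s * sqrt (F a1 v * F a2 v)) /
     (2 * pi\<^sup>2 * (1 - (fst v)\<^sup>2) * (1 - (snd v)\<^sup>2) * sqrt (F a1 v * F a2 v)) *
     indicator (E a1 \<inter> E a2) v"


section \<open>Wave vector space\<close>

text \<open>Functions on the torus are \<open>2 * pi\<close>-periodic functions on the plane. For a square summable
  state the Fourier series converges (unconditionally) in \<open>L\<^sup>2\<close> of the torus, so the transform is
  determined only up to null sets; a Borel representative is chosen.\<close>

definition is_fourier_transform :: "state \<Rightarrow> (real \<times> real \<Rightarrow> complex ^ 2) \<Rightarrow> bool" where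
  "is_fourier_transform \<Psi> g \<longleftrightarrow>
     g \<in> borel_measurable borel \<and>
     (\<forall>k1 k2. g (k1 + 2 * pi, k2) = g (k1, k2) \<and> g (k1, k2 + 2 * pi) = g (k1, k2)) \<and>
     ((\<lambda>A. \<integral>\<^sup>+k \<in> {-pi..pi} \<times> {-pi..pi}.
          ennreal ((norm (g k - (\<Sum>x\<in>A. cis (- (fst k * of_int (fst x) + snd k * of_int (snd x)))
                                       *s \<Psi> x)))\<^sup>2) \<partial>lborel)
        \<longlongrightarrow> 0) (finite_subsets_at_top UNIV)"

definition fourier_transform :: "state \<Rightarrow> real \<times> real \<Rightarrow> complex ^ 2" where
  "fourier_transform \<Psi> = (SOME g. is_fourier_transform \<Psi> g)"

definition phase_matrix :: "real \<Rightarrow> complex ^ 2 ^ 2" where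
  "phase_matrix \<kappa> = vector [vector [cis \<kappa>, 0], vector [0, cis (- \<kappa>)]]"

definition Uhat :: "real \<Rightarrow> real \<Rightarrow> real \<times> real \<Rightarrow> complex ^ 2 ^ 2" where
  "Uhat a1 a2 k = phase_matrix (snd k) ** coin a2 ** phase_matrix (fst k) ** coin a1"

definition l1 :: "real \<times> real \<Rightarrow> real" where
  "l1 k = snd k + fst k"

definition l2 :: "real \<times> real \<Rightarrow> real" where
  "l2 k = snd k - fst k"

definition \<tau> :: "real \<Rightarrow> real \<Rightarrow> real \<times> real \<Rightarrow> real" where
  "\<tau> a1 a2 k = prod_a a1 a2 * cos (l1 k) - prod_b a1 a2 * cos (l2 k)"

definition \<omega> :: "real \<Rightarrow> real \<Rightarrow> real \<times> real \<Rightarrow> real" where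
  "\<omega> a1 a2 k = arccos (\<tau> a1 a2 k)"

text \<open>The eigenvalues are simple for the parameters considered, so the unit eigenvector is
  determined up to a phase, on which \<open>P\<close> below does not depend.\<close>

definition eigvec :: "real \<Rightarrow> real \<Rightarrow> real \<Rightarrow> real \<times> real \<Rightarrow> complex ^ 2" where
  "eigvec a1 a2 s k =
     (SOME \<phi>. norm \<phi> = 1 \<and> Uhat a1 a2 k *v \<phi> = cis (s * \<omega> a1 a2 k) *s \<phi>)"

definition P :: "real \<Rightarrow> real \<Rightarrow> state \<Rightarrow> real \<Rightarrow> real \<times> real \<Rightarrow> real" where
  "P a1 a2 \<Psi>0 s k =
     (cmod (\<Sum>i\<in>UNIV. cnj (eigvec a1 a2 s k $ i) * fourier_transform \<Psi>0 k $ i))\<^sup>2"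

definition velocity :: "real \<Rightarrow> real \<Rightarrow> real \<times> real \<Rightarrow> real \<times> real" where
  "velocity a1 a2 k =
     (- (prod_a a1 a2 * sin (l1 k) + prod_b a1 a2 * sin (l2 k)) / sqrt (1 - (\<tau> a1 a2 k)\<^sup>2),
      - (prod_a a1 a2 * sin (l1 k) - prod_b a1 a2 * sin (l2 k)) / sqrt (1 - (\<tau> a1 a2 k)\<^sup>2))"


section \<open>Inverse branches of the velocity map\<close>

definition tile_box :: "nat \<Rightarrow> (real \<times> real) set" where
  "tile_box n =
     [{0..pi} \<times> {0..pi},
      {-pi..0} \<times> {0..pi},
      {-pi..0} \<times> {-pi..0},
      {0..pi} \<times> {-pi..0},
      {-2*pi..-pi} \<times> {0..pi},
      {-pi..0} \<times> {-2*pi..-pi},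
      {pi..2*pi} \<times> {-pi..0},
      {0..pi} \<times> {pi..2*pi}] ! (n - 1)"

definition tile :: "nat \<Rightarrow> (real \<times> real) set" where
  "tile n = {((x - y) / 2, (x + y) / 2) | x y. (x, y) \<in> tile_box n}"

definition \<phi> :: "real \<Rightarrow> real \<Rightarrow> real \<times> real \<Rightarrow> real" where
  "\<phi> a1 a2 = (\<lambda>(c1, c2).
     prod_a a1 a2 * prod_b a1 a2 * c1\<^sup>2
     + (1 - (prod_a a1 a2)\<^sup>2 - (prod_b a1 a2)\<^sup>2) * c1 * c2
     + prod_a a1 a2 * prod_b a1 a2 * c2\<^sup>2)"

definition cos_region :: "real \<Rightarrow> real \<Rightarrow> nat \<Rightarrow> (real \<times> real) set" where
  "cos_region a1 a2 m = ({-1..1} \<times> {-1..1}) \<inter>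
     [{(c1, c2). \<phi> a1 a2 (c1, c2) \<le> 0 \<and> c1 \<le> 0 \<and> 0 \<le> c2},
      {(c1, c2). \<phi> a1 a2 (c1, c2) \<ge> 0 \<and> c1 + c2 \<le> 0},
      {(c1, c2). \<phi> a1 a2 (c1, c2) \<le> 0 \<and> c2 \<le> 0 \<and> 0 \<le> c1},
      {(c1, c2). \<phi> a1 a2 (c1, c2) \<ge> 0 \<and> c1 + c2 \<ge> 0}] ! (m - 1)"

definition K :: "real \<Rightarrow> real \<Rightarrow> nat \<Rightarrow> nat \<Rightarrow> nat \<Rightarrow> (real \<times> real) set" where
  "K a1 a2 \<mu> \<nu> \<xi> =
     {k \<in> (\<Union>n\<in>{1..4}. tile (n + 4 * \<mu>)).
        (cos (l1 k), cos (l2 k)) \<in> cos_region a1 a2 (2 * (\<nu> + 1) - \<xi>)}"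

text \<open>Superscript \<open>+\<close> (\<open>s = 1\<close>) belongs to \<open>\<xi> = 0\<close>, superscript \<open>-\<close> to \<open>\<xi> = 1\<close>. Only almost every
  point of \<open>E\<^sub>1 \<inter> E\<^sub>2\<close> has exactly one preimage; on the exceptional null set, and outside
  \<open>E\<^sub>1 \<inter> E\<^sub>2\<close>, where \<open>f\<close> vanishes, the value is irrelevant.\<close>

definition k_inv :: "real \<Rightarrow> real \<Rightarrow> real \<Rightarrow> nat \<Rightarrow> nat \<Rightarrow> real \<times> real \<Rightarrow> real \<times> real" where
  "k_inv a1 a2 s \<mu> \<nu> = inv_into (K a1 a2 \<mu> \<nu> (if s = 1 then 0 else 1)) (velocity a1 a2)"

text \<open>The spectral component with eigenvalue \<open>cis (s' * \<omega> k)\<close> has group velocity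
  \<open>- s' * grad \<omega> k = s' * velocity k\<close>. It therefore contributes at \<open>v\<close> through the wave vectors
  whose image under \<open>velocity\<close> is \<open>s' * v\<close>, and \<open>k_inv\<close> is evaluated at \<open>s' * v\<close>. Evaluating it
  at \<open>v\<close> for both signs would make the limit law the same symmetric one for all initial states
  supported at the origin, which the walk contradicts.\<close>

definition w :: "real \<Rightarrow> real \<Rightarrow> state \<Rightarrow> real \<Rightarrow> real \<times> real \<Rightarrow> real" where
  "w a1 a2 \<Psi>0 s v =
     1 / 4 * (\<Sum>s'\<in>{1, -1}. \<Sum>(\<mu>, \<nu>)\<in>{0, 1} \<times> {0, 1}.
       P a1 a2 \<Psi>0 s' (k_inv a1 a2 s \<mu> \<nu> (s' *\<^sub>R v)))"

definition limit_density :: "real \<Rightarrow> real \<Rightarrow> state \<Rightarrow> real \<times> real \<Rightarrow> real" where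
  "limit_density a1 a2 \<Psi>0 v =
     w a1 a2 \<Psi>0 1 v * f a1 a2 1 v + w a1 a2 \<Psi>0 (-1) v * f a1 a2 (-1) v"

end

theory Submission
  imports Defs
begin

text \<open>In wave vector space the walk is multiplication by \<open>Uhat k\<close>, a matrix in SU(2) with eigenvalues
  \<open>cis (\<plusminus> \<omega> k)\<close>. For finitely supported states the characteristic function of the scaled position is an
  integral over the torus of an inner product of \<open>Uhat (k) ^ t\<close> and \<open>Uhat (k - \<xi> / t) ^ t\<close> applied to the
  transform, and the phases combine to \<open>cis (\<plusminus> t (\<omega> (k - \<xi> / t) - \<omega> k))\<close>. Since \<open>velocity\<close> is \<open>- grad \<omega>\<close>,
  the limit is the law of \<open>\<plusminus> velocity k\<close> under \<open>P (\<plusminus>) dk / (4 pi^2)\<close>. The scaled positions stay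
  in a compact set, so trigonometric polynomials suffice as test functions; general states follow by
  approximation in mean square.

  For the density, write \<open>p, q\<close> for half the sum and half the difference of the velocity components and
  \<open>W = 1 - \<tau>^2\<close>. Then \<open>W F\<^sub>1 = A^2\<close> and \<open>W F\<^sub>2 = B^2\<close> for linear forms \<open>A, B\<close> in \<open>(c\<^sub>1, c\<^sub>2)\<close>
  with \<open>\<phi> = A B\<close>, and the four cosine regions are exactly the four sign patterns of \<open>(A, B)\<close>. Given \<open>v\<close> and
  the signs, \<open>A / sqrt W\<close> and \<open>B / sqrt W\<close> are known, hence \<open>c\<^sub>i / sqrt W\<close>, and \<open>c\<^sub>1^2 + s\<^sub>1^2 = 1\<close>
  determines \<open>W\<close>. The Jacobian is \<open>4 a b \<bar>\<phi>\<bar> / W^2\<close>, which is the reciprocal of \<open>pi^2 f\<^sub>\<plusminus>\<close>.\<close>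

section \<open>Algebraic identities\<close>

text \<open>The map from k to the angles (l1, l2) sends the periods 2 pi (i, j) to 2 pi (i + j, j -
  i), a sublattice of index 2, so the torus covers the angle pairs modulo 2 pi twice. This is why
  there are two families of tiles; with the four sign patterns of (A, B) they give eight branches.
  The signs of the sines cause no further branching, since v determines both sines up to the common
  factor sqrt W. The hypothesis a + b < 1 acts in two ways: it keeps \<tau> away from 1 and -1, so
  the two eigenvalues never meet, and it excludes a1 = a2, where A and B coincide. Eigenvectors,
  transform and inverse branches are pointwise choices, so continuity or measurability cannot be
  read off them. Eigenvectors are replaced by the explicit operator \<open>Y\<close> and the
  quadratic form \<open>Q\<close>. Measurability of the density is obtained as a conclusion of the
  change of variables, in the Lebesgue sense only; a Borel function equal to it almost everywhere
  then defines the limit measure.\<close>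

lemma F_numerator_identity:
  fixes a1 a2 b1 b2 c1 c2 s1 s2 :: real
  assumes "a1\<^sup>2 + b1\<^sup>2 = 1" "a2\<^sup>2 + b2\<^sup>2 = 1" "c1\<^sup>2 + s1\<^sup>2 = 1" "c2\<^sup>2 + s2\<^sup>2 = 1"
  shows "1 - (a1 * a2 * c1 - b1 * b2 * c2)\<^sup>2 - (a2 * s1)\<^sup>2 - (b2 * s2)\<^sup>2
      = (a2 * b1 * c1 + a1 * b2 * c2)\<^sup>2"
  using assms by algebra

text \<open>Expanding (a1^2 + b1^2)(a2^2 + b2^2) = 1 gives (a2 b1)^2 + (a1 b2)^2 = 1 - a^2 - b^2,
  the mixed coefficient; the product of a2 b1 and a1 b2 is a b.\<close>

lemma \<phi>_factorization:
  fixes a1 a2 b1 b2 c1 c2 :: real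
  assumes "a1\<^sup>2 + b1\<^sup>2 = 1" "a2\<^sup>2 + b2\<^sup>2 = 1"
  shows "(a1 * a2) * (b1 * b2) * c1\<^sup>2 + (1 - (a1 * a2)\<^sup>2 - (b1 * b2)\<^sup>2) * c1 * c2
        + (a1 * a2) * (b1 * b2) * c2\<^sup>2
      = (a2 * b1 * c1 + a1 * b2 * c2) * (a1 * b2 * c1 + a2 * b1 * c2)"
  using assms by algebra

text \<open>Divided by 2 a b V this reads F0 + \<phi> / V = V (1 - v1^2)(1 - v2^2) / (2 a b): the
  numerator of \<open>f\<close> contains the factors 1 - v_i^2 of its denominator.\<close>

lemma F0_numerator_identity:
  fixes a1 a2 b1 b2 c1 c2 s1 s2 :: real
  assumes "a1\<^sup>2 + b1\<^sup>2 = 1" "a2\<^sup>2 + b2\<^sup>2 = 1" "c1\<^sup>2 + s1\<^sup>2 = 1" "c2\<^sup>2 + s2\<^sup>2 = 1"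
  defines "a \<equiv> a1 * a2" and "b \<equiv> b1 * b2"
  defines "V \<equiv> 1 - (a * c1 - b * c2)\<^sup>2"
  shows "((a1 * b2)\<^sup>2 + (a2 * b1)\<^sup>2) * V - (b1\<^sup>2 + b2\<^sup>2) * (a * s1)\<^sup>2 - (a1\<^sup>2 + a2\<^sup>2) * (b * s2)\<^sup>2
      + 2 * (a * b) * ((a2 * b1 * c1 + a1 * b2 * c2) * (a1 * b2 * c1 + a2 * b1 * c2))
      = (V - (a * s1 + b * s2)\<^sup>2) * (V - (a * s1 - b * s2)\<^sup>2)"
  using assms(1-4) unfolding a_def b_def V_def by algebra

text \<open>With p = - a s1 / sqrt V and q = - b s2 / sqrt V, the left side is V^3 times the
  determinant of (p, q) with respect to (l1, l2).\<close>

lemma jacobian_identity: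
  fixes a b c1 c2 s1 s2 :: real
  assumes "c1\<^sup>2 + s1\<^sup>2 = 1" "c2\<^sup>2 + s2\<^sup>2 = 1"
  defines "t \<equiv> a * c1 - b * c2"
  defines "V \<equiv> 1 - t\<^sup>2"
  shows "(- a * c1 * V + a\<^sup>2 * s1\<^sup>2 * t) * (- b * c2 * V - b\<^sup>2 * s2\<^sup>2 * t) + a\<^sup>2 * b\<^sup>2 * s1\<^sup>2 * s2\<^sup>2 * t\<^sup>2
     = (a * b) * V * (a * b * c1\<^sup>2 + (1 - a\<^sup>2 - b\<^sup>2) * c1 * c2 + a * b * c2\<^sup>2)"
  using assms(1,2) unfolding t_def V_def by algebra

lemma affine_pair_unique:
  fixes A1 A2 B1 B2 u z M :: real
  assumes "A1 + B1 = 1" "A2 + B2 = 1" "A2 * B1 \<noteq> A1 * B2"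
    and "A2 * u + B2 * z = M" "A1 * u + B1 * z = M"
  shows "u = M" "z = M"
proof -
  have "(A2 * B1 - A1 * B2) * (u - M) = 0" "(A2 * B1 - A1 * B2) * (z - M) = 0"
    using assms(1,2,4,5) by algebra+
  then show "u = M" "z = M" using assms(3) by auto
qed

text \<open>Meant for x, y = c_i / sqrt W and X, Y = s_i^2 / W. The hypotheses become two linear
  equations for x^2 + X and y^2 + Y whose coefficients sum to 1 in each row, so the pair (M, M)
  solves them, uniquely by the determinant condition. Both angles thus get the same radius.\<close>

lemma inverse_branch_identity:
  fixes a1 a2 b1 b2 x y X Y :: real
  assumes "a1\<^sup>2 + b1\<^sup>2 = 1" "a2\<^sup>2 + b2\<^sup>2 = 1" "(a2 * b1)\<^sup>2 \<noteq> (a1 * b2)\<^sup>2"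
    and "(a2 * b1 * x + a1 * b2 * y)\<^sup>2 = 1 - a2\<^sup>2 * X - b2\<^sup>2 * Y"
    and "(a1 * b2 * x + a2 * b1 * y)\<^sup>2 = 1 - a1\<^sup>2 * X - b1\<^sup>2 * Y"
  defines "M \<equiv> 1 + (a1 * a2 * x - b1 * b2 * y)\<^sup>2"
  shows "x\<^sup>2 + X = M" "y\<^sup>2 + Y = M"
proof -
  have e1: "a2\<^sup>2 * (x\<^sup>2 + X) + b2\<^sup>2 * (y\<^sup>2 + Y) = M"
    using assms(1,2,4) unfolding M_def by algebra
  have e2: "a1\<^sup>2 * (x\<^sup>2 + X) + b1\<^sup>2 * (y\<^sup>2 + Y) = M"
    using assms(1,2,5) unfolding M_def by algebra
  have "a2\<^sup>2 * b1\<^sup>2 \<noteq> a1\<^sup>2 * b2\<^sup>2"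
    using assms(3) by (simp add: power_mult_distrib)
  from affine_pair_unique[OF assms(1,2) this e1 e2]
  show "x\<^sup>2 + X = M" "y\<^sup>2 + Y = M" by simp_all
qed

section \<open>Inverting the velocity map\<close>

definition tau_compl :: "real \<Rightarrow> real \<Rightarrow> real \<times> real \<Rightarrow> real" where
  "tau_compl a1 a2 k = 1 - (\<tau> a1 a2 k)\<^sup>2"

text \<open>The sines vanish on the boundaries of the tiles; \<phi> vanishes between neighbouring
  cosine regions, which is also where the Jacobian degenerates.\<close>

definition generic :: "real \<Rightarrow> real \<Rightarrow> real \<times> real \<Rightarrow> bool" where
  "generic a1 a2 k \<longleftrightarrow> sin (l1 k) \<noteq> 0 \<and> sin (l2 k) \<noteq> 0 \<and> \<phi> a1 a2 (cos (l1 k), cos (l2 k)) \<noteq> 0"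

locale walk_params =
  fixes a1 a2 :: real
  assumes a1: "0 \<le> a1" "a1 \<le> 1" and a2: "0 \<le> a2" "a2 \<le> 1"
    and ab_pos: "prod_a a1 a2 > 0" "prod_b a1 a2 > 0"
    and ab_sum: "prod_a a1 a2 + prod_b a1 a2 < 1"
begin

abbreviation "b1 \<equiv> compl_coeff a1"
abbreviation "b2 \<equiv> compl_coeff a2"
abbreviation "a \<equiv> prod_a a1 a2"
abbreviation "b \<equiv> prod_b a1 a2"
abbreviation "W \<equiv> tau_compl a1 a2"
abbreviation "gen \<equiv> generic a1 a2"

definition lin1 :: "real \<times> real \<Rightarrow> real" where
  "lin1 c = a2 * b1 * fst c + a1 * b2 * snd c"

definition lin2 :: "real \<times> real \<Rightarrow> real" where
  "lin2 c = a1 * b2 * fst c + a2 * b1 * snd c"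

abbreviation "csl k \<equiv> (cos (l1 k), cos (l2 k))"

lemma coeff_pos: "0 < a1" "0 < a2" "0 < b1" "0 < b2"
  using ab_pos a1 a2 power_le_one[OF a1, of 2] power_le_one[OF a2, of 2]
  by (auto simp: prod_a_def prod_b_def compl_coeff_def zero_less_mult_iff)

lemma coeff_sq: "a1\<^sup>2 + b1\<^sup>2 = 1" "a2\<^sup>2 + b2\<^sup>2 = 1"
  using a1 a2 by (simp_all add: compl_coeff_def power_le_one)

text \<open>The difference of the two squares is a2^2 - a1^2, and a1 = a2 would give a + b = a1^2 +
  b1^2 = 1, against \<open>ab_sum\<close>.\<close>

lemma cross_ne: "(a2 * b1)\<^sup>2 \<noteq> (a1 * b2)\<^sup>2"
proof
  assume "(a2 * b1)\<^sup>2 = (a1 * b2)\<^sup>2"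
  then have "a1\<^sup>2 = a2\<^sup>2" using coeff_sq by algebra
  then have "a1 = a2" using a1 a2 by simp
  then show False
    using ab_sum coeff_sq by (simp add: prod_a_def prod_b_def power2_eq_square)
qed

text \<open>The spectral gap: since \<bar>\<tau>\<bar> is at most a + b, the eigenvalues stay away
  from 1 and -1, and \<open>\<omega>\<close> and \<open>velocity\<close> are smooth on the whole
  plane.\<close>

lemma W_pos: "0 < W k"
proof -
  have "\<bar>\<tau> a1 a2 k\<bar> \<le> a * \<bar>cos (l1 k)\<bar> + b * \<bar>cos (l2 k)\<bar>"
    using ab_pos abs_triangle_ineq4[of "a * cos (l1 k)" "b * cos (l2 k)"]
    by (simp add: \<tau>_def abs_mult)
  also have "\<dots> \<le> a * 1 + b * 1"
    using ab_pos by (intro add_mono mult_left_mono) auto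
  finally have "\<bar>\<tau> a1 a2 k\<bar> < 1" using ab_sum by simp
  then show ?thesis by (simp add: tau_compl_def abs_square_less_1)
qed

lemma \<phi>_lin: "\<phi> a1 a2 c = lin1 c * lin2 c"
  using \<phi>_factorization[OF coeff_sq, of "fst c" "snd c"]
  by (simp add: \<phi>_def lin1_def lin2_def prod_a_def prod_b_def split_beta mult.assoc)

lemma velocity_half:
  "(fst (velocity a1 a2 k) + snd (velocity a1 a2 k)) / 2 = - a * sin (l1 k) / sqrt (W k)"
  "(fst (velocity a1 a2 k) - snd (velocity a1 a2 k)) / 2 = - b * sin (l2 k) / sqrt (W k)"
  unfolding velocity_def tau_compl_def by (simp_all add: divide_simps)

lemma F_half:
  "F \<alpha> v = 1 - ((fst v + snd v) / 2)\<^sup>2 / \<alpha>\<^sup>2 - ((fst v - snd v) / 2)\<^sup>2 / (compl_coeff \<alpha>)\<^sup>2"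
  by (simp add: F_def split_beta power_divide)

lemma F_velocity:
  "F a1 (velocity a1 a2 k) = (lin1 (csl k))\<^sup>2 / W k"
  "F a2 (velocity a1 a2 k) = (lin2 (csl k))\<^sup>2 / W k"
proof -
  have W: "W k = 1 - (a1 * a2 * cos (l1 k) - b1 * b2 * cos (l2 k))\<^sup>2"
    by (simp add: tau_compl_def \<tau>_def prod_a_def prod_b_def)
  have i1: "W k - (a2 * sin (l1 k))\<^sup>2 - (b2 * sin (l2 k))\<^sup>2 = (lin1 (csl k))\<^sup>2"
    unfolding W lin1_def using F_numerator_identity[OF coeff_sq, of "cos (l1 k)" "sin (l1 k)" "cos (l2 k)" "sin (l2 k)"]
    by simp
  \<comment> \<open>The same identity with the two coins exchanged: a and b are unchanged, while
    \<open>lin1\<close> and \<open>lin2\<close> swap.\<close>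
  have i2: "W k - (a1 * sin (l1 k))\<^sup>2 - (b1 * sin (l2 k))\<^sup>2 = (lin2 (csl k))\<^sup>2"
    unfolding W lin2_def using F_numerator_identity[OF coeff_sq(2,1), of "cos (l1 k)" "sin (l1 k)" "cos (l2 k)" "sin (l2 k)"]
    by (simp add: mult.commute)
  have "F a1 (velocity a1 a2 k) = (W k - (a2 * sin (l1 k))\<^sup>2 - (b2 * sin (l2 k))\<^sup>2) / W k"
    unfolding F_half velocity_half using W_pos[of k] coeff_pos
    by (simp add: power_divide power_mult_distrib prod_a_def prod_b_def diff_divide_distrib)
  then show "F a1 (velocity a1 a2 k) = (lin1 (csl k))\<^sup>2 / W k" using i1 by simp
  have "F a2 (velocity a1 a2 k) = (W k - (a1 * sin (l1 k))\<^sup>2 - (b1 * sin (l2 k))\<^sup>2) / W k"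
    unfolding F_half velocity_half using W_pos[of k] coeff_pos
    by (simp add: power_divide power_mult_distrib prod_a_def prod_b_def diff_divide_distrib)
  then show "F a2 (velocity a1 a2 k) = (lin2 (csl k))\<^sup>2 / W k" using i2 by simp
qed

lemma velocity_in_E: "velocity a1 a2 k \<in> E a1 \<inter> E a2"
  using W_pos[of k] by (simp add: E_def F_velocity)

text \<open>Cauchy--Schwarz with the weights a1^2 + b1^2 = 1. It keeps the factors 1 - v_i^2 in the
  denominator of \<open>f\<close> away from zero.\<close>

lemma components_lt_1:
  assumes "F a1 v > 0"
  shows "(fst v)\<^sup>2 < 1" "(snd v)\<^sup>2 < 1"
proof -
  define p q where "p = (fst v + snd v) / 2" and "q = (fst v - snd v) / 2"
  have pq: "fst v = p + q" "snd v = p - q" by (simp_all add: p_def q_def field_simps)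
  have lt: "p\<^sup>2 / a1\<^sup>2 + q\<^sup>2 / b1\<^sup>2 < 1"
    using assms by (simp add: F_half p_def q_def)
  have cs: "(p + r)\<^sup>2 \<le> p\<^sup>2 / a1\<^sup>2 + r\<^sup>2 / b1\<^sup>2" for r
  proof -
    have "p\<^sup>2 / a1\<^sup>2 + r\<^sup>2 / b1\<^sup>2 = (p\<^sup>2 / a1\<^sup>2 + r\<^sup>2 / b1\<^sup>2) * (a1\<^sup>2 + b1\<^sup>2)"
      using coeff_sq by simp
    also have "\<dots> = (p + r)\<^sup>2 + (p * b1 / a1 - r * a1 / b1)\<^sup>2"
      using coeff_pos by (simp add: field_simps power2_eq_square)
    finally show ?thesis by simp
  qed
  show "(fst v)\<^sup>2 < 1" using cs[of q] lt by (simp add: pq)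
  show "(snd v)\<^sup>2 < 1" using cs[of "-q"] lt by (simp add: pq)
qed

text \<open>The two signs are those of \<open>lin1\<close> and \<open>lin2\<close> on the region with the given index; for odd
  indices they depend on which of the two coefficients is larger.\<close>

definition sign1 :: "nat \<Rightarrow> real" where
  "sign1 m = (if m = 1 then - sgn (a2 * b1 - a1 * b2) else if m = 2 then -1
     else if m = 3 then sgn (a2 * b1 - a1 * b2) else 1)"

definition sign2 :: "nat \<Rightarrow> real" where
  "sign2 m = (if m = 1 then sgn (a2 * b1 - a1 * b2) else if m = 2 then -1
     else if m = 3 then - sgn (a2 * b1 - a1 * b2) else 1)"

lemma al_be: "0 < a2 * b1" "0 < a1 * b2" "a2 * b1 \<noteq> a1 * b2"
  using coeff_pos cross_ne by auto

lemma sign_sq: "sign1 m * sign1 m = 1" "sign2 m * sign2 m = 1"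
  using al_be by (auto simp: sign1_def sign2_def sgn_if)

end

text \<open>The difference of the two forms is (\<alpha> - \<beta>)(c1 - c2), so c1 \<le> 0 \<le> c2
  orders them and a nonpositive product then fixes both signs. Conversely, solving for c1 and c2
  gives combinations in which both terms have the same sign.\<close>

lemma opposite_signs_iff:
  fixes \<alpha> \<beta> c1 c2 :: real
  assumes "0 < \<alpha>" "0 < \<beta>" "\<beta> < \<alpha>"
  shows "(\<alpha> * c1 + \<beta> * c2) * (\<beta> * c1 + \<alpha> * c2) \<le> 0 \<and> c1 \<le> 0 \<and> 0 \<le> c2 \<longleftrightarrow>
    \<alpha> * c1 + \<beta> * c2 \<le> 0 \<and> 0 \<le> \<beta> * c1 + \<alpha> * c2" (is "?L \<longleftrightarrow> ?R")
proof
  assume L: ?L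
  then have "(\<alpha> - \<beta>) * (c1 - c2) \<le> 0"
    using assms by (intro mult_nonneg_nonpos) auto
  then have "\<alpha> * c1 + \<beta> * c2 \<le> \<beta> * c1 + \<alpha> * c2" by (simp add: algebra_simps)
  with L show ?R by (auto simp: mult_le_0_iff)
next
  assume R: ?R
  have "(\<alpha>\<^sup>2 - \<beta>\<^sup>2) * c1 = \<alpha> * (\<alpha> * c1 + \<beta> * c2) - \<beta> * (\<beta> * c1 + \<alpha> * c2)" by algebra
  also have "\<dots> \<le> 0"
    using mult_nonneg_nonpos[of \<alpha> "\<alpha> * c1 + \<beta> * c2"] mult_nonneg_nonneg[of \<beta> "\<beta> * c1 + \<alpha> * c2"] R assms
    by linarith
  finally have 1: "(\<alpha>\<^sup>2 - \<beta>\<^sup>2) * c1 \<le> 0" .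
  have "(\<alpha>\<^sup>2 - \<beta>\<^sup>2) * c2 = \<alpha> * (\<beta> * c1 + \<alpha> * c2) - \<beta> * (\<alpha> * c1 + \<beta> * c2)" by algebra
  also have "\<dots> \<ge> 0"
    using mult_nonneg_nonneg[of \<alpha> "\<beta> * c1 + \<alpha> * c2"] mult_nonneg_nonpos[of \<beta> "\<alpha> * c1 + \<beta> * c2"] R assms
    by linarith
  finally have 2: "0 \<le> (\<alpha>\<^sup>2 - \<beta>\<^sup>2) * c2" .
  have "0 < \<alpha>\<^sup>2 - \<beta>\<^sup>2" using assms by (simp add: power_strict_mono)
  then have "c1 \<le> 0" "0 \<le> c2" using 1 2 by (auto simp: mult_le_0_iff zero_le_mult_iff)
  then show ?L using R by (auto simp: mult_nonpos_nonneg)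
qed

lemma opposite_signs_iff':
  fixes \<alpha> \<beta> c1 c2 :: real
  assumes "0 < \<alpha>" "0 < \<beta>" "\<beta> < \<alpha>"
  shows "(\<alpha> * c1 + \<beta> * c2) * (\<beta> * c1 + \<alpha> * c2) \<le> 0 \<and> 0 \<le> c1 \<and> c2 \<le> 0 \<longleftrightarrow>
    0 \<le> \<alpha> * c1 + \<beta> * c2 \<and> \<beta> * c1 + \<alpha> * c2 \<le> 0"
proof -
  have "\<alpha> * (- c1) + \<beta> * (- c2) = - (\<alpha> * c1 + \<beta> * c2)" for \<alpha> \<beta> by algebra
  then show ?thesis
    using opposite_signs_iff[OF assms, of "- c1" "- c2"]
    by (simp only: minus_mult_minus neg_le_0_iff_le neg_0_le_iff_le)
qed

text \<open>The sum of the two forms is (\<alpha> + \<beta>)(c1 + c2), so c1 + c2 decides between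
  both nonnegative and both nonpositive.\<close>

lemma same_signs_iff:
  fixes \<alpha> \<beta> c1 c2 :: real
  assumes "0 < \<alpha>" "0 < \<beta>"
  shows "0 \<le> (\<alpha> * c1 + \<beta> * c2) * (\<beta> * c1 + \<alpha> * c2) \<and> 0 \<le> c1 + c2 \<longleftrightarrow>
    0 \<le> \<alpha> * c1 + \<beta> * c2 \<and> 0 \<le> \<beta> * c1 + \<alpha> * c2" (is "?L \<longleftrightarrow> ?R")
proof -
  have e: "(\<alpha> * c1 + \<beta> * c2) + (\<beta> * c1 + \<alpha> * c2) = (\<alpha> + \<beta>) * (c1 + c2)" by algebra
  show ?thesis
  proof
    assume ?L
    then have "0 \<le> (\<alpha> * c1 + \<beta> * c2) + (\<beta> * c1 + \<alpha> * c2)" using e assms by simp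
    with \<open>?L\<close> show ?R by (auto simp: zero_le_mult_iff)
  next
    assume ?R
    then have "0 \<le> (\<alpha> + \<beta>) * (c1 + c2)" using e by linarith
    then have "0 \<le> c1 + c2" using assms by (simp add: zero_le_mult_iff)
    with \<open>?R\<close> show ?L by simp
  qed
qed

section \<open>The cosine regions as quadrants of the two linear forms\<close>

context walk_params begin

lemma cos_region_iff:
  assumes "m \<in> {1..4}"
  shows "c \<in> cos_region a1 a2 m \<longleftrightarrow> \<bar>fst c\<bar> \<le> 1 \<and> \<bar>snd c\<bar> \<le> 1 \<and>
    0 \<le> sign1 m * lin1 c \<and> 0 \<le> sign2 m * lin2 c"
proof -
  obtain c1 c2 where c: "c = (c1, c2)" by (cases c)
  have mm: "m = 1 \<or> m = 2 \<or> m = 3 \<or> m = 4" using assms by auto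
  have ph: "\<phi> a1 a2 (c1, c2) = (a2*b1 * c1 + a1*b2 * c2) * (a1*b2 * c1 + a2*b1 * c2)"
    by (simp add: \<phi>_lin lin1_def lin2_def)
  have pos: "0 < a2 * b1" "0 < a1 * b2" by (rule al_be)+
  define A where "A = a2*b1 * c1 + a1*b2 * c2"
  define B where "B = a1*b2 * c1 + a2*b1 * c2"
  have lin: "lin1 c = A" "lin2 c = B" "\<phi> a1 a2 (c1, c2) = A * B"
    by (simp_all add: ph c A_def B_def lin1_def lin2_def)
  have same: "0 \<le> A * B \<and> 0 \<le> c1 + c2 \<longleftrightarrow> 0 \<le> A \<and> 0 \<le> B"
    using same_signs_iff[OF pos, of c1 c2] by (simp add: A_def B_def)
  have "0 \<le> (-A) * (-B) \<and> 0 \<le> (-c1) + (-c2) \<longleftrightarrow> 0 \<le> -A \<and> 0 \<le> -B"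
    using same_signs_iff[OF pos, of "-c1" "-c2"] unfolding A_def B_def by (simp add: algebra_simps)
  then have same': "0 \<le> A * B \<and> c1 + c2 \<le> 0 \<longleftrightarrow> A \<le> 0 \<and> B \<le> 0" by auto
  have "a2 * b1 < a1 * b2 \<or> a1 * b2 < a2 * b1" using al_be by linarith
  then show ?thesis
  proof
    \<comment> \<open>\<open>opposite_signs_iff\<close> wants the larger coefficient first; here
      that is \<open>a1 * b2\<close>, so the two forms change roles.\<close>
    assume lt: "a2 * b1 < a1 * b2"
    have opp: "A * B \<le> 0 \<and> c1 \<le> 0 \<and> 0 \<le> c2 \<longleftrightarrow> B \<le> 0 \<and> 0 \<le> A"
      using opposite_signs_iff[OF pos(2,1) lt, of c1 c2] by (simp add: A_def B_def mult.commute)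
    have opp': "A * B \<le> 0 \<and> 0 \<le> c1 \<and> c2 \<le> 0 \<longleftrightarrow> 0 \<le> B \<and> A \<le> 0"
      using opposite_signs_iff'[OF pos(2,1) lt, of c1 c2] by (simp add: A_def B_def mult.commute)
    have sg: "sgn (a2 * b1 - a1 * b2) = -1" using lt by simp
    have "?thesis \<longleftrightarrow> (\<bar>c1\<bar> \<le> 1 \<and> \<bar>c2\<bar> \<le> 1 \<and> (if m = 1 then A * B \<le> 0 \<and> c1 \<le> 0 \<and> 0 \<le> c2
        else if m = 2 then 0 \<le> A * B \<and> c1 + c2 \<le> 0 else if m = 3 then A * B \<le> 0 \<and> 0 \<le> c1 \<and> c2 \<le> 0
        else 0 \<le> A * B \<and> 0 \<le> c1 + c2) \<longleftrightarrow>
      \<bar>c1\<bar> \<le> 1 \<and> \<bar>c2\<bar> \<le> 1 \<and> 0 \<le> sign1 m * A \<and> 0 \<le> sign2 m * B)"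
      using mm unfolding lin by (elim disjE) (simp_all add: c cos_region_def lin abs_le_iff conj_ac)
    then show ?thesis
      unfolding same same' opp opp' using mm by (elim disjE) (simp_all add: sign1_def sign2_def sg conj_ac)
  next
    assume lt: "a1 * b2 < a2 * b1"
    have opp: "A * B \<le> 0 \<and> c1 \<le> 0 \<and> 0 \<le> c2 \<longleftrightarrow> A \<le> 0 \<and> 0 \<le> B"
      using opposite_signs_iff[OF pos lt, of c1 c2] by (simp add: A_def B_def)
    have opp': "A * B \<le> 0 \<and> 0 \<le> c1 \<and> c2 \<le> 0 \<longleftrightarrow> 0 \<le> A \<and> B \<le> 0"
      using opposite_signs_iff'[OF pos lt, of c1 c2] by (simp add: A_def B_def)
    have sg: "sgn (a2 * b1 - a1 * b2) = 1" using lt by simp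
    have "?thesis \<longleftrightarrow> (\<bar>c1\<bar> \<le> 1 \<and> \<bar>c2\<bar> \<le> 1 \<and> (if m = 1 then A * B \<le> 0 \<and> c1 \<le> 0 \<and> 0 \<le> c2
        else if m = 2 then 0 \<le> A * B \<and> c1 + c2 \<le> 0 else if m = 3 then A * B \<le> 0 \<and> 0 \<le> c1 \<and> c2 \<le> 0
        else 0 \<le> A * B \<and> 0 \<le> c1 + c2) \<longleftrightarrow>
      \<bar>c1\<bar> \<le> 1 \<and> \<bar>c2\<bar> \<le> 1 \<and> 0 \<le> sign1 m * A \<and> 0 \<le> sign2 m * B)"
      using mm unfolding lin by (elim disjE) (simp_all add: c cos_region_def lin abs_le_iff conj_ac)
    then show ?thesis
      unfolding same same' opp opp' using mm by (elim disjE) (simp_all add: sign1_def sign2_def sg conj_ac)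
  qed
qed

text \<open>The parity of the region index is the sign of \<phi>, and even indices are those with
  \<xi> = 0. This is how the superscript of the branch gets tied to the sign in
  \<open>f\<close>.\<close>

lemma sign_phi:
  assumes "m \<in> {1..4}"
  shows "sign1 m * sign2 m = (if even m then 1 else - 1)"
proof -
  have "m = 1 \<or> m = 2 \<or> m = 3 \<or> m = 4" using assms by auto
  then show ?thesis using al_be by (auto simp: sign1_def sign2_def sgn_if)
qed

lemma region_unique:
  assumes "lin1 c \<noteq> 0" "lin2 c \<noteq> 0" "\<bar>fst c\<bar> \<le> 1" "\<bar>snd c\<bar> \<le> 1"
  shows "\<exists>!m. m \<in> {1..4} \<and> c \<in> cos_region a1 a2 m"
proof -
  have r: "{1..4::nat} = {1,2,3,4}" by auto
  have "(m \<in> {1..4} \<and> c \<in> cos_region a1 a2 m) \<longleftrightarrow> (m \<in> {1,2,3,4} \<and> 0 \<le> sign1 m * lin1 c \<and> 0 \<le> sign2 m * lin2 c)" for m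
    using cos_region_iff[of m c] assms by (auto simp: r)
  moreover have "\<exists>!m. m \<in> {1,2,3,4} \<and> 0 \<le> sign1 m * A \<and> 0 \<le> sign2 m * B" if "A \<noteq> 0" "B \<noteq> 0" for A B
  proof -
    have "sgn (a2 * b1 - a1 * b2) = 1 \<or> sgn (a2 * b1 - a1 * b2) = -1" using al_be by (simp add: sgn_if)
    moreover have "A > 0 \<or> A < 0" "B > 0 \<or> B < 0" using that by auto
    ultimately show ?thesis
      unfolding sign1_def sign2_def
      by (elim disjE) ((rule ex1I[where a = 1], force, force) | (rule ex1I[where a = 2], force, force)
        | (rule ex1I[where a = 3], force, force) | (rule ex1I[where a = 4], force, force))+
  qed
  ultimately show ?thesis using assms(1,2) by presburger
qed

end

section \<open>The two families of tiles in terms of the angles\<close>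

lemma mem_tile_iff: "k \<in> tile n \<longleftrightarrow> (l1 k, l2 k) \<in> tile_box n"
proof
  assume "(l1 k, l2 k) \<in> tile_box n"
  moreover have "k = ((l1 k - l2 k) / 2, (l1 k + l2 k) / 2)"
    by (simp add: l1_def l2_def prod_eq_iff)
  ultimately show "k \<in> tile n" unfolding tile_def by blast
qed (auto simp: tile_def l1_def l2_def field_simps)

text \<open>One of the two copies of the angle pairs modulo 2 pi: \<open>tiles 0\<close> is the
  central square, while \<open>tiles 1\<close> consists of its four quadrants, each moved by one
  period in one angle.\<close>

definition tiles :: "nat \<Rightarrow> (real \<times> real) set" where
  "tiles \<mu> = (\<Union>n\<in>{1..4}. tile (n + 4 * \<mu>))"

lemma tiles_0: "k \<in> tiles 0 \<longleftrightarrow> l1 k \<in> {-pi..pi} \<and> l2 k \<in> {-pi..pi}"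
proof -
  have "{1..4::nat} = {1,2,3,4}" by auto
  then show ?thesis
    by (auto simp: tiles_def mem_tile_iff tile_box_def)
qed

lemma tiles_1: "k \<in> tiles 1 \<longleftrightarrow>
    l1 k \<in> {-2*pi..-pi} \<and> l2 k \<in> {0..pi} \<or> l1 k \<in> {-pi..0} \<and> l2 k \<in> {-2*pi..-pi} \<or>
    l1 k \<in> {pi..2*pi} \<and> l2 k \<in> {-pi..0} \<or> l1 k \<in> {0..pi} \<and> l2 k \<in> {pi..2*pi}"
proof -
  have "{1..4::nat} = {1,2,3,4}" by auto
  then show ?thesis
    by (auto simp: tiles_def mem_tile_iff tile_box_def)
qed

lemma sin_sign_intervals:
  "x \<in> {-2*pi..-pi} \<Longrightarrow> 0 \<le> sin x" "x \<in> {-pi..0} \<Longrightarrow> sin x \<le> 0"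
  "x \<in> {0..pi} \<Longrightarrow> 0 \<le> sin x" "x \<in> {pi..2*pi} \<Longrightarrow> sin x \<le> 0"
proof -
  show "x \<in> {-2*pi..-pi} \<Longrightarrow> 0 \<le> sin x"
    using sin_ge_zero[of "x + 2 * pi"] by simp
  show "x \<in> {-pi..0} \<Longrightarrow> sin x \<le> 0"
    using sin_ge_zero[of "- x"] by simp
  show "x \<in> {0..pi} \<Longrightarrow> 0 \<le> sin x"
    using sin_ge_zero[of x] by simp
  show "x \<in> {pi..2*pi} \<Longrightarrow> sin x \<le> 0"
    using sin_ge_zero[of "2 * pi - x"] by (simp add: sin_diff)
qed

lemma sin_ne_zero_ends:
  assumes "sin x \<noteq> 0"
  shows "x \<noteq> 0" "x \<noteq> pi" "x \<noteq> - pi" "x \<noteq> 2 * pi" "x \<noteq> - (2 * pi)"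
  using assms by auto

lemma congruent_eq:
  assumes "sin x = sin x'" "cos x = cos x'" "\<bar>x - x'\<bar> < 2 * pi"
  shows "x = x'"
proof -
  obtain n :: int where n: "x = x' + 2 * pi * n"
    using sin_cos_eq_iff[of x x'] assms by auto
  then have "\<bar>2 * pi * n\<bar> < 2 * pi" using assms(3) by simp
  then have "\<bar>real_of_int n\<bar> < 1" by (simp add: abs_mult)
  then have "n = 0" by linarith
  then show ?thesis using n by simp
qed

text \<open>Each of the four boxes has its own sign pattern of the two sines, so the signs identify
  the box.\<close>

lemma tiles_1_sin:
  assumes "k \<in> tiles 1" "sin (l1 k) \<noteq> 0" "sin (l2 k) \<noteq> 0"
  shows "l1 k \<in> {if sin (l1 k) > 0 then if sin (l2 k) > 0 then -2*pi else 0
                   else if sin (l2 k) > 0 then -pi else pi <..<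
                 if sin (l1 k) > 0 then if sin (l2 k) > 0 then -pi else pi
                   else if sin (l2 k) > 0 then 0 else 2*pi}" (is ?A)
    and "l2 k \<in> {if sin (l2 k) > 0 then if sin (l1 k) > 0 then 0 else -2*pi
                   else if sin (l1 k) > 0 then pi else -pi <..<
                 if sin (l2 k) > 0 then if sin (l1 k) > 0 then pi else -pi
                   else if sin (l1 k) > 0 then 2*pi else 0}" (is ?B)
proof -
  note e = sin_ne_zero_ends[OF assms(2)] sin_ne_zero_ends[OF assms(3)]
  have "?A \<and> ?B"
    using assms(1)[unfolded tiles_1]
  proof (elim disjE conjE)
    assume h: "l1 k \<in> {-2*pi..-pi}" "l2 k \<in> {0..pi}"
    have "sin (l1 k) > 0" "sin (l2 k) > 0"
      using sin_sign_intervals(1)[OF h(1)] sin_sign_intervals(3)[OF h(2)] assms by auto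
    then show ?thesis using h e by auto
  next
    assume h: "l1 k \<in> {-pi..0}" "l2 k \<in> {-2*pi..-pi}"
    have "\<not> sin (l1 k) > 0" "sin (l2 k) > 0"
      using sin_sign_intervals(2)[OF h(1)] sin_sign_intervals(1)[OF h(2)] assms by auto
    then show ?thesis using h e by auto
  next
    assume h: "l1 k \<in> {pi..2*pi}" "l2 k \<in> {-pi..0}"
    have "\<not> sin (l1 k) > 0" "\<not> sin (l2 k) > 0"
      using sin_sign_intervals(4)[OF h(1)] sin_sign_intervals(2)[OF h(2)] assms by auto
    then show ?thesis using h e by auto
  next
    assume h: "l1 k \<in> {0..pi}" "l2 k \<in> {pi..2*pi}"
    have "sin (l1 k) > 0" "\<not> sin (l2 k) > 0"
      using sin_sign_intervals(3)[OF h(1)] sin_sign_intervals(4)[OF h(2)] assms by auto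
    then show ?thesis using h e by auto
  qed
  then show ?A ?B by blast+
qed

lemma tiles_unique:
  assumes "\<mu> \<in> {0, 1}" "k \<in> tiles \<mu>" "k' \<in> tiles \<mu>" "sin (l1 k) \<noteq> 0" "sin (l2 k) \<noteq> 0"
    and sc: "sin (l1 k) = sin (l1 k')" "cos (l1 k) = cos (l1 k')"
            "sin (l2 k) = sin (l2 k')" "cos (l2 k) = cos (l2 k')"
  shows "k = k'"
proof -
  \<comment> \<open>Nonzero sines make both points interior. In \<open>tiles 0\<close> each angle
    lies in an open interval of length 2 pi; in \<open>tiles 1\<close> the common signs put both
    points in the same box.\<close>
  have "\<bar>l1 k - l1 k'\<bar> < 2 * pi \<and> \<bar>l2 k - l2 k'\<bar> < 2 * pi"
  proof (cases "\<mu> = 0")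
    case True
    then show ?thesis
      using assms(2,3) sin_ne_zero_ends[OF assms(4)] sin_ne_zero_ends[OF assms(5)]
      by (auto simp: tiles_0)
  next
    case False
    then have "k \<in> tiles 1" "k' \<in> tiles 1" using assms by auto
    then show ?thesis
      using tiles_1_sin[of k] tiles_1_sin[of k'] assms(4,5) pi_gt_zero unfolding sc
      by (auto split: if_splits)
  qed
  then have "l1 k = l1 k'" "l2 k = l2 k'" using congruent_eq sc by blast+
  then show ?thesis by (simp add: l1_def l2_def prod_eq_iff)
qed

lemma tiles_exists:
  assumes "\<mu> \<in> {0, 1}" "c1\<^sup>2 + s1\<^sup>2 = 1" "c2\<^sup>2 + s2\<^sup>2 = 1"
  obtains k where "k \<in> tiles \<mu>" "sin (l1 k) = s1" "cos (l1 k) = c1" "sin (l2 k) = s2" "cos (l2 k) = c2"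
proof -
  have ang: "\<exists>x. (if s \<ge> 0 then x \<in> {0..pi} else x \<in> {-pi..0}) \<and> sin x = s \<and> cos x = c" if "c\<^sup>2 + s\<^sup>2 = 1" for c s :: real
  proof -
    have c1: "\<bar>c\<bar> \<le> 1" using that by (metis abs_square_le_1 le_add_same_cancel1 zero_le_power2)
    have "sqrt (1 - c\<^sup>2) = \<bar>s\<bar>" using that by (metis add_diff_cancel_left' real_sqrt_abs)
    then have s: "sin (arccos c) = \<bar>s\<bar>" using c1 by (simp add: sin_arccos abs_le_iff)
    show ?thesis
    proof (cases "s \<ge> 0")
      case True
      then show ?thesis using s c1 by (intro exI[of _ "arccos c"]) (auto simp: arccos_lbound arccos_ubound abs_le_iff)
    next
      case False
      then show ?thesis using s c1 by (intro exI[of _ "- arccos c"]) (auto simp: arccos_lbound arccos_ubound abs_le_iff)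
    qed
  qed
  obtain x where x: "if s1 \<ge> 0 then x \<in> {0..pi} else x \<in> {-pi..0}" "sin x = s1" "cos x = c1"
    using ang[OF assms(2)] by blast
  obtain y where y: "if s2 \<ge> 0 then y \<in> {0..pi} else y \<in> {-pi..0}" "sin y = s2" "cos y = c2"
    using ang[OF assms(3)] by blast
  \<comment> \<open>For \<mu> = 1 exactly one of the two principal angles is moved by one period;
    the signs of the sines tell which and in which direction.\<close>
  define i :: real where "i = (if \<mu> = 0 then 0 else if s1 \<ge> 0 \<and> s2 \<ge> 0 then -1 else if s1 < 0 \<and> s2 < 0 then 1 else 0)"
  define j :: real where "j = (if \<mu> = 0 then 0 else if s1 < 0 \<and> s2 \<ge> 0 then -1 else if s1 \<ge> 0 \<and> s2 < 0 then 1 else 0)"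
  define k where "k = ((x + 2 * pi * i - (y + 2 * pi * j)) / 2, (x + 2 * pi * i + (y + 2 * pi * j)) / 2)"
  have k: "l1 k = x + 2 * pi * i" "l2 k = y + 2 * pi * j"
    by (simp_all add: k_def l1_def l2_def field_simps)
  have per: "sin (z + 2 * pi * r) = sin z" "cos (z + 2 * pi * r) = cos z" if "r \<in> {-1,0,1}" for z r :: real
    using that by (auto simp: sin_diff cos_diff)
  have ij: "i \<in> {-1,0,1}" "j \<in> {-1,0,1}" by (auto simp: i_def j_def)
  have "k \<in> tiles \<mu>"
  proof (cases "\<mu> = 0")
    case True
    then have "i = 0" "j = 0" by (simp_all add: i_def j_def)
    then show ?thesis using True x y k by (auto simp: tiles_0 split: if_splits)
  next
    case False
    then have "\<mu> = 1" using assms by simp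
    have "k \<in> tiles 1"
      using x(1) y(1) False unfolding tiles_1 k i_def j_def
      by (cases "s1 \<ge> 0"; cases "s2 \<ge> 0"; auto)
    then show ?thesis by (simp add: \<open>\<mu> = 1\<close>)
  qed
  then show thesis using that[of k] k per ij x y by simp
qed

section \<open>Injectivity and surjectivity of the velocity on each branch\<close>

context walk_params begin

definition ridx :: "nat \<Rightarrow> nat \<Rightarrow> nat" where
  "ridx \<nu> \<xi> = 2 * (\<nu> + 1) - \<xi>"

lemma K_iff: "k \<in> K a1 a2 \<mu> \<nu> \<xi> \<longleftrightarrow> k \<in> tiles \<mu> \<and> csl k \<in> cos_region a1 a2 (ridx \<nu> \<xi>)"
  by (simp add: K_def tiles_def ridx_def)

lemma ridx_range: "\<nu> \<in> {0,1} \<Longrightarrow> \<xi> \<in> {0,1} \<Longrightarrow> ridx \<nu> \<xi> \<in> {1..4}"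
  by (auto simp: ridx_def)

lemma sign_scaled_unique:
  fixes s A B :: real
  assumes "s * s = 1" "0 \<le> s * A" "0 \<le> s * B" "A\<^sup>2 = B\<^sup>2"
  shows "A = B"
proof -
  have "(s * A)\<^sup>2 = (s * B)\<^sup>2" using assms(4) by (simp add: power_mult_distrib)
  then have "s * A = s * B" using assms(2,3) power2_eq_imp_eq by blast
  then show ?thesis using assms(1) by (metis mult_left_cancel mult_zero_left zero_neq_one)
qed

text \<open>Only \<open>k\<close> is assumed to have nonzero sines; those of \<open>k'\<close> turn
  out to be equal. The asymmetry matters later, where \<open>k'\<close> is produced by a choice
  operator and nothing more is known about it than membership in \<open>K\<close>.\<close>

lemma velocity_inj:
  assumes "\<mu> \<in> {0,1}" "\<nu> \<in> {0,1}" "\<xi> \<in> {0,1}"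
    and k: "k \<in> K a1 a2 \<mu> \<nu> \<xi>" "k' \<in> K a1 a2 \<mu> \<nu> \<xi>"
    and sin: "sin (l1 k) \<noteq> 0" "sin (l2 k) \<noteq> 0"
    and eq: "velocity a1 a2 k = velocity a1 a2 k'"
  shows "k = k'"
proof -
  define m where "m = ridx \<nu> \<xi>"
  have m: "m \<in> {1..4}" unfolding m_def using assms ridx_range by blast
  define r r' where "r = sqrt (W k)" and "r' = sqrt (W k')"
  have r: "0 < r" "0 < r'" "r\<^sup>2 = W k" "r'\<^sup>2 = W k'"
    using W_pos[of k] W_pos[of k'] by (simp_all add: r_def r'_def)
  have s1: "sin (l1 k) / r = sin (l1 k') / r'"
  proof -
    have "- a * sin (l1 k) / r = - a * sin (l1 k') / r'"
      using velocity_half(1)[of k] velocity_half(1)[of k'] eq by (simp only: r_def r'_def)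
    then show ?thesis using ab_pos r by (simp add: frac_eq_eq)
  qed
  have s2: "sin (l2 k) / r = sin (l2 k') / r'"
  proof -
    have "- b * sin (l2 k) / r = - b * sin (l2 k') / r'"
      using velocity_half(2)[of k] velocity_half(2)[of k'] eq by (simp only: r_def r'_def)
    then show ?thesis using ab_pos r by (simp add: frac_eq_eq)
  qed
  have sg: "0 \<le> sign1 m * lin1 (csl k)" "0 \<le> sign2 m * lin2 (csl k)"
      "0 \<le> sign1 m * lin1 (csl k')" "0 \<le> sign2 m * lin2 (csl k')"
    using k cos_region_iff[OF m] by (simp_all add: K_iff m_def)
  have A: "lin1 (csl k) / r = lin1 (csl k') / r'"
  proof (rule sign_scaled_unique[of "sign1 m"])
    show "(lin1 (csl k) / r)\<^sup>2 = (lin1 (csl k') / r')\<^sup>2"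
      using F_velocity(1)[of k] F_velocity(1)[of k'] eq by (simp add: power_divide r)
  qed (use sg r sign_sq in \<open>simp_all add: zero_le_divide_iff\<close>)
  have B: "lin2 (csl k) / r = lin2 (csl k') / r'"
  proof (rule sign_scaled_unique[of "sign2 m"])
    show "(lin2 (csl k) / r)\<^sup>2 = (lin2 (csl k') / r')\<^sup>2"
      using F_velocity(2)[of k] F_velocity(2)[of k'] eq by (simp add: power_divide r)
  qed (use sg r sign_sq in \<open>simp_all add: zero_le_divide_iff\<close>)
  \<comment> \<open>Determinant of the two linear forms; the facts \<open>c1\<close> and
    \<open>c2\<close> are Cramer's rule.\<close>
  define D where "D = (a2 * b1)\<^sup>2 - (a1 * b2)\<^sup>2"
  have D: "D \<noteq> 0" using cross_ne by (simp add: D_def)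
  have c1: "x = (a2 * b1 * lin1 (x, y) - a1 * b2 * lin2 (x, y)) / D" for x y
    using D by (simp add: lin1_def lin2_def D_def field_simps power2_eq_square)
  have c2: "y = (a2 * b1 * lin2 (x, y) - a1 * b2 * lin1 (x, y)) / D" for x y
    using D by (simp add: lin1_def lin2_def D_def field_simps power2_eq_square)
  have "cos (l1 k) / r = (a2 * b1 * (lin1 (csl k) / r) - a1 * b2 * (lin2 (csl k) / r)) / D"
    by (subst c1[of "cos (l1 k)" "cos (l2 k)"]) (simp add: diff_divide_distrib mult.commute)
  also have "\<dots> = cos (l1 k') / r'"
    unfolding A B by (subst (3) c1[of "cos (l1 k')" "cos (l2 k')"]) (simp add: diff_divide_distrib mult.commute)
  finally have C1: "cos (l1 k) / r = cos (l1 k') / r'" .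
  have "cos (l2 k) / r = (a2 * b1 * (lin2 (csl k) / r) - a1 * b2 * (lin1 (csl k) / r)) / D"
    by (subst c2[of "cos (l2 k)" "cos (l1 k)"]) (simp add: diff_divide_distrib mult.commute)
  also have "\<dots> = cos (l2 k') / r'"
    unfolding A B by (subst (3) c2[of "cos (l2 k')" "cos (l1 k')"]) (simp add: diff_divide_distrib mult.commute)
  finally have C2: "cos (l2 k) / r = cos (l2 k') / r'" .
  have "1 / r\<^sup>2 = (cos (l1 k) / r)\<^sup>2 + (sin (l1 k) / r)\<^sup>2"
    by (simp add: power_divide add_divide_distrib[symmetric])
  also have "\<dots> = 1 / r'\<^sup>2"
    unfolding C1 s1 by (simp add: power_divide add_divide_distrib[symmetric])
  finally have "r\<^sup>2 = r'\<^sup>2" by simp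
  then have "r = r'" using r(1,2) by simp
  then have "sin (l1 k) = sin (l1 k')" "cos (l1 k) = cos (l1 k')"
            "sin (l2 k) = sin (l2 k')" "cos (l2 k) = cos (l2 k')"
    using s1 s2 C1 C2 r by simp_all
  then show ?thesis
    using tiles_unique[OF assms(1)] k sin by (simp add: K_iff)
qed

lemma velocity_surj:
  assumes idx: "\<mu> \<in> {0,1}" "\<nu> \<in> {0,1}" "\<xi> \<in> {0,1}"
    and v: "0 < F a1 v" "0 < F a2 v"
  obtains k where "k \<in> K a1 a2 \<mu> \<nu> \<xi>" "velocity a1 a2 k = v"
proof -
  define m where "m = ridx \<nu> \<xi>"
  have m: "m \<in> {1..4}" unfolding m_def using assms ridx_range by blast
  define p q where "p = (fst v + snd v) / 2" and "q = (fst v - snd v) / 2"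
  define R1 R2 where "R1 = sign1 m * sqrt (F a1 v)" and "R2 = sign2 m * sqrt (F a2 v)"
  define D where "D = (a2 * b1)\<^sup>2 - (a1 * b2)\<^sup>2"
  have D: "D \<noteq> 0" using cross_ne by (simp add: D_def)
  \<comment> \<open>Prospective values of c_i / sqrt W: the two forms are inverted at the values
    \<open>R1\<close>, \<open>R2\<close>, whose squares are prescribed by v and whose signs by the
    region.\<close>
  define x y where "x = (a2 * b1 * R1 - a1 * b2 * R2) / D" and "y = (a2 * b1 * R2 - a1 * b2 * R1) / D"
  have lin: "a2 * b1 * x + a1 * b2 * y = R1" "a1 * b2 * x + a2 * b1 * y = R2"
    using D by (simp_all add: x_def y_def field_simps) (simp_all add: D_def algebra_simps power2_eq_square)
  have R: "R1\<^sup>2 = F a1 v" "R2\<^sup>2 = F a2 v"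
    using v sign_sq by (simp_all add: R1_def R2_def power_mult_distrib) (simp_all add: power2_eq_square)
  define X Y where "X = (p / a)\<^sup>2" and "Y = (q / b)\<^sup>2"
  define M where "M = 1 + (a1 * a2 * x - b1 * b2 * y)\<^sup>2"
  have e1: "(a2 * b1 * x + a1 * b2 * y)\<^sup>2 = 1 - a2\<^sup>2 * X - b2\<^sup>2 * Y"
    unfolding lin R F_half X_def Y_def prod_a_def prod_b_def p_def[symmetric] q_def[symmetric]
    using coeff_pos by (simp add: power_divide power_mult_distrib)
  have e2: "(a1 * b2 * x + a2 * b1 * y)\<^sup>2 = 1 - a1\<^sup>2 * X - b1\<^sup>2 * Y"
    unfolding lin R F_half X_def Y_def prod_a_def prod_b_def p_def[symmetric] q_def[symmetric]
    using coeff_pos by (simp add: power_divide power_mult_distrib)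
  have xX: "x\<^sup>2 + X = M" and yY: "y\<^sup>2 + Y = M"
    using inverse_branch_identity[OF coeff_sq cross_ne e1 e2] by (simp_all add: M_def)
  have M: "M > 0" unfolding M_def by (simp add: add_pos_nonneg)
  \<comment> \<open>\<open>M\<close> will turn out to be 1 / W, so \<open>r\<close> stands for 1 /
    sqrt W, the reciprocal of the \<open>r\<close> in the injectivity proof. Division by it puts
    both angles on the unit circle.\<close>
  define r where "r = sqrt M"
  have r: "0 < r" "r\<^sup>2 = M" using M by (simp_all add: r_def)
  have c1: "(x / r)\<^sup>2 + (- p / a / r)\<^sup>2 = 1" and c2: "(y / r)\<^sup>2 + (- q / b / r)\<^sup>2 = 1"
    using xX yY r M by (simp_all add: power_divide power_mult_distrib X_def Y_def add_divide_distrib[symmetric] divide_divide_eq_left[symmetric]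
        del: divide_divide_eq_left)
  obtain k where k: "k \<in> tiles \<mu>" "sin (l1 k) = - p / a / r" "cos (l1 k) = x / r"
      "sin (l2 k) = - q / b / r" "cos (l2 k) = y / r"
    using tiles_exists[OF idx(1) c1 c2] by metis
  have "csl k \<in> cos_region a1 a2 m"
  proof -
    have "lin1 (csl k) = R1 / r" "lin2 (csl k) = R2 / r"
      using lin by (simp_all add: lin1_def lin2_def k add_divide_distrib[symmetric])
    moreover have "0 \<le> sign1 m * (R1 / r)" "0 \<le> sign2 m * (R2 / r)"
      using r v sign_sq by (simp_all add: R1_def R2_def mult.assoc[symmetric])
    ultimately show ?thesis
      unfolding cos_region_iff[OF m] by (metis abs_cos_le_one fst_conv snd_conv)
  qed
  then have kK: "k \<in> K a1 a2 \<mu> \<nu> \<xi>" using k by (simp add: K_iff m_def)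
  have "\<tau> a1 a2 k = (a1 * a2 * x - b1 * b2 * y) / r"
    by (simp add: \<tau>_def k prod_a_def prod_b_def diff_divide_distrib)
  then have "W k = 1 - (a1 * a2 * x - b1 * b2 * y)\<^sup>2 / M"
    by (simp add: tau_compl_def power_divide r)
  also have "\<dots> = (M - (a1 * a2 * x - b1 * b2 * y)\<^sup>2) / M"
    using M by (simp add: diff_divide_distrib mult.commute)
  also have "\<dots> = 1 / M" by (simp add: M_def)
  finally have "sqrt (W k) = 1 / r" by (simp add: r_def real_sqrt_divide)
  then have "(fst (velocity a1 a2 k) + snd (velocity a1 a2 k)) / 2 = p"
    "(fst (velocity a1 a2 k) - snd (velocity a1 a2 k)) / 2 = q"
    unfolding velocity_half k using ab_pos r by simp_all
  then have "velocity a1 a2 k = v"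
    unfolding p_def q_def by (simp add: prod_eq_iff)
  then show thesis using that kK by blast
qed

lemma generic_image:
  assumes "sin (l1 k) \<noteq> 0" "sin (l2 k) \<noteq> 0" "F a1 (velocity a1 a2 k) > 0" "F a2 (velocity a1 a2 k) > 0"
  shows "gen k"
  using assms W_pos[of k] unfolding F_velocity generic_def \<phi>_lin by auto

lemma generic_F_pos:
  assumes "gen k"
  shows "F a1 (velocity a1 a2 k) > 0" "F a2 (velocity a1 a2 k) > 0"
  using assms W_pos[of k] unfolding F_velocity generic_def \<phi>_lin by auto

text \<open>The determinant of (p, q) in the angles is a b \<phi> / W^2; the factor 4 collects the
  determinants 2 of k to (l1, l2) and -2 of (p, q) to (p + q, p - q), up to sign.\<close>

definition jac :: "real \<times> real \<Rightarrow> real" where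
  "jac k = 4 * a * b * \<bar>\<phi> a1 a2 (csl k)\<bar> / (W k)\<^sup>2"

text \<open>For the matching sign, s \<bar>\<phi>\<bar> = \<phi>, so the square root in the
  numerator of \<open>f\<close> becomes the rational term \<phi> / W, and
  \<open>F0_numerator_identity\<close> cancels the factors 1 - v_i^2.\<close>

lemma f_velocity:
  assumes "gen k" and s: "s \<in> {1, -1}" "0 \<le> s * \<phi> a1 a2 (csl k)"
  shows "jac k * (pi\<^sup>2 * f a1 a2 s (velocity a1 a2 k)) = 1"
proof -
  define V where "V = W k"
  have V: "V > 0" using W_pos V_def by simp
  define v where "v = velocity a1 a2 k"
  define p q where "p = (fst v + snd v) / 2" and "q = (fst v - snd v) / 2"
  define ph where "ph = \<phi> a1 a2 (csl k)"
  have ph0: "ph \<noteq> 0" using assms(1) by (simp add: generic_def ph_def)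
  have sph: "s * \<bar>ph\<bar> = ph" using s by (auto simp: ph_def)
  have pq: "p = - a * sin (l1 k) / sqrt V" "q = - b * sin (l2 k) / sqrt V"
    unfolding p_def q_def v_def V_def by (rule velocity_half)+
  have p2: "p\<^sup>2 = (a * sin (l1 k))\<^sup>2 / V" and q2: "q\<^sup>2 = (b * sin (l2 k))\<^sup>2 / V"
    unfolding pq using V by (simp_all add: power_divide)
  have fs: "fst v = - (a * sin (l1 k) + b * sin (l2 k)) / sqrt V"
           "snd v = - (a * sin (l1 k) - b * sin (l2 k)) / sqrt V"
    by (simp_all add: v_def velocity_def V_def tau_compl_def)
  have f2: "1 - (fst v)\<^sup>2 = (V - (a * sin (l1 k) + b * sin (l2 k))\<^sup>2) / V"
           "1 - (snd v)\<^sup>2 = (V - (a * sin (l1 k) - b * sin (l2 k))\<^sup>2) / V"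
  proof -
    have "(- c / sqrt V)\<^sup>2 = c\<^sup>2 / V" for c using V by (simp add: power_divide)
    then show "1 - (fst v)\<^sup>2 = (V - (a * sin (l1 k) + b * sin (l2 k))\<^sup>2) / V"
           "1 - (snd v)\<^sup>2 = (V - (a * sin (l1 k) - b * sin (l2 k))\<^sup>2) / V"
      unfolding fs using V by (simp_all only: diff_divide_distrib) simp_all
  qed
  define Pi where "Pi = (1 - (fst v)\<^sup>2) * (1 - (snd v)\<^sup>2)"
  have Pi0: "Pi > 0"
    unfolding Pi_def using components_lt_1[of v] generic_F_pos[OF assms(1)] by (simp add: v_def)
  have id: "cross_sq a1 a2 * V - (b1\<^sup>2 + b2\<^sup>2) * (a * sin (l1 k))\<^sup>2 - (a1\<^sup>2 + a2\<^sup>2) * (b * sin (l2 k))\<^sup>2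
      + 2 * (a * b) * ph = Pi * V\<^sup>2"
  proof -
    have "cross_sq a1 a2 * V - (b1\<^sup>2 + b2\<^sup>2) * (a * sin (l1 k))\<^sup>2 - (a1\<^sup>2 + a2\<^sup>2) * (b * sin (l2 k))\<^sup>2
      + 2 * (a * b) * ph = (V - (a * sin (l1 k) + b * sin (l2 k))\<^sup>2) * (V - (a * sin (l1 k) - b * sin (l2 k))\<^sup>2)"
      using F0_numerator_identity[OF coeff_sq, of "cos (l1 k)" "sin (l1 k)" "cos (l2 k)" "sin (l2 k)"]
      by (simp add: cross_sq_def V_def tau_compl_def \<tau>_def ph_def \<phi>_lin lin1_def lin2_def prod_a_def prod_b_def)
    also have "\<dots> = Pi * V\<^sup>2" unfolding Pi_def f2 using V by (simp add: power2_eq_square)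
    finally show ?thesis .
  qed
  have cr: "cross_sq a1 a2 > 0" unfolding cross_sq_def using coeff_pos by (simp add: add_pos_pos)
  have "F0 a1 a2 v = cross_sq a1 a2 / (2 * a * b) * (1 - p\<^sup>2 / a0_sq a1 a2 - q\<^sup>2 / b0_sq a1 a2)"
    by (simp add: F0_def split_beta p_def q_def power_divide)
  also have "\<dots> = (cross_sq a1 a2 - (b1\<^sup>2 + b2\<^sup>2) * p\<^sup>2 - (a1\<^sup>2 + a2\<^sup>2) * q\<^sup>2) / (2 * a * b)"
    unfolding a0_sq_def b0_sq_def using cr by (simp add: right_diff_distrib diff_divide_distrib mult_ac)
  also have "\<dots> = (cross_sq a1 a2 * V - (b1\<^sup>2 + b2\<^sup>2) * (a * sin (l1 k))\<^sup>2 - (a1\<^sup>2 + a2\<^sup>2) * (b * sin (l2 k))\<^sup>2) / (2 * a * b * V)"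
    unfolding p2 q2 using V by (simp add: diff_divide_distrib mult_ac)
  finally have F0: "F0 a1 a2 v = (Pi * V\<^sup>2 - 2 * (a * b) * ph) / (2 * a * b * V)"
    using id by (simp add: algebra_simps)
  have sF: "sqrt (F a1 v * F a2 v) = \<bar>ph\<bar> / V"
  proof -
    have "F a1 v * F a2 v = (ph / V)\<^sup>2"
      by (simp add: v_def F_velocity V_def ph_def \<phi>_lin power_divide power_mult_distrib power2_eq_square)
    then show ?thesis using V by simp
  qed
  have num: "F0 a1 a2 v + s * sqrt (F a1 v * F a2 v) = Pi * V / (2 * a * b)"
    unfolding F0 sF using sph V ab_pos by (simp add: field_simps power2_eq_square)
  have ind: "indicator (E a1 \<inter> E a2) v = (1::real)"
    using velocity_in_E[of k] by (simp add: v_def)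
  have "f a1 a2 s v = (Pi * V / (2 * a * b)) / (2 * pi\<^sup>2 * Pi * (\<bar>ph\<bar> / V))"
    unfolding f_def num unfolding ind sF Pi_def by (simp add: mult.assoc)
  also have "\<dots> = V\<^sup>2 / (4 * pi\<^sup>2 * a * b * \<bar>ph\<bar>)"
    using Pi0 V ab_pos ph0 by (simp add: field_simps power2_eq_square)
  finally have "jac k * (pi\<^sup>2 * f a1 a2 s v) = 4 * a * b * \<bar>ph\<bar> / V\<^sup>2 * (pi\<^sup>2 * (V\<^sup>2 / (4 * pi\<^sup>2 * a * b * \<bar>ph\<bar>)))"
    by (simp add: jac_def V_def ph_def)
  also have "\<dots> = 1" using V ab_pos ph0 by (simp add: field_simps)
  finally show ?thesis by (simp add: v_def)
qed

end

section \<open>Change of variables in the plane\<close>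

text \<open>The Jacobian formula with \<open>det\<close> and \<open>matrix\<close> lives on
  \<open>real ^ 2\<close>; these two maps carry it to pairs.\<close>

definition pair_of_vec :: "real ^ 2 \<Rightarrow> real \<times> real" where
  "pair_of_vec x = (x $ 1, x $ 2)"

definition vec_of_pair :: "real \<times> real \<Rightarrow> real ^ 2" where
  "vec_of_pair v = (\<chi> i. if i = 1 then fst v else snd v)"

lemma pair_vec_inverse [simp]: "pair_of_vec (vec_of_pair v) = v" "vec_of_pair (pair_of_vec x) = x"
  by (auto simp: pair_of_vec_def vec_of_pair_def vec_eq_iff) (metis (full_types) exhaust_2)

lemma linear_pair_vec: "linear pair_of_vec" "linear vec_of_pair"
  by (auto simp: linear_iff pair_of_vec_def vec_of_pair_def vec_eq_iff)

lemma bounded_linear_pair_vec: "bounded_linear pair_of_vec" "bounded_linear vec_of_pair"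
  using linear_pair_vec by (simp_all add: linear_conv_bounded_linear)

lemma measurable_pair_vec [measurable]:
  "pair_of_vec \<in> borel_measurable borel" "vec_of_pair \<in> borel_measurable borel"
  by (intro borel_measurable_continuous_onI linear_continuous_on bounded_linear_pair_vec)+

lemma lborel_pair_of_vec: "distr lborel borel pair_of_vec = lborel"
proof (rule lborel_eqI[symmetric])
  fix l u :: "real \<times> real"
  assume le: "\<And>b. b \<in> Basis \<Longrightarrow> l \<bullet> b \<le> u \<bullet> b"
  have le': "fst l \<le> fst u" "snd l \<le> snd u"
    using le[of "(1, 0)"] le[of "(0, 1)"] by (auto simp: Basis_prod_def inner_prod_def)
  have "pair_of_vec -` box l u = box (vec_of_pair l) (vec_of_pair u)"
  proof -
    have "z \<in> box l u \<longleftrightarrow> fst l < fst z \<and> fst z < fst u \<and> snd l < snd z \<and> snd z < snd u" for z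
      by (auto simp: box_def Basis_prod_def inner_prod_def)
    then show ?thesis
      by (auto simp: mem_box_cart pair_of_vec_def vec_of_pair_def forall_2)
  qed
  then have "emeasure (distr lborel borel pair_of_vec) (box l u)
      = emeasure lborel (box (vec_of_pair l) (vec_of_pair u))"
    by (subst emeasure_distr) simp_all
  also have "\<dots> = (\<Prod>b\<in>Basis. (vec_of_pair u - vec_of_pair l) \<bullet> b)"
    using le' by (intro emeasure_lborel_box)
      (auto simp: Basis_vec_def inner_axis vec_of_pair_def)
  also have "(\<Prod>b\<in>Basis. (vec_of_pair u - vec_of_pair l) \<bullet> b)
      = (\<Prod>i\<in>UNIV. (vec_of_pair u - vec_of_pair l) $ i)"
  proof -
    have B: "(Basis :: (real ^ 2) set) = range (\<lambda>i. axis i 1)" by (auto simp: Basis_vec_def)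
    show ?thesis
      unfolding B by (subst prod.reindex) (auto intro!: inj_onI simp: axis_eq_axis inner_axis)
  qed
  also have "\<dots> = (\<Prod>b\<in>Basis. (u - l) \<bullet> b)"
    by (simp add: UNIV_2 vec_of_pair_def Basis_prod_def prod.union_disjoint inner_prod_def)
  finally show "emeasure (distr lborel borel pair_of_vec) (box l u) = (\<Prod>b\<in>Basis. (u - l) \<bullet> b)" .
qed simp

lemma lborel_vec_of_pair: "distr lborel borel vec_of_pair = lborel"
  by (subst lborel_pair_of_vec[symmetric]) (simp add: distr_distr comp_def distr_id2)

lemma integrable_lborel_pair_iff:
  fixes h :: "real \<times> real \<Rightarrow> real"
  assumes [measurable]: "h \<in> borel_measurable borel"
  shows "integrable lborel (\<lambda>x. h (pair_of_vec x)) \<longleftrightarrow> integrable lborel h"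
    and "(LINT x|lborel. h (pair_of_vec x)) = (LINT v|lborel. h v)"
proof -
  show "integrable lborel (\<lambda>x. h (pair_of_vec x)) \<longleftrightarrow> integrable lborel h"
    by (subst lborel_pair_of_vec[symmetric]) (simp add: integrable_distr_eq)
  show "(LINT x|lborel. h (pair_of_vec x)) = (LINT v|lborel. h v)"
    by (subst lborel_pair_of_vec[symmetric]) (simp add: integral_distr)
qed

lemma AE_lborel_pair:
  assumes "AE x in (lborel :: (real ^ 2) measure). Q (pair_of_vec x)"
  shows "AE v in lborel. Q v"
proof -
  obtain N where N: "N \<in> null_sets lborel" "{x. \<not> Q (pair_of_vec x)} \<subseteq> N"
    using assms by (auto simp: eventually_ae_filter)
  have "vec_of_pair -` N \<in> null_sets lborel"
  proof (rule null_setsI)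
    have [measurable]: "N \<in> sets borel" using N(1) by auto
    show "vec_of_pair -` N \<in> sets lborel" using measurable_sets_borel[OF measurable_pair_vec(2)] by simp
    have "emeasure lborel N = emeasure (distr lborel borel vec_of_pair) N" by (simp add: lborel_vec_of_pair)
    also have "\<dots> = emeasure lborel (vec_of_pair -` N)" by (subst emeasure_distr) simp_all
    finally show "emeasure lborel (vec_of_pair -` N) = 0" using N(1) by auto
  qed
  moreover have "{v. \<not> Q v} \<subseteq> vec_of_pair -` N"
  proof
    fix v assume "v \<in> {v. \<not> Q v}"
    then have "vec_of_pair v \<in> {x. \<not> Q (pair_of_vec x)}" by simp
    then show "v \<in> vec_of_pair -` N" using N(2) by blast
  qed
  ultimately show ?thesis by (auto simp: eventually_ae_filter)
qed

text \<open>No measurability of \<open>h\<close> is assumed beyond what integrability of the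
  composition gives, so the transfer goes through a Borel function equal to the composition almost
  everywhere.\<close>

lemma integrable_lebesgue_pair:
  fixes h :: "real \<times> real \<Rightarrow> real"
  assumes "integrable lebesgue (\<lambda>x. h (pair_of_vec x))"
  shows "integrable lebesgue h"
    and "(LINT v|lebesgue. h v) = (LINT x|lebesgue. h (pair_of_vec x))"
proof -
  obtain H where H: "H \<in> borel_measurable lborel" "AE x in lborel. h (pair_of_vec x) = H x"
    using completion_ex_borel_measurable_real[of "\<lambda>x. h (pair_of_vec x)" lborel] assms by auto
  note [measurable] = H(1)
  have ae: "AE v in lborel. h v = H (vec_of_pair v)"
    by (rule AE_lborel_pair) (use H(2) in simp)
  have ae': "AE v in lebesgue. h v = H (vec_of_pair v)" "AE x in lebesgue. h (pair_of_vec x) = H x"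
    using ae H(2) by (auto intro: AE_completion)
  have mH: "H \<in> borel_measurable lebesgue" "(\<lambda>v. H (vec_of_pair v)) \<in> borel_measurable lebesgue"
    by (auto intro: measurable_completion)
  have mh: "h \<in> borel_measurable lebesgue"
    using ae'(1) mH(2) by (auto intro: borel_measurable_AE)
  have iH: "integrable lborel H" and eq: "(LINT x|lebesgue. h (pair_of_vec x)) = (LINT x|lborel. H x)"
    using assms integrable_cong_AE[OF borel_measurable_integrable[OF assms] mH(1) ae'(2)]
      integral_cong_AE[OF borel_measurable_integrable[OF assms] mH(1) ae'(2)]
    by (simp_all add: integrable_completion integral_completion)
  have mHv: "(\<lambda>v. H (vec_of_pair v)) \<in> borel_measurable borel" by measurable
  show "integrable lebesgue h"
    using integrable_cong_AE[OF mh mH(2) ae'(1)] integrable_lborel_pair_iff(1)[OF mHv] iH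
    by (simp add: integrable_completion)
  show "(LINT v|lebesgue. h v) = (LINT x|lebesgue. h (pair_of_vec x))"
    using integral_cong_AE[OF mh mH(2) ae'(1)] integrable_lborel_pair_iff(2)[OF mHv] eq
    by (simp add: integral_completion)
qed

text \<open>Integrability is required on the source side only, and that of \<open>h\<close> on the
  image is a conclusion. Hence a function built from a chosen inverse of \<open>g\<close> can be
  integrated without a separate proof that the inverse is measurable.\<close>

lemma change_of_variables_pair:
  fixes g :: "real \<times> real \<Rightarrow> real \<times> real" and h :: "real \<times> real \<Rightarrow> real"
  assumes S: "S \<in> sets borel"
    and der: "\<And>x. x \<in> S \<Longrightarrow> (g has_derivative g' x) (at x)"
    and inj: "inj_on g S"
    and J: "\<And>x. x \<in> S \<Longrightarrow>
      J x = \<bar>fst (g' x (1, 0)) * snd (g' x (0, 1)) - fst (g' x (0, 1)) * snd (g' x (1, 0))\<bar>"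
    and int: "set_integrable lborel S (\<lambda>x. J x * h (g x))"
  shows "set_integrable lebesgue (g ` S) h"
    and "(LINT v:g ` S|lebesgue. h v) = (LINT x:S|lborel. J x * h (g x))"
proof -
  define S' where "S' = pair_of_vec -` S"
  define G where "G x = vec_of_pair (g (pair_of_vec x))" for x
  define G' where "G' x = (\<lambda>y. vec_of_pair (g' (pair_of_vec x) (pair_of_vec y)))" for x
  \<comment> \<open>The formula is applied to vector valued integrands; one component
    suffices.\<close>
  define H :: "real ^ 2 \<Rightarrow> real ^ 1" where "H x = vec (h (pair_of_vec x))" for x
  have S': "S' \<in> sets lebesgue"
    unfolding S'_def using measurable_sets_borel[OF measurable_pair_vec(1) S] by simp
  have derG: "(G has_derivative G' x) (at x within S')" if "x \<in> S'" for x
  proof -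
    have "(pair_of_vec has_derivative pair_of_vec) (at x)"
      by (rule bounded_linear_imp_has_derivative[OF bounded_linear_pair_vec(1)])
    from diff_chain_at[OF diff_chain_at[OF this der] bounded_linear_imp_has_derivative[OF bounded_linear_pair_vec(2)]]
    have "(G has_derivative G' x) (at x)"
      using that by (simp add: S'_def G_def[abs_def] G'_def comp_def)
    then show ?thesis by (rule has_derivative_at_withinI)
  qed
  have injG: "inj_on G S'"
  proof (rule inj_onI)
    fix x y assume xy: "x \<in> S'" "y \<in> S'" "G x = G y"
    then have "g (pair_of_vec x) = g (pair_of_vec y)"
      unfolding G_def by (metis pair_vec_inverse(1))
    then have "pair_of_vec x = pair_of_vec y"
      using inj_onD[OF inj] xy by (simp add: S'_def)
    then show "x = y" by (metis pair_vec_inverse(2))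
  qed
  have im: "pair_of_vec x \<in> g ` S \<longleftrightarrow> x \<in> G ` S'" for x
  proof
    assume "pair_of_vec x \<in> g ` S"
    then obtain k where k: "k \<in> S" "pair_of_vec x = g k" by blast
    then have "G (vec_of_pair k) = x" by (simp add: G_def k(2)[symmetric])
    moreover have "vec_of_pair k \<in> S'" using k by (simp add: S'_def)
    ultimately show "x \<in> G ` S'" by blast
  qed (auto simp: G_def S'_def)
  have det: "\<bar>det (matrix (G' x))\<bar> = J (pair_of_vec x)" if "x \<in> S'" for x
  proof -
    have "pair_of_vec (axis 1 1) = (1, 0)" "pair_of_vec (axis 2 1) = (0, 1)"
      by (simp_all add: pair_of_vec_def axis_def)
    then show ?thesis
      using that by (simp add: det_2 matrix_def G'_def vec_of_pair_def J S'_def)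
  qed
  define T where "T x = J (pair_of_vec x) * h (g (pair_of_vec x))" for x
  have mT: "(\<lambda>x. indicator S x * (J x * h (g x))) \<in> borel_measurable borel"
    using int unfolding set_integrable_def by (auto dest: borel_measurable_integrable)
  have indS: "indicator S (pair_of_vec x) = (indicator S' x :: real)" for x
    by (simp add: S'_def indicator_def)
  have intT: "set_integrable lebesgue S' T" and eqT: "(LINT x:S'|lebesgue. T x) = (LINT x:S|lborel. J x * h (g x))"
  proof -
    have "integrable lborel (\<lambda>x. indicator S' x * T x)"
      using integrable_lborel_pair_iff(1)[OF mT] int by (simp add: indS T_def set_integrable_def)
    moreover have m: "(\<lambda>x. indicator S' x * T x) \<in> borel_measurable lborel"
      using calculation by (rule borel_measurable_integrable)
    ultimately show "set_integrable lebesgue S' T"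
      by (simp add: set_integrable_def integrable_completion)
    show "(LINT x:S'|lebesgue. T x) = (LINT x:S|lborel. J x * h (g x))"
      using integrable_lborel_pair_iff(2)[OF mT] m
      by (simp add: indS T_def set_lebesgue_integral_def integral_completion)
  qed
  have "(\<lambda>x. \<bar>det (matrix (G' x))\<bar> *\<^sub>R H (G x)) absolutely_integrable_on S'"
  proof -
    have "(\<lambda>x. \<bar>det (matrix (G' x))\<bar> *\<^sub>R H (G x)) absolutely_integrable_on S' \<longleftrightarrow>
        (\<lambda>x. (\<bar>det (matrix (G' x))\<bar> *\<^sub>R H (G x)) $ 1) absolutely_integrable_on S'"
      by (rule absolutely_integrable_on_1_iff)
    also have "\<dots> \<longleftrightarrow> T absolutely_integrable_on S'"
      by (intro set_integrable_cong refl) (simp add: det H_def G_def T_def)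
    finally show ?thesis using intT by simp
  qed
  then have res: "H absolutely_integrable_on (G ` S')"
      "integral (G ` S') H = integral S' (\<lambda>x. \<bar>det (matrix (G' x))\<bar> *\<^sub>R H (G x))"
    using has_absolute_integral_change_of_variables[OF S' derG injG, of H] by blast+
  have H1: "set_integrable lebesgue (G ` S') (\<lambda>x. h (pair_of_vec x))"
    using res(1) by (simp add: absolutely_integrable_on_1_iff H_def)
  have "integral (G ` S') (\<lambda>x. h (pair_of_vec x)) = integral S' T"
  proof -
    have "integral (G ` S') (\<lambda>x. h (pair_of_vec x)) = integral (G ` S') H $ 1"
      by (simp add: integral_on_1_eq H_def)
    also have "\<dots> = integral S' (\<lambda>x. (\<bar>det (matrix (G' x))\<bar> *\<^sub>R H (G x)) $ 1)"
      unfolding res(2) by (simp add: integral_on_1_eq)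
    also have "\<dots> = integral S' T"
      by (intro integral_cong) (simp add: det H_def G_def T_def)
    finally show ?thesis .
  qed
  then have H2: "(LINT x:G ` S'|lebesgue. h (pair_of_vec x)) = (LINT x:S'|lebesgue. T x)"
    using set_lebesgue_integral_eq_integral(2)[OF H1] set_lebesgue_integral_eq_integral(2)[OF intT] by simp
  have ind: "indicator (G ` S') x = (indicator (g ` S) (pair_of_vec x) :: real)" for x
    using im by (simp add: indicator_def)
  have "integrable lebesgue (\<lambda>x. (\<lambda>v. indicator (g ` S) v * h v) (pair_of_vec x))"
    using H1 by (simp add: set_integrable_def ind)
  note * = integrable_lebesgue_pair[OF this]
  show "set_integrable lebesgue (g ` S) h"
    using *(1) by (simp add: set_integrable_def)
  show "(LINT v:g ` S|lebesgue. h v) = (LINT x:S|lborel. J x * h (g x))"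
    using *(2) H2 eqT by (simp add: set_lebesgue_integral_def ind)
qed

section \<open>The torus and its tiling\<close>

text \<open>Both sets are fundamental domains for the same translations. D1 is cut according to the
  unique shift that brings a point into D2, each part is translated, and periodicity lets the parts
  reassemble to the integral over D2.\<close>

lemma integral_tiling:
  fixes H :: "real \<times> real \<Rightarrow> real" and Z :: "(real \<times> real) set"
  assumes Z: "finite Z" and D [measurable]: "D1 \<in> sets borel" "D2 \<in> sets borel"
    and per: "\<And>z k. z \<in> Z \<Longrightarrow> H (k + z) = H k"
    and t1: "AE k in lborel. k \<in> D1 \<longrightarrow> (\<exists>!z. z \<in> Z \<and> k - z \<in> D2)"
    and t2: "AE k in lborel. k \<in> D2 \<longrightarrow> (\<exists>!z. z \<in> Z \<and> k + z \<in> D1)"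
    and [measurable]: "H \<in> borel_measurable borel"
    and int: "set_integrable lborel D1 H"
  shows "set_integrable lborel D2 H" "(LINT k:D1|lborel. H k) = (LINT k:D2|lborel. H k)"
proof -
  have one: "(\<Sum>z\<in>Z. indicator A (g z)) = (1 :: real)" if "\<exists>!z. z \<in> Z \<and> g z \<in> A" for A and g :: "real \<times> real \<Rightarrow> real \<times> real"
  proof -
    obtain z0 where z0: "z0 \<in> Z" "g z0 \<in> A" "\<And>z. z \<in> Z \<Longrightarrow> g z \<in> A \<Longrightarrow> z = z0" using \<open>\<exists>!z. z \<in> Z \<and> g z \<in> A\<close> by blast
    have "(\<Sum>z\<in>Z. indicator A (g z)) = (\<Sum>z\<in>{z0}. indicator A (g z) :: real)"
    proof (rule sum.mono_neutral_right)
      show "\<forall>z\<in>Z - {z0}. indicator A (g z) = (0 :: real)"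
      proof
        fix z assume "z \<in> Z - {z0}"
        then have "g z \<notin> A" using z0(3)[of z] by blast
        then show "indicator A (g z) = (0 :: real)" by simp
      qed
    qed (use z0(1) Z in auto)
    then show ?thesis using z0(2) by simp
  qed
  define T1 where "T1 z k = indicator D1 k * H k * indicator D2 (k - z)" for z k
  define T2 where "T2 z k = indicator D2 k * H k * indicator D1 (k + z)" for z k
  have T12: "T1 z (z + k) = T2 z k" if "z \<in> Z" for z k
    using per[OF that, of k] by (simp add: T1_def T2_def add.commute)
  have [measurable]: "T1 z \<in> borel_measurable borel" "T2 z \<in> borel_measurable borel" for z
    unfolding T1_def T2_def by measurable
  have tr: "distr lborel borel ((+) z) = (lborel :: (real \<times> real) measure)" for z
    by (rule lborel_distr_plus)
  have T2eq: "T2 z = (\<lambda>k. T1 z (z + k))" if "z \<in> Z" for z using T12[OF that] by auto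
  have i1: "integrable lborel (T1 z)" for z
  proof (rule Bochner_Integration.integrable_bound)
    show "integrable lborel (\<lambda>k. indicator D1 k * H k)" using int by (simp add: set_integrable_def)
    show "AE k in lborel. norm (T1 z k) \<le> norm (indicator D1 k * H k)"
      by (auto simp: T1_def indicator_def)
  qed simp
  have i2: "integrable lborel (T2 z)" if "z \<in> Z" for z
  proof -
    have "integrable (distr lborel borel ((+) z)) (T1 z)" using i1 tr by simp
    then show ?thesis using T2eq[OF that] by (simp add: integrable_distr_eq)
  qed
  have e12: "(LINT k|lborel. T1 z k) = (LINT k|lborel. T2 z k)" if "z \<in> Z" for z
  proof -
    have "(LINT k|lborel. T1 z k) = (LINT k|distr lborel borel ((+) z). T1 z k)" using tr by simp
    also have "\<dots> = (LINT k|lborel. T1 z (z + k))" by (subst integral_distr) simp_all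
    finally show ?thesis using T12[OF that] by simp
  qed
  have s1: "AE k in lborel. indicator D1 k * H k = (\<Sum>z\<in>Z. T1 z k)"
    using t1
  proof eventually_elim
    case (elim k)
    show ?case
    proof (cases "k \<in> D1")
      case True
      then have "(\<Sum>z\<in>Z. indicator D2 (k - z)) = (1 :: real)" using elim one[of "\<lambda>z. k - z"] by blast
      then show ?thesis unfolding T1_def sum_distrib_left[symmetric] by simp
    qed (simp add: T1_def)
  qed
  have s2: "AE k in lborel. indicator D2 k * H k = (\<Sum>z\<in>Z. T2 z k)"
    using t2
  proof eventually_elim
    case (elim k)
    show ?case
    proof (cases "k \<in> D2")
      case True
      then have "(\<Sum>z\<in>Z. indicator D1 (k + z)) = (1 :: real)" using elim one[of "\<lambda>z. k + z"] by blast
      then show ?thesis unfolding T2_def sum_distrib_left[symmetric] by simp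
    qed (simp add: T2_def)
  qed
  have "integrable lborel (\<lambda>k. \<Sum>z\<in>Z. T2 z k)" using i2 by auto
  then show "set_integrable lborel D2 H"
    unfolding set_integrable_def using s2 by (subst integrable_cong_AE) (auto)
  have "(LINT k:D1|lborel. H k) = (LINT k|lborel. (\<Sum>z\<in>Z. T1 z k))"
    unfolding set_lebesgue_integral_def using s1 by (intro integral_cong_AE) auto
  also have "\<dots> = (\<Sum>z\<in>Z. LINT k|lborel. T1 z k)" using i1 by (intro Bochner_Integration.integral_sum) auto
  also have "\<dots> = (\<Sum>z\<in>Z. LINT k|lborel. T2 z k)" using e12 by (intro sum.cong) auto
  also have "\<dots> = (LINT k|lborel. (\<Sum>z\<in>Z. T2 z k))" using i2 by (intro Bochner_Integration.integral_sum[symmetric]) auto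
  also have "\<dots> = (LINT k:D2|lborel. H k)"
    unfolding set_lebesgue_integral_def using s2 by (intro integral_cong_AE) auto
  finally show "(LINT k:D1|lborel. H k) = (LINT k:D2|lborel. H k)" .
qed

section \<open>Zero sets of trigonometric expressions are null sets\<close>

lemma countable_zeros_sinusoid:
  fixes c d :: real
  assumes "c \<noteq> 0 \<or> d \<noteq> 0"
  shows "countable {y. c * cos y + d * sin y = 0}"
proof -
  define r where "r = sqrt (c\<^sup>2 + d\<^sup>2)"
  have r: "r > 0" using assms by (simp add: r_def sum_power2_gt_zero_iff)
  have "(c / r)\<^sup>2 + (d / r)\<^sup>2 = 1"
    using r by (simp add: power_divide add_divide_distrib[symmetric]) (simp add: r_def)
  \<comment> \<open>Amplitude and phase: the expression is r cos (y - t).\<close>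
  then obtain t where "c / r = cos t" "d / r = sin t" using sincos_total_2pi by metis
  then have cd: "c = r * cos t" "d = r * sin t" using r by (simp_all add: field_simps)
  have "{y. c * cos y + d * sin y = 0} \<subseteq> range (\<lambda>i::int. of_int i * (pi / 2) + t)"
  proof
    fix y assume "y \<in> {y. c * cos y + d * sin y = 0}"
    then have "r * cos (y - t) = 0" by (simp add: cd cos_diff algebra_simps)
    then have "cos (y - t) = 0" using r by simp
    then obtain i :: int where "y - t = of_int i * (pi / 2)" using cos_zero_iff_int by auto
    then have "y = of_int i * (pi / 2) + t" by simp
    then show "y \<in> range (\<lambda>i::int. of_int i * (pi / 2) + t)" by blast
  qed
  then show ?thesis by (rule countable_subset) simp
qed

text \<open>By Fubini: for each fixed first coordinate the zeros in the second are
  countable.\<close>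

lemma AE_sinusoid_ne_0:
  fixes c d :: "real \<Rightarrow> real"
  assumes [measurable]: "c \<in> borel_measurable borel" "d \<in> borel_measurable borel"
    and "\<And>x. c x \<noteq> 0 \<or> d x \<noteq> 0"
  shows "AE k in lborel. c (fst k) * cos (snd k) + d (fst k) * sin (snd k) \<noteq> 0"
proof -
  have "AE x in lborel. AE y in lborel. c x * cos y + d x * sin y \<noteq> 0"
  proof (rule AE_I2)
    fix x
    have "{y. c x * cos y + d x * sin y = 0} \<in> null_sets lborel"
      by (intro countable_imp_null_set_lborel countable_zeros_sinusoid assms)
    then show "AE y in lborel. c x * cos y + d x * sin y \<noteq> 0"
      by (rule AE_I'[where N = "{y. c x * cos y + d x * sin y = 0}"]) auto
  qed
  moreover have "(\<lambda>k. c (fst k) * cos (snd k) + d (fst k) * sin (snd k)) \<in> borel_measurable (lborel \<Otimes>\<^sub>M lborel)"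
    by measurable
  ultimately have "AE k in lborel \<Otimes>\<^sub>M lborel. c (fst k) * cos (snd k) + d (fst k) * sin (snd k) \<noteq> 0"
    by (intro lborel_pair.AE_pair_measure borel_measurable_neq borel_measurable_const) (simp_all only: fst_conv snd_conv)
  then show ?thesis by (simp only: lborel_prod)
qed

lemma sin_cos_not_both_0: "sin x \<noteq> 0 \<or> cos x \<noteq> (0::real)"
  using sin_zero_abs_cos_one[of x] by auto

lemma AE_sin_ne_0:
  "AE k in lborel. sin (l1 k) \<noteq> 0" "AE k in lborel. sin (l2 k) \<noteq> 0"
  "AE k in lborel. sin (fst k) \<noteq> (0::real) \<and> sin (snd k) \<noteq> (0::real)"
proof -
  show "AE k in lborel. sin (l1 k) \<noteq> 0"
    using AE_sinusoid_ne_0[of sin cos] sin_cos_not_both_0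
    by (simp add: l1_def sin_add mult.commute add.commute)
  show "AE k in lborel. sin (l2 k) \<noteq> 0"
    using AE_sinusoid_ne_0[of "\<lambda>x. - sin x" cos] sin_cos_not_both_0
    by (simp add: l2_def sin_diff mult.commute algebra_simps)
  have 1: "AE k in lborel. sin (snd (k :: real \<times> real)) \<noteq> 0"
    using AE_sinusoid_ne_0[of "\<lambda>_. 0" "\<lambda>_. 1"] by (simp add: split_beta)
  have "{x::real. 0 * cos x + 1 * sin x = 0} \<in> null_sets lborel"
    by (intro countable_imp_null_set_lborel countable_zeros_sinusoid) simp
  then have "AE x in lborel. AE y in lborel. sin (x::real) \<noteq> 0"
    by (intro AE_I'[where N = "{x. 0 * cos x + 1 * sin x = 0}"]) auto
  moreover have "(\<lambda>k. sin (fst k :: real)) \<in> borel_measurable (lborel \<Otimes>\<^sub>M lborel)"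
    by measurable
  ultimately have "AE k in lborel \<Otimes>\<^sub>M lborel. sin (fst k :: real) \<noteq> 0"
    by (intro lborel_pair.AE_pair_measure borel_measurable_neq borel_measurable_const) (simp_all only: fst_conv snd_conv)
  then have 2: "AE k in lborel. sin (fst (k :: real \<times> real)) \<noteq> 0" by (simp only: lborel_prod)
  show "AE k in lborel. sin (fst k) \<noteq> (0::real) \<and> sin (snd k) \<noteq> (0::real)"
    using 1 2 by eventually_elim auto
qed

text \<open>For fixed x = k1 the form \<alpha> cos l1 + \<beta> cos l2 is a sinusoid in k2 with
  coefficients (\<alpha> + \<beta>) cos x and (\<beta> - \<alpha>) sin x. These cannot both vanish,
  as \<alpha> and \<beta> are positive and distinct.\<close>

lemma (in walk_params) AE_generic: "AE k in lborel. gen k"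
proof -
  have lin: "(\<alpha> + \<beta>) * cos x * cos y + (\<beta> - \<alpha>) * sin x * sin y = \<alpha> * cos (y + x) + \<beta> * cos (y - x)" for \<alpha> \<beta> x y :: real
    by (simp add: cos_add cos_diff algebra_simps)
  have "AE k in lborel. \<alpha> * cos (l1 k) + \<beta> * cos (l2 k) \<noteq> 0" if "\<alpha> \<noteq> \<beta>" "0 < \<alpha>" "0 < \<beta>" for \<alpha> \<beta>
    using AE_sinusoid_ne_0[of "\<lambda>x. (\<alpha> + \<beta>) * cos x" "\<lambda>x. (\<beta> - \<alpha>) * sin x"] sin_cos_not_both_0 that
    by (auto simp: lin l1_def l2_def)
  from this[of "a2 * b1" "a1 * b2"] this[of "a1 * b2" "a2 * b1"] al_be
  have "AE k in lborel. lin1 (csl k) \<noteq> 0" "AE k in lborel. lin2 (csl k) \<noteq> 0"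
    by (simp_all add: lin1_def lin2_def)
  with AE_sin_ne_0(1,2) show ?thesis
    by eventually_elim (simp add: generic_def \<phi>_lin)
qed

text \<open>A finite window of periods. It contains the entries -1, 0, 1 from the existence lemmas;
  uniqueness is proved for all integers.\<close>

definition shifts :: "(real \<times> real) set" where
  "shifts = (\<lambda>(i, j). (2 * pi * of_int i, 2 * pi * of_int j)) ` ({-3..3} \<times> {-3..3 :: int})"

definition torus :: "(real \<times> real) set" where
  "torus = {-pi..pi} \<times> {-pi..pi}"

lemma sets_torus [measurable]: "torus \<in> sets borel"
  unfolding torus_def by (intro borel_closed closed_Times closed_atLeastAtMost)

lemma measurable_l [measurable]: "l1 \<in> borel_measurable borel" "l2 \<in> borel_measurable borel"
  unfolding l1_def[abs_def] l2_def[abs_def]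
  by (intro borel_measurable_continuous_onI continuous_intros)+

lemma sets_tiles [measurable]: "tiles 0 \<in> sets borel" "tiles 1 \<in> sets borel"
proof -
  have "tiles 0 = {k. l1 k \<in> {-pi..pi} \<and> l2 k \<in> {-pi..pi}}" by (auto simp: tiles_0)
  also have "\<dots> \<in> sets borel" by measurable
  finally show "tiles 0 \<in> sets borel" .
  have "tiles 1 = {k. l1 k \<in> {-2*pi..-pi} \<and> l2 k \<in> {0..pi} \<or> l1 k \<in> {-pi..0} \<and> l2 k \<in> {-2*pi..-pi} \<or>
    l1 k \<in> {pi..2*pi} \<and> l2 k \<in> {-pi..0} \<or> l1 k \<in> {0..pi} \<and> l2 k \<in> {pi..2*pi}}"
    using tiles_1 by blast
  also have "\<dots> \<in> sets borel" by measurable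
  finally show "tiles 1 \<in> sets borel" .
qed

section \<open>Torus and tiles as fundamental domains of the same lattice\<close>

lemma abs_multiple_lt_1:
  assumes "\<bar>2 * pi * of_int n\<bar> < 2 * pi"
  shows "n = (0::int)"
proof -
  have "\<bar>real_of_int n\<bar> < 1" using assms by (simp add: abs_mult)
  then show ?thesis by linarith
qed

text \<open>A parity argument: the angle shifts i + j and j - i, counted in periods, have the same
  parity. In \<open>tiles 1\<close> one angle has modulus below pi and the other lies beyond pi. The
  small one cannot have moved, so the other moves by a multiple of 4 pi; but it moves by less than 3
  pi, hence not at all, against its size.\<close>

lemma tiles_disjoint_shift:
  assumes k: "k \<in> tiles 0" "k' \<in> tiles 1"
    and s: "sin (l1 k) \<noteq> 0" "sin (l2 k) \<noteq> 0" "sin (l1 k') \<noteq> 0" "sin (l2 k') \<noteq> 0"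
    and l: "l1 k' = l1 k + 2 * pi * of_int (i + j)" "l2 k' = l2 k + 2 * pi * of_int (j - i)"
  shows False
proof -
  have k0: "\<bar>l1 k\<bar> < pi" "\<bar>l2 k\<bar> < pi"
    using k(1) sin_ne_zero_ends[OF s(1)] sin_ne_zero_ends[OF s(2)] by (auto simp: tiles_0)
  have k1: "pi < \<bar>l1 k'\<bar> \<and> \<bar>l1 k'\<bar> < 2 * pi \<and> \<bar>l2 k'\<bar> < pi \<or> pi < \<bar>l2 k'\<bar> \<and> \<bar>l2 k'\<bar> < 2 * pi \<and> \<bar>l1 k'\<bar> < pi"
    using tiles_1_sin[OF k(2) s(3,4)] by (auto split: if_splits)
  have even: "m = 0" if "\<bar>2 * pi * of_int (2 * m)\<bar> < 3 * pi" for m :: int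
  proof -
    have "pi * \<bar>real_of_int m * 4\<bar> < pi * 3" using that by (simp add: abs_mult)
    then have "\<bar>real_of_int m * 4\<bar> < 3" using mult_less_cancel_left_pos[OF pi_gt_zero] by blast
    then show ?thesis by linarith
  qed
  from k1 show False
  proof
    assume h: "pi < \<bar>l1 k'\<bar> \<and> \<bar>l1 k'\<bar> < 2 * pi \<and> \<bar>l2 k'\<bar> < pi"
    then have "j - i = 0" using k0 l by (intro abs_multiple_lt_1) linarith
    then have ij: "i + j = 2 * i" by simp
    then have "i = 0" using h k0 l(1) unfolding ij by (intro even) linarith
    then show False using h k0 l ij by simp
  next
    assume h: "pi < \<bar>l2 k'\<bar> \<and> \<bar>l2 k'\<bar> < 2 * pi \<and> \<bar>l1 k'\<bar> < pi"
    then have "i + j = 0" using k0 l by (intro abs_multiple_lt_1) linarith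
    then have ij: "j - i = 2 * j" by simp
    then have "j = 0" using h k0 l(2) unfolding ij by (intro even) linarith
    then show False using h k0 l ij by simp
  qed
qed

lemma tiles_unique_shift:
  assumes k: "k \<in> tiles 0 \<union> tiles 1" "k' \<in> tiles 0 \<union> tiles 1"
    and s: "sin (l1 k) \<noteq> 0" "sin (l2 k) \<noteq> 0"
    and k': "k' = k + (2 * pi * of_int i, 2 * pi * of_int j)"
  shows "k' = k"
proof -
  have l: "l1 k' = l1 k + 2 * pi * of_int (i + j)" "l2 k' = l2 k + 2 * pi * of_int (j - i)"
    by (simp_all add: k' l1_def l2_def algebra_simps)
  have per: "sin (x + 2 * pi * of_int n) = sin x" "cos (x + 2 * pi * of_int n) = cos x" for x :: real and n :: int
    using sin_cos_eq_iff[of "x + 2 * pi * of_int n" x] by blast+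
  have sc: "sin (l1 k) = sin (l1 k')" "cos (l1 k) = cos (l1 k')" "sin (l2 k) = sin (l2 k')" "cos (l2 k) = cos (l2 k')"
    unfolding l per by simp_all
  have l': "l1 k = l1 k' + 2 * pi * of_int (- i + - j)" "l2 k = l2 k' + 2 * pi * of_int (- j - - i)"
    unfolding l by (simp_all add: algebra_simps)
  consider "k \<in> tiles 0" "k' \<in> tiles 0" | "k \<in> tiles 1" "k' \<in> tiles 1" | "k \<in> tiles 0" "k' \<in> tiles 1" | "k \<in> tiles 1" "k' \<in> tiles 0"
    using k by auto
  then show ?thesis
  proof cases
    case 1
    then show ?thesis using tiles_unique[of 0 k k'] s sc by simp
  next
    case 2
    then show ?thesis using tiles_unique[of 1 k k'] s sc by simp
  next
    case 3
    then show ?thesis using tiles_disjoint_shift[OF 3 _ _ _ _ l] s sc by simp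
  next
    case 4
    then show ?thesis using tiles_disjoint_shift[OF 4(2,1) _ _ _ _ l'] s sc by simp
  qed
qed

lemma torus_unique_shift:
  assumes k: "k \<in> torus" "k' \<in> torus" and s: "sin (fst k) \<noteq> 0" "sin (snd k) \<noteq> 0"
    and k': "k' = k + (2 * pi * of_int i, 2 * pi * of_int j)"
  shows "k' = k"
proof -
  have per: "\<bar>x\<bar> < pi" if "\<bar>x\<bar> \<le> pi" "sin x \<noteq> 0" for x :: real
    using that sin_ne_zero_ends[of x] by linarith
  have k0: "\<bar>fst k\<bar> < pi" "\<bar>snd k\<bar> < pi"
    using per[of "fst k"] per[of "snd k"] k(1) s by (auto simp: torus_def abs_le_iff)
  have "\<bar>fst k + 2 * pi * of_int i\<bar> \<le> pi" "\<bar>snd k + 2 * pi * of_int j\<bar> \<le> pi"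
    using k(2) by (auto simp: torus_def abs_le_iff k' mem_Times_iff)
  then have "\<bar>2 * pi * of_int i\<bar> < 2 * pi" "\<bar>2 * pi * of_int j\<bar> < 2 * pi" using k0 by linarith+
  then have "i = 0" "j = 0" using abs_multiple_lt_1 by blast+
  then show ?thesis using k' by (simp add: zero_prod_def[symmetric])
qed

text \<open>In the angles the torus is the diamond \<bar>l1\<bar> + \<bar>l2\<bar> \<le> 2 pi: the
  central square and four corners. Half of each corner already lies in a box of
  \<open>tiles 1\<close>, and one unit shift of k takes the other half to another such box.\<close>

lemma tiles_shift_exists:
  assumes "k \<in> torus"
  shows "\<exists>i\<in>{-1..1::int}. \<exists>j\<in>{-1..1::int}. k - (2 * pi * of_int i, 2 * pi * of_int j) \<in> tiles 0 \<union> tiles 1"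
proof -
  have k: "\<bar>fst k\<bar> \<le> pi" "\<bar>snd k\<bar> \<le> pi" using assms by (auto simp: torus_def)
  let ?R = "\<lambda>i j. k - (2 * pi * of_int i, 2 * pi * of_int j) \<in> tiles 0 \<union> tiles 1"
  have m: "?R i j \<longleftrightarrow> l1 k - 2 * pi * (i + j) \<in> {-pi..pi} \<and> l2 k - 2 * pi * (j - i) \<in> {-pi..pi} \<or>
    l1 k - 2 * pi * (i + j) \<in> {-2*pi..-pi} \<and> l2 k - 2 * pi * (j - i) \<in> {0..pi} \<or>
    l1 k - 2 * pi * (i + j) \<in> {-pi..0} \<and> l2 k - 2 * pi * (j - i) \<in> {-2*pi..-pi} \<or>
    l1 k - 2 * pi * (i + j) \<in> {pi..2*pi} \<and> l2 k - 2 * pi * (j - i) \<in> {-pi..0} \<or>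
    l1 k - 2 * pi * (i + j) \<in> {0..pi} \<and> l2 k - 2 * pi * (j - i) \<in> {pi..2*pi}" for i j :: int
  proof -
    have "l1 (k - (2 * pi * of_int i, 2 * pi * of_int j)) = l1 k - 2 * pi * (i + j)"
      "l2 (k - (2 * pi * of_int i, 2 * pi * of_int j)) = l2 k - 2 * pi * (j - i)"
      by (simp_all add: l1_def l2_def algebra_simps)
    then show ?thesis unfolding Un_iff tiles_0 tiles_1 by simp
  qed
  have k1: "l1 k + l2 k \<le> 2 * pi" "l1 k - l2 k \<le> 2 * pi" "- l1 k + l2 k \<le> 2 * pi" "- l1 k - l2 k \<le> 2 * pi"
    using k unfolding l1_def l2_def by linarith+
  have five: "?R 0 0 \<or> ?R 0 1 \<or> ?R 0 (-1) \<or> ?R 1 0 \<or> ?R (-1) 0"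
  proof -
    consider "l1 k \<le> pi" "- pi \<le> l1 k" "l2 k \<le> pi" "- pi \<le> l2 k"
      | "pi < l1 k" "l2 k \<le> 0" | "pi < l1 k" "0 < l2 k" | "l1 k < - pi" "l2 k < 0" | "l1 k < - pi" "0 \<le> l2 k"
      | "pi < l2 k" "l1 k < 0" | "pi < l2 k" "0 \<le> l1 k" | "l2 k < - pi" "l1 k \<le> 0" | "l2 k < - pi" "0 < l1 k"
      by linarith
    then show ?thesis
    proof cases
      case 1 then have "?R 0 0" unfolding m by auto then show ?thesis by blast
    next
      case 2 then have "?R 0 0" unfolding m using k1 by auto then show ?thesis by blast
    next
      case 3 then have "?R 0 1" unfolding m using k1 by auto then show ?thesis by blast
    next
      case 4 then have "?R 0 (-1)" unfolding m using k1 by auto then show ?thesis by blast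
    next
      case 5 then have "?R 0 0" unfolding m using k1 by auto then show ?thesis by blast
    next
      case 6 then have "?R (-1) 0" unfolding m using k1 by auto then show ?thesis by blast
    next
      case 7 then have "?R 0 0" unfolding m using k1 by auto then show ?thesis by blast
    next
      case 8 then have "?R 0 0" unfolding m using k1 by auto then show ?thesis by blast
    next
      case 9 then have "?R 1 0" unfolding m using k1 by auto then show ?thesis by blast
    qed
  qed
  have "?thesis" if "?R i j" "i \<in> {-1..1}" "j \<in> {-1..1}" for i j
    using that by blast
  note ex = this
  have r: "0 \<in> {-1..1::int}" "1 \<in> {-1..1::int}" "-1 \<in> {-1..1::int}" by simp_all
  from five show ?thesis
    using ex[OF _ r(1) r(1)] ex[OF _ r(1) r(2)] ex[OF _ r(1) r(3)] ex[OF _ r(2) r(1)] ex[OF _ r(3) r(1)] by blast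
qed

lemma torus_shift_exists:
  assumes "k \<in> tiles 0 \<union> tiles 1"
  shows "\<exists>i\<in>{-1..1::int}. \<exists>j\<in>{-1..1::int}. k + (2 * pi * of_int i, 2 * pi * of_int j) \<in> torus"
proof -
  have b: "\<bar>fst k\<bar> \<le> 3 * pi" "\<bar>snd k\<bar> \<le> 3 * pi"
    using assms pi_gt_zero unfolding Un_iff tiles_0 tiles_1 l1_def l2_def by auto
  have "\<exists>i\<in>{-1..1::int}. x + 2 * pi * of_int i \<in> {-pi..pi}" if "\<bar>x\<bar> \<le> 3 * pi" for x :: real
  proof -
    consider "x > pi" | "x < - pi" | "\<bar>x\<bar> \<le> pi" by linarith
    then show ?thesis
    proof cases
      case 1
      then show ?thesis using that by (intro bexI[of _ "-1"]) auto
    next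
      case 2
      then show ?thesis using that by (intro bexI[of _ 1]) auto
    next
      case 3
      then show ?thesis by (intro bexI[of _ 0]) auto
    qed
  qed
  from this[OF b(1)] this[OF b(2)] obtain i j :: int
    where "i \<in> {-1..1}" "j \<in> {-1..1}" "fst k + 2 * pi * of_int i \<in> {-pi..pi}" "snd k + 2 * pi * of_int j \<in> {-pi..pi}"
    by blast
  then show ?thesis
    unfolding torus_def by (intro bexI[of _ i] bexI[of _ j]) (simp_all add: mem_Times_iff)
qed

text \<open>Existence and uniqueness of the shift, in both directions, are the hypotheses of
  \<open>integral_tiling\<close>; nonzero sines remove the boundary points where uniqueness
  fails.\<close>

lemma integral_torus_eq_tiles:
  fixes H :: "real \<times> real \<Rightarrow> real"
  assumes per: "\<And>k. H (k + (2 * pi, 0)) = H k" "\<And>k. H (k + (0, 2 * pi)) = H k"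
    and [measurable]: "H \<in> borel_measurable borel"
    and int: "set_integrable lborel torus H"
  shows "set_integrable lborel (tiles 0 \<union> tiles 1) H"
    and "(LINT k:torus|lborel. H k) = (LINT k:tiles 0 \<union> tiles 1|lborel. H k)"
proof -
  have pn: "H (k + (2 * pi * real n, 0)) = H k" "H (k + (0, 2 * pi * real n)) = H k" for k and n :: nat
  proof (induction n)
    case (Suc n)
    have e: "k + (2 * pi * real (Suc n), 0) = (k + (2 * pi * real n, 0)) + (2 * pi, 0)"
      "k + (0, 2 * pi * real (Suc n)) = (k + (0, 2 * pi * real n)) + (0, 2 * pi)"
      by (simp_all add: prod_eq_iff algebra_simps)
    show "H (k + (2 * pi * real (Suc n), 0)) = H k" "H (k + (0, 2 * pi * real (Suc n))) = H k"
      unfolding e per by (rule Suc)+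
  qed (simp_all add: zero_prod_def[symmetric])
  have pi': "H (k + (2 * pi * of_int i, 0)) = H k" "H (k + (0, 2 * pi * of_int i)) = H k" for k and i :: int
  proof -
    obtain n where n: "i = int n \<or> i = - int n" by (metis int_cases2)
    have "H (k + (2 * pi * of_int i, 0)) = H k \<and> H (k + (0, 2 * pi * of_int i)) = H k"
    proof (cases "i = int n")
      case False
      then have i: "i = - int n" using n by simp
      have "(k + (2 * pi * of_int i, 0)) + (2 * pi * real n, 0) = k" "(k + (0, 2 * pi * of_int i)) + (0, 2 * pi * real n) = k"
        by (simp_all add: i prod_eq_iff)
      then show ?thesis
        using pn(1)[of "k + (2 * pi * of_int i, 0)" n] pn(2)[of "k + (0, 2 * pi * of_int i)" n] by metis
    qed (use pn in simp)
    then show "H (k + (2 * pi * of_int i, 0)) = H k" "H (k + (0, 2 * pi * of_int i)) = H k" by simp_all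
  qed
  have pz: "H (k + z) = H k" if zs: "z \<in> shifts" for z k
  proof -
    obtain i j :: int where "z = (2 * pi * of_int i, 2 * pi * of_int j)" using zs by (auto simp: shifts_def)
    then have "k + z = (k + (2 * pi * of_int i, 0)) + (0, 2 * pi * of_int j)" by (simp add: prod_eq_iff)
    then show ?thesis by (simp only: pi')
  qed
  have shI: "(2 * pi * of_int i, 2 * pi * of_int j) \<in> shifts" if "i \<in> {-1..1}" "j \<in> {-1..1}" for i j
    using that unfolding shifts_def by force
  have shD: "\<exists>i j :: int. z - z' = (2 * pi * of_int i, 2 * pi * of_int j)" if zz: "z \<in> shifts" "z' \<in> shifts" for z z'
  proof -
    obtain i j i' j' :: int where "z = (2 * pi * of_int i, 2 * pi * of_int j)" "z' = (2 * pi * of_int i', 2 * pi * of_int j')"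
      using zz by (auto simp: shifts_def)
    then have "z - z' = (2 * pi * of_int (i - i'), 2 * pi * of_int (j - j'))" by (simp add: algebra_simps)
    then show ?thesis by blast
  qed
  have sin_sh: "sin (l1 (k - z)) = sin (l1 k)" "sin (l2 (k - z)) = sin (l2 k)" "sin (fst (k + z)) = sin (fst k)" "sin (snd (k + z)) = sin (snd k)"
    if zs: "z \<in> shifts" for z k
  proof -
    obtain i j :: int where z: "z = (2 * pi * of_int i, 2 * pi * of_int j)" using zs by (auto simp: shifts_def)
    have l: "l1 (k - z) = l1 k + 2 * pi * of_int (- i - j)" "l2 (k - z) = l2 k + 2 * pi * of_int (i - j)"
      by (simp_all add: z l1_def l2_def algebra_simps)
    have per: "sin (x + 2 * pi * of_int n) = sin x" for x :: real and n :: int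
      using sin_cos_eq_iff[of "x + 2 * pi * of_int n" x] by blast
    show "sin (l1 (k - z)) = sin (l1 k)" "sin (l2 (k - z)) = sin (l2 k)" "sin (fst (k + z)) = sin (fst k)" "sin (snd (k + z)) = sin (snd k)"
      unfolding l per by (simp_all add: z per)
  qed
  have fin: "finite shifts" by (simp add: shifts_def)
  have m2: "tiles 0 \<union> tiles 1 \<in> sets borel" by measurable
  have t1: "AE k in lborel. k \<in> torus \<longrightarrow> (\<exists>!z. z \<in> shifts \<and> k - z \<in> tiles 0 \<union> tiles 1)"
    using AE_sin_ne_0(1,2)
  proof eventually_elim
    case (elim k)
    show ?case
    proof
      assume "k \<in> torus"
      then obtain z where z: "z \<in> shifts" "k - z \<in> tiles 0 \<union> tiles 1"
        using tiles_shift_exists shI by blast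
      show "\<exists>!z. z \<in> shifts \<and> k - z \<in> tiles 0 \<union> tiles 1"
      proof (rule ex1I[of _ z])
        fix z' assume z': "z' \<in> shifts \<and> k - z' \<in> tiles 0 \<union> tiles 1"
        obtain i j :: int where "z - z' = (2 * pi * of_int i, 2 * pi * of_int j)"
          using shD[OF z(1)] z' by blast
        then have "k - z' = (k - z) + (2 * pi * of_int i, 2 * pi * of_int j)" by (metis add_diff_cancel_left' diff_add_cancel diff_diff_eq2 add_diff_eq)
        from tiles_unique_shift[OF z(2) _ _ _ this] z' z sin_sh elim have "k - z' = k - z" by auto
        then show "z' = z" by simp
      qed (use z in simp)
    qed
  qed
  have t2: "AE k in lborel. k \<in> tiles 0 \<union> tiles 1 \<longrightarrow> (\<exists>!z. z \<in> shifts \<and> k + z \<in> torus)"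
    using AE_sin_ne_0(3)
  proof eventually_elim
    case (elim k)
    show ?case
    proof
      assume "k \<in> tiles 0 \<union> tiles 1"
      then obtain z where z: "z \<in> shifts" "k + z \<in> torus"
        using torus_shift_exists shI by blast
      show "\<exists>!z. z \<in> shifts \<and> k + z \<in> torus"
      proof (rule ex1I[of _ z])
        fix z' assume z': "z' \<in> shifts \<and> k + z' \<in> torus"
        obtain i j :: int where "z' - z = (2 * pi * of_int i, 2 * pi * of_int j)"
          using shD[of z' z] z z' by blast
        then have "k + z' = (k + z) + (2 * pi * of_int i, 2 * pi * of_int j)" by (metis add.assoc add_diff_cancel_left' diff_add_cancel add.commute)
        from torus_unique_shift[OF z(2) _ _ _ this] z' z sin_sh elim have "k + z' = k + z" by auto
        then show "z' = z" by simp
      qed (use z in simp)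
    qed
  qed
  show "set_integrable lborel (tiles 0 \<union> tiles 1) H"
    and "(LINT k:torus|lborel. H k) = (LINT k:tiles 0 \<union> tiles 1|lborel. H k)"
    using integral_tiling[OF fin sets_torus m2 pz t1 t2 _ int] by auto
qed

lemma AE_tiles_disjoint: "AE k in lborel. \<not> (k \<in> tiles 0 \<and> k \<in> tiles 1)"
  using AE_sin_ne_0(1,2)
proof eventually_elim
  case (elim k)
  show ?case using tiles_disjoint_shift[of k k 0 0] elim by auto
qed

section \<open>Push-forward under the velocity map\<close>

lemma integral_triple_sum:
  fixes F' :: "'i \<Rightarrow> 'j \<Rightarrow> 'l \<Rightarrow> 'a \<Rightarrow> real"
  assumes "\<And>i j l. i \<in> A \<Longrightarrow> j \<in> B \<Longrightarrow> l \<in> C \<Longrightarrow> integrable M (F' i j l)"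
  shows "(LINT x|M. (\<Sum>i\<in>A. \<Sum>j\<in>B. \<Sum>l\<in>C. F' i j l x)) = (\<Sum>i\<in>A. \<Sum>j\<in>B. \<Sum>l\<in>C. LINT x|M. F' i j l x)"
    and "integrable M (\<lambda>x. \<Sum>i\<in>A. \<Sum>j\<in>B. \<Sum>l\<in>C. F' i j l x)"
proof -
  have "(LINT x|M. (\<Sum>i\<in>A. \<Sum>j\<in>B. \<Sum>l\<in>C. F' i j l x)) = (\<Sum>i\<in>A. LINT x|M. (\<Sum>j\<in>B. \<Sum>l\<in>C. F' i j l x))"
    using assms by (intro Bochner_Integration.integral_sum Bochner_Integration.integrable_sum)
  also have "\<dots> = (\<Sum>i\<in>A. \<Sum>j\<in>B. LINT x|M. (\<Sum>l\<in>C. F' i j l x))"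
    using assms by (intro sum.cong refl Bochner_Integration.integral_sum Bochner_Integration.integrable_sum)
  also have "\<dots> = (\<Sum>i\<in>A. \<Sum>j\<in>B. \<Sum>l\<in>C. LINT x|M. F' i j l x)"
    using assms by (intro sum.cong refl Bochner_Integration.integral_sum)
  finally show "(LINT x|M. (\<Sum>i\<in>A. \<Sum>j\<in>B. \<Sum>l\<in>C. F' i j l x)) = (\<Sum>i\<in>A. \<Sum>j\<in>B. \<Sum>l\<in>C. LINT x|M. F' i j l x)" .
  show "integrable M (\<lambda>x. \<Sum>i\<in>A. \<Sum>j\<in>B. \<Sum>l\<in>C. F' i j l x)"
    using assms by (intro Bochner_Integration.integrable_sum)
qed

section \<open>Derivative and Jacobian of the velocity\<close>

lemma has_derivative_l:
  "(l1 has_derivative l1) (at k)" "(l2 has_derivative l2) (at k)"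
  unfolding l1_def[abs_def] l2_def[abs_def] by (auto intro!: derivative_eq_intros)

lemma continuous_l [continuous_intros]: "continuous_on S l1" "continuous_on S l2"
  unfolding l1_def[abs_def] l2_def[abs_def] by (intro continuous_intros)+

context walk_params begin

abbreviation vel :: "real \<times> real \<Rightarrow> real \<times> real" where
  "vel \<equiv> velocity a1 a2"

definition dtau :: "real \<times> real \<Rightarrow> real \<times> real \<Rightarrow> real" where
  "dtau k h = - a * sin (l1 k) * l1 h + b * sin (l2 k) * l2 h"

lemma has_derivative_\<tau>: "(\<tau> a1 a2 has_derivative dtau k) (at k)"
  unfolding \<tau>_def[abs_def] dtau_def[abs_def]
  by (auto intro!: derivative_eq_intros has_derivative_l simp: algebra_simps)

lemma inverse_sqrt_derivative:
  fixes t :: real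
  assumes "t\<^sup>2 < 1"
  shows "((\<lambda>t. inverse (sqrt (1 - t\<^sup>2))) has_real_derivative t * (inverse (sqrt (1 - t\<^sup>2)))^3) (at t)"
proof -
  have "(sqrt (1 - t\<^sup>2))\<^sup>2 = 1 - t\<^sup>2" using assms by simp
  then show ?thesis
    using assms
    by (auto intro!: derivative_eq_intros simp: divide_simps power2_eq_square power3_eq_cube)
qed

lemma has_derivative_inverse_sqrt_W:
  "((\<lambda>k. inverse (sqrt (W k))) has_derivative (\<lambda>h. dtau k h * (\<tau> a1 a2 k * (inverse (sqrt (W k)))^3))) (at k)"
proof -
  have "(\<tau> a1 a2 k)\<^sup>2 < 1" using W_pos[of k] by (simp add: tau_compl_def)
  from inverse_sqrt_derivative[OF this]
  have "((\<lambda>t. inverse (sqrt (1 - t\<^sup>2))) has_derivative (\<lambda>t. t * (\<tau> a1 a2 k * (inverse (sqrt (W k)))^3))) (at (\<tau> a1 a2 k))"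
    by (simp add: has_field_derivative_def tau_compl_def mult_commute_abs)
  from has_derivative_compose[OF has_derivative_\<tau> this] show ?thesis
    by (simp add: tau_compl_def)
qed

text \<open>\<open>dp\<close> and \<open>dq\<close> are the differentials of half the sum and half
  the difference of the velocity components, with \<open>R\<close> = 1 / sqrt W.\<close>

definition dvel :: "real \<times> real \<Rightarrow> real \<times> real \<Rightarrow> real \<times> real" where
  "dvel k h = (let R = inverse (sqrt (W k));
      dp = - a * cos (l1 k) * l1 h * R - a * sin (l1 k) * (dtau k h * (\<tau> a1 a2 k * R^3));
      dq = - b * cos (l2 k) * l2 h * R - b * sin (l2 k) * (dtau k h * (\<tau> a1 a2 k * R^3))
    in (dp + dq, dp - dq))"

lemma has_derivative_velocity: "(vel has_derivative dvel k) (at k)"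
proof -
  define r where "r k = inverse (sqrt (W k))" for k
  have r: "(r has_derivative (\<lambda>h. dtau k h * (\<tau> a1 a2 k * (r k)^3))) (at k)"
    unfolding r_def by (rule has_derivative_inverse_sqrt_W)
  have e: "vel = (\<lambda>k. (- (a * sin (l1 k) * r k) - b * sin (l2 k) * r k, - (a * sin (l1 k) * r k) + b * sin (l2 k) * r k))"
    by (auto simp: velocity_def tau_compl_def divide_inverse algebra_simps r_def)
  show ?thesis
    unfolding e dvel_def Let_def r_def[symmetric]
    by (rule has_derivative_eq_rhs)
       (auto intro!: derivative_eq_intros has_derivative_l r simp: algebra_simps)
qed

lemma det_dvel:
  "\<bar>fst (dvel k (1, 0)) * snd (dvel k (0, 1)) - fst (dvel k (0, 1)) * snd (dvel k (1, 0))\<bar> = jac k"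
proof -
  define c1 c2 s1 s2 t V R where "c1 = cos (l1 k)" and "c2 = cos (l2 k)" and "s1 = sin (l1 k)" and "s2 = sin (l2 k)"
    and "t = \<tau> a1 a2 k" and "V = W k" and "R = inverse (sqrt V)"
  have V: "V > 0" unfolding V_def by (rule W_pos)
  have R2: "R\<^sup>2 * V = 1" using V by (simp add: R_def power_inverse)
  have tV: "t = a * c1 - b * c2" "V = 1 - t\<^sup>2"
    by (simp_all add: t_def V_def c1_def c2_def \<tau>_def tau_compl_def)
  have cs: "c1\<^sup>2 + s1\<^sup>2 = 1" "c2\<^sup>2 + s2\<^sup>2 = 1" by (simp_all add: c1_def c2_def s1_def s2_def)
  \<comment> \<open>Brings both summands of each differential to the common factor R^3, after which
    the determinant is polynomial.\<close>
  have R: "R = R^3 * V" using R2 by algebra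
  define X where "X = (- a * c1 * V + a\<^sup>2 * s1\<^sup>2 * t) * (- b * c2 * V - b\<^sup>2 * s2\<^sup>2 * t) + a\<^sup>2 * b\<^sup>2 * s1\<^sup>2 * s2\<^sup>2 * t\<^sup>2"
  have l: "l1 (1, 0) = 1" "l2 (1, 0) = -1" "l1 (0, 1) = 1" "l2 (0, 1) = 1" by (simp_all add: l1_def l2_def)
  have "fst (dvel k (1, 0)) * snd (dvel k (0, 1)) - fst (dvel k (0, 1)) * snd (dvel k (1, 0)) = - 4 * (R^3)\<^sup>2 * X"
    unfolding dvel_def Let_def dtau_def l fst_conv snd_conv
      c1_def[symmetric] c2_def[symmetric] s1_def[symmetric] s2_def[symmetric] t_def[symmetric] V_def[symmetric] R_def[symmetric] X_def
    using R by algebra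
  also have "X = a * b * V * \<phi> a1 a2 (c1, c2)"
    using jacobian_identity[OF cs, of a b] unfolding X_def tV by (simp add: \<phi>_def)
  also have "- 4 * (R^3)\<^sup>2 * (a * b * V * \<phi> a1 a2 (c1, c2)) = - (4 * a * b * \<phi> a1 a2 (c1, c2) / V\<^sup>2)"
  proof -
    have "(R^3)\<^sup>2 * V = 1 / V\<^sup>2"
    proof -
      have "(R^3)\<^sup>2 * V * V\<^sup>2 = 1" using R2 by algebra
      then show ?thesis using V by (simp add: field_simps)
    qed
    moreover have "- 4 * (R^3)\<^sup>2 * (a * b * V * \<phi> a1 a2 (c1, c2)) = - (4 * a * b * \<phi> a1 a2 (c1, c2)) * ((R^3)\<^sup>2 * V)"
      by algebra
    ultimately show ?thesis by simp
  qed
  finally show ?thesis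
    using ab_pos by (simp add: jac_def c1_def c2_def V_def abs_mult)
qed

lemma continuous_W: "continuous_on S W"
  unfolding tau_compl_def[abs_def] \<tau>_def[abs_def] by (intro continuous_intros)

lemma continuous_vel: "continuous_on S vel"
proof -
  have "\<forall>k\<in>S. sqrt (1 - (\<tau> a1 a2 k)\<^sup>2) \<noteq> 0"
    using W_pos by (auto simp: tau_compl_def less_le)
  moreover have "continuous_on S (\<tau> a1 a2)"
    unfolding \<tau>_def[abs_def] by (intro continuous_intros)
  ultimately show ?thesis
    unfolding velocity_def[abs_def] by (intro continuous_intros) auto
qed

lemma measurable_vel [measurable]: "vel \<in> borel_measurable borel"
  by (intro borel_measurable_continuous_onI continuous_vel)

lemma measurable_lin [measurable]: "(\<lambda>k. lin1 (csl k)) \<in> borel_measurable borel" "(\<lambda>k. lin2 (csl k)) \<in> borel_measurable borel"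
  unfolding lin1_def lin2_def by measurable

text \<open>The part of a branch domain on which the velocity is injective with nonzero Jacobian;
  only a null set is removed.\<close>

definition piece :: "nat \<Rightarrow> nat \<Rightarrow> nat \<Rightarrow> (real \<times> real) set" where
  "piece \<mu> \<nu> \<xi> = {k \<in> K a1 a2 \<mu> \<nu> \<xi>. gen k}"

lemma sets_piece:
  assumes "\<mu> \<in> {0,1}" "\<nu> \<in> {0,1}" "\<xi> \<in> {0,1}"
  shows "piece \<mu> \<nu> \<xi> \<in> sets borel"
proof -
  have [measurable]: "tiles \<mu> \<in> sets borel" using assms(1) sets_tiles by auto
  have "piece \<mu> \<nu> \<xi> = {k \<in> tiles \<mu>. 0 \<le> sign1 (ridx \<nu> \<xi>) * lin1 (csl k) \<and> 0 \<le> sign2 (ridx \<nu> \<xi>) * lin2 (csl k)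
      \<and> sin (l1 k) \<noteq> 0 \<and> sin (l2 k) \<noteq> 0 \<and> lin1 (csl k) * lin2 (csl k) \<noteq> 0}"
    unfolding piece_def generic_def \<phi>_lin using cos_region_iff[OF ridx_range[OF assms(2,3)]]
    by (auto simp: K_iff)
  also have "\<dots> \<in> sets borel" by measurable
  finally show ?thesis .
qed

text \<open>\<open>inv_into\<close> ranges over all of \<open>K\<close> and might return a
  nongeneric point; \<open>velocity_inj\<close> excludes this because it needs nonzero sines at
  \<open>k\<close> alone.\<close>

lemma k_inv_velocity:
  assumes idx: "\<mu> \<in> {0,1}" "\<nu> \<in> {0,1}" "\<xi> \<in> {0,1}" and k: "k \<in> piece \<mu> \<nu> \<xi>"
  shows "k_inv a1 a2 (if \<xi> = 0 then 1 else -1) \<mu> \<nu> (vel k) = k"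
proof -
  let ?k' = "inv_into (K a1 a2 \<mu> \<nu> \<xi>) vel (vel k)"
  have e: "k_inv a1 a2 (if \<xi> = 0 then 1 else -1) \<mu> \<nu> (vel k) = ?k'"
    using idx by (auto simp: k_inv_def)
  have kK: "k \<in> K a1 a2 \<mu> \<nu> \<xi>" "sin (l1 k) \<noteq> 0" "sin (l2 k) \<noteq> 0"
    using k by (auto simp: piece_def generic_def)
  then have "?k' \<in> K a1 a2 \<mu> \<nu> \<xi>" "vel ?k' = vel k"
    by (auto intro: inv_into_into f_inv_into_f)
  then have "k = ?k'" using velocity_inj[OF idx kK(1) _ kK(2,3)] by simp
  then show ?thesis using e by simp
qed

lemma F_scale: "s \<in> {1, -1} \<Longrightarrow> F \<alpha> (s *\<^sub>R v) = F \<alpha> v"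
  by (auto simp: F_def split_beta power2_eq_square algebra_simps)

text \<open>Evenness of \<open>f\<close> lets the weights be evaluated at s v while the factor
  \<open>f\<close> stays at v.\<close>

lemma f_scale: "s \<in> {1, -1} \<Longrightarrow> f a1 a2 \<sigma> (s *\<^sub>R v) = f a1 a2 \<sigma> v"
proof -
  assume s: "s \<in> {1, -1}"
  then have "F0 a1 a2 (s *\<^sub>R v) = F0 a1 a2 v"
    by (auto simp: F0_def split_beta power2_eq_square algebra_simps)
  moreover have "indicator (E a1 \<inter> E a2) (s *\<^sub>R v) = (indicator (E a1 \<inter> E a2) v :: real)"
    by (simp add: E_def F_scale[OF s] indicator_def)
  ultimately show ?thesis using s F_scale[OF s] by (auto simp: f_def)
qed

text \<open>Outside the two ellipses the indicator vanishes; on their boundaries the denominator is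
  0 and the quotient is 0 by convention.\<close>

lemma f_eq_0: "\<not> (0 < F a1 v \<and> 0 < F a2 v) \<Longrightarrow> f a1 a2 \<sigma> v = 0"
  by (auto simp: f_def E_def indicator_def not_less)

lemma phi_sign:
  assumes "\<nu> \<in> {0,1}" "\<xi> \<in> {0,1}" "k \<in> piece \<mu> \<nu> \<xi>"
  shows "0 \<le> (if \<xi> = 0 then 1 else -1) * \<phi> a1 a2 (csl k)"
proof -
  let ?m = "ridx \<nu> \<xi>"
  have m: "?m \<in> {1..4}" using ridx_range assms by blast
  have "0 \<le> (sign1 ?m * lin1 (csl k)) * (sign2 ?m * lin2 (csl k))"
    using assms(3) cos_region_iff[OF m, of "csl k"] by (auto simp: piece_def K_iff)
  also have "\<dots> = (sign1 ?m * sign2 ?m) * \<phi> a1 a2 (csl k)" by (simp add: \<phi>_lin mult_ac)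
  also have "sign1 ?m * sign2 ?m = (if \<xi> = 0 then 1 else -1)"
    using sign_phi[OF m] assms(2) by (auto simp: ridx_def)
  finally show ?thesis .
qed

text \<open>On these two lines p or q is 0, so a sine vanishes at every preimage.\<close>

lemma AE_lebesgue_components: "AE v in lebesgue. fst v + snd v \<noteq> 0 \<and> fst v - snd v \<noteq> (0::real)"
proof -
  have sub: "{v. fst v + c * snd v = 0} \<in> null_sets lborel" if "c \<noteq> 0" for c :: real
  proof -
    have "AE x in lborel. AE y in lborel. x + c * y \<noteq> 0"
    proof (rule AE_I2)
      fix x
      show "AE y in lborel. x + c * y \<noteq> 0"
        using AE_lborel_singleton[of "- x / c"] that
        by (auto elim!: eventually_mono simp: field_simps)
    qed
    moreover have "(\<lambda>k. fst k + c * snd k) \<in> borel_measurable (lborel \<Otimes>\<^sub>M lborel)"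
      by measurable
    ultimately have "AE k in lborel \<Otimes>\<^sub>M lborel. fst k + c * snd k \<noteq> 0"
      by (intro lborel_pair.AE_pair_measure borel_measurable_neq borel_measurable_const) (simp_all only: fst_conv snd_conv)
    then have "AE k in lborel. fst k + c * snd k \<noteq> 0" by (simp only: lborel_prod)
    then show ?thesis by (subst (asm) AE_iff_null) (auto intro!: borel_measurable_continuous_onI continuous_intros borel_closed closed_Collect_eq)
  qed
  have "AE v in lborel. fst v + snd v \<noteq> 0 \<and> fst v - snd v \<noteq> (0::real)"
    using AE_not_in[OF sub[of 1]] AE_not_in[OF sub[of "-1"]] by simp
  then show ?thesis by (rule AE_completion)
qed

text \<open>Any preimage in \<open>K\<close> is automatically generic: p and q nonzero force nonzero
  sines, and positive F values force \<phi> nonzero.\<close>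

lemma velocity_image:
  assumes idx: "\<mu> \<in> {0,1}" "\<nu> \<in> {0,1}" "\<xi> \<in> {0,1}" and s: "s \<in> {1, -1}"
    and v: "0 < F a1 v" "0 < F a2 v" "fst v + snd v \<noteq> 0" "fst v - snd v \<noteq> 0"
  shows "v \<in> (\<lambda>k. s *\<^sub>R vel k) ` piece \<mu> \<nu> \<xi>"
proof -
  obtain k where k: "k \<in> K a1 a2 \<mu> \<nu> \<xi>" "vel k = s *\<^sub>R v"
    using velocity_surj[OF idx, of "s *\<^sub>R v"] v F_scale[OF s] by metis
  have "fst (s *\<^sub>R v) + snd (s *\<^sub>R v) \<noteq> 0" "fst (s *\<^sub>R v) - snd (s *\<^sub>R v) \<noteq> 0"
    using v s by auto
  then have "sin (l1 k) \<noteq> 0" "sin (l2 k) \<noteq> 0"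
    using velocity_half[of k] unfolding k(2) by auto
  then have "gen k" using generic_image[of k] v F_scale[OF s] by (simp add: k(2))
  then have "k \<in> piece \<mu> \<nu> \<xi>" using k by (simp add: piece_def)
  moreover have "v = s *\<^sub>R vel k" using k s by auto
  ultimately show ?thesis by blast
qed

text \<open>One of the sixteen summands of four times the limit density: an eigenvalue sign together
  with one of the eight inverse branches. The sign of \<open>f\<close> is dictated by \<xi>.\<close>

definition branch :: "state \<Rightarrow> real \<Rightarrow> nat \<Rightarrow> nat \<Rightarrow> nat \<Rightarrow> real \<times> real \<Rightarrow> real" where
  "branch \<Psi>0 s \<mu> \<nu> \<xi> v = P a1 a2 \<Psi>0 s (k_inv a1 a2 (if \<xi> = 0 then 1 else -1) \<mu> \<nu> (s *\<^sub>R v))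
      * f a1 a2 (if \<xi> = 0 then 1 else -1) v"

text \<open>By \<open>f_velocity\<close> the Jacobian times pi^2 f is 1, so the change of variables
  along s times the velocity leaves exactly h times \<open>P\<close> on the wave vector side. The
  image misses only a null set of the points where \<open>branch\<close> can be nonzero.\<close>

lemma integral_piece:
  assumes idx: "\<mu> \<in> {0,1}" "\<nu> \<in> {0,1}" "\<xi> \<in> {0,1}" and s: "s \<in> {1, -1}"
    and int: "set_integrable lborel (piece \<mu> \<nu> \<xi>) (\<lambda>k. h (s *\<^sub>R vel k) * P a1 a2 \<Psi>0 s k)"
  shows "integrable lebesgue (\<lambda>v. pi\<^sup>2 * (h v * branch \<Psi>0 s \<mu> \<nu> \<xi> v))"
    and "(LINT v|lebesgue. pi\<^sup>2 * (h v * branch \<Psi>0 s \<mu> \<nu> \<xi> v))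
      = (LINT k:piece \<mu> \<nu> \<xi>|lborel. h (s *\<^sub>R vel k) * P a1 a2 \<Psi>0 s k)"
proof -
  define \<sigma> :: real where "\<sigma> = (if \<xi> = 0 then 1 else -1)"
  have \<sigma>: "\<sigma> \<in> {1, -1}" by (simp add: \<sigma>_def)
  define g where "g k = s *\<^sub>R vel k" for k
  define B where "B v = pi\<^sup>2 * (h v * branch \<Psi>0 s \<mu> \<nu> \<xi> v)" for v
  have ss: "s *\<^sub>R (s *\<^sub>R v) = v" for v :: "real \<times> real" using s by auto
  have key: "jac k * B (g k) = h (s *\<^sub>R vel k) * P a1 a2 \<Psi>0 s k" if k: "k \<in> piece \<mu> \<nu> \<xi>" for k
  proof -
    have "gen k" using k by (simp add: piece_def)
    from f_velocity[OF this \<sigma>] phi_sign[OF idx(2,3) k]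
    have f1: "jac k * (pi\<^sup>2 * f a1 a2 \<sigma> (vel k)) = 1" by (simp add: \<sigma>_def)
    have B: "B (g k) = pi\<^sup>2 * (h (s *\<^sub>R vel k) * (P a1 a2 \<Psi>0 s k * f a1 a2 \<sigma> (vel k)))"
      unfolding B_def branch_def g_def ss \<sigma>_def[symmetric] f_scale[OF s]
      using k_inv_velocity[OF idx k] by (simp add: \<sigma>_def)
    have "jac k * B (g k) = (jac k * (pi\<^sup>2 * f a1 a2 \<sigma> (vel k))) * (h (s *\<^sub>R vel k) * P a1 a2 \<Psi>0 s k)"
      unfolding B by (simp only: mult_ac)
    then show ?thesis using f1 by simp
  qed
  have der: "(g has_derivative (\<lambda>x. s *\<^sub>R dvel k x)) (at k)" for k
    unfolding g_def[abs_def] by (intro has_derivative_scaleR_right has_derivative_velocity)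
  have inj: "inj_on g (piece \<mu> \<nu> \<xi>)"
  proof (rule inj_onI)
    fix k k' assume k: "k \<in> piece \<mu> \<nu> \<xi>" "k' \<in> piece \<mu> \<nu> \<xi>" "g k = g k'"
    then have "vel k = vel k'" using s by (auto simp: g_def)
    then show "k = k'" using k_inv_velocity[OF idx] k by metis
  qed
  have J: "jac k = \<bar>fst (s *\<^sub>R dvel k (1, 0)) * snd (s *\<^sub>R dvel k (0, 1)) - fst (s *\<^sub>R dvel k (0, 1)) * snd (s *\<^sub>R dvel k (1, 0))\<bar>" for k
    using det_dvel[of k] s by auto
  have "set_integrable lborel (piece \<mu> \<nu> \<xi>) (\<lambda>k. jac k * B (g k))
      \<longleftrightarrow> set_integrable lborel (piece \<mu> \<nu> \<xi>) (\<lambda>k. h (s *\<^sub>R vel k) * P a1 a2 \<Psi>0 s k)"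
    using key by (intro set_integrable_cong) auto
  then have int': "set_integrable lborel (piece \<mu> \<nu> \<xi>) (\<lambda>k. jac k * B (g k))" using int by simp
  note cov = change_of_variables_pair[OF sets_piece[OF idx] der inj J int']
  have ae: "AE v in lebesgue. indicator (g ` piece \<mu> \<nu> \<xi>) v * B v = B v"
    using AE_lebesgue_components
  proof eventually_elim
    case (elim v)
    show ?case
    proof (cases "0 < F a1 v \<and> 0 < F a2 v")
      case True
      then have "v \<in> g ` piece \<mu> \<nu> \<xi>" using velocity_image[OF idx s] elim by (simp add: g_def[abs_def])
      then show ?thesis by simp
    next
      case False
      then have "B v = 0" by (simp add: B_def branch_def f_eq_0)
      then show ?thesis by simp
    qed
  qed
  have m: "(\<lambda>v. indicator (g ` piece \<mu> \<nu> \<xi>) v * B v) \<in> borel_measurable lebesgue"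
    using cov(1) by (auto simp: set_integrable_def dest: borel_measurable_integrable)
  \<comment> \<open>The inverse branch becomes measurable here: the product agrees almost everywhere
    with the function whose measurability the change of variables delivered.\<close>
  have mB: "B \<in> borel_measurable lebesgue"
    using borel_measurable_AE[OF m ae] .
  have "integrable lebesgue B \<longleftrightarrow> integrable lebesgue (\<lambda>v. indicator (g ` piece \<mu> \<nu> \<xi>) v * B v)"
    and eq: "(LINT v|lebesgue. B v) = (LINT v|lebesgue. indicator (g ` piece \<mu> \<nu> \<xi>) v * B v)"
    using integrable_cong_AE[OF m mB ae] integral_cong_AE[OF m mB ae] by simp_all
  then have "integrable lebesgue B"
    using cov(1) by (simp add: set_integrable_def)
  then show "integrable lebesgue (\<lambda>v. pi\<^sup>2 * (h v * branch \<Psi>0 s \<mu> \<nu> \<xi> v))"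
    by (simp only: B_def[abs_def])
  have "(LINT v|lebesgue. B v) = (LINT k:piece \<mu> \<nu> \<xi>|lborel. jac k * B (g k))"
    using eq cov(2) by (simp add: set_lebesgue_integral_def)
  also have "\<dots> = (LINT k:piece \<mu> \<nu> \<xi>|lborel. h (s *\<^sub>R vel k) * P a1 a2 \<Psi>0 s k)"
    using key sets_piece[OF idx] by (intro set_lebesgue_integral_cong) auto
  finally show "(LINT v|lebesgue. pi\<^sup>2 * (h v * branch \<Psi>0 s \<mu> \<nu> \<xi> v))
      = (LINT k:piece \<mu> \<nu> \<xi>|lborel. h (s *\<^sub>R vel k) * P a1 a2 \<Psi>0 s k)"
    by (simp add: B_def)
qed

text \<open>A generic point lies in exactly one cosine region, and (\<nu>, \<xi>) to 2 (\<nu> + 1) -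
  \<xi> is a bijection onto the four region indices.\<close>

lemma AE_pieces:
  "AE k in lborel. (\<Sum>\<mu>\<in>{0,1}. \<Sum>\<nu>\<in>{0,1}. \<Sum>\<xi>\<in>{0,1}. indicator (piece \<mu> \<nu> \<xi>) k)
      = (indicator (tiles 0 \<union> tiles 1) k :: real)"
  using AE_generic AE_tiles_disjoint
proof eventually_elim
  case (elim k)
  have lin: "lin1 (csl k) \<noteq> 0" "lin2 (csl k) \<noteq> 0" using elim by (auto simp: generic_def \<phi>_lin)
  obtain m where m: "m \<in> {1..4}" "csl k \<in> cos_region a1 a2 m"
    "\<And>m'. m' \<in> {1..4} \<Longrightarrow> csl k \<in> cos_region a1 a2 m' \<Longrightarrow> m' = m"
    using region_unique[OF lin] by auto
  have reg: "csl k \<in> cos_region a1 a2 m' \<longleftrightarrow> m' = m" if "m' \<in> {1..4}" for m'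
    using m that by blast
  have ind: "indicator (piece \<mu> \<nu> \<xi>) k = (indicator (tiles \<mu>) k * (if ridx \<nu> \<xi> = m then 1 else 0) :: real)"
    if "\<nu> \<in> {0,1}" "\<xi> \<in> {0,1}" for \<mu> \<nu> \<xi>
    using reg[OF ridx_range[OF that]] elim(1) by (auto simp: piece_def K_iff indicator_def)
  have "(\<Sum>\<nu>\<in>{0,1}. \<Sum>\<xi>\<in>{0,1}. indicator (piece \<mu> \<nu> \<xi>) k) = (indicator (tiles \<mu>) k :: real)" for \<mu>
  proof -
    have "(\<Sum>\<nu>\<in>{0,1}. \<Sum>\<xi>\<in>{0,1}. indicator (piece \<mu> \<nu> \<xi>) k)
      = (\<Sum>\<nu>\<in>{0,1}. \<Sum>\<xi>\<in>{0,1}. indicator (tiles \<mu>) k * (if ridx \<nu> \<xi> = m then 1 else 0) :: real)"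
      using ind by (intro sum.cong refl) auto
    also have "\<dots> = indicator (tiles \<mu>) k"
    proof -
      have "m = 1 \<or> m = 2 \<or> m = 3 \<or> m = 4" using m(1) by auto
      moreover have "(\<Sum>x\<in>{0, 1::nat}. G x) = G 0 + G 1" for G :: "nat \<Rightarrow> real" by simp
      ultimately show ?thesis by (simp only: ridx_def) (elim disjE; simp)
    qed
    finally show ?thesis .
  qed
  then show ?case using elim(2) by (auto simp: indicator_def)
qed

lemma limit_density_branches:
  "limit_density a1 a2 \<Psi>0 v = 1 / 4 * (\<Sum>s\<in>{1,-1}. \<Sum>\<mu>\<in>{0,1}. \<Sum>\<nu>\<in>{0,1}. \<Sum>\<xi>\<in>{0,1}. branch \<Psi>0 s \<mu> \<nu> \<xi> v)"
proof -
  have "(\<Sum>x\<in>{0, 1::nat} \<times> {0, 1::nat}. G x) = G (0,0) + G (0,1) + G (1,0) + G (1,1)" for G :: "_ \<Rightarrow> real"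
  proof -
    have "{0, 1::nat} \<times> {0, 1::nat} = {(0,0),(0,1),(1,0),(1,1)}" by auto
    then show ?thesis by simp
  qed
  then show ?thesis
    by (simp add: limit_density_def w_def branch_def split_beta algebra_simps add_divide_distrib)
qed

text \<open>The factor 1 / 4 of \<open>w\<close> and the pi^2 of the Jacobian relation combine to 1
  / (4 pi^2), the normalized measure of the torus. Periodicity is what moves the integral from the
  tiles to the torus.\<close>

theorem integral_limit_density:
  assumes P: "\<And>s. s \<in> {1, -1} \<Longrightarrow> set_integrable lborel torus (\<lambda>k. h (s *\<^sub>R vel k) * P a1 a2 \<Psi>0 s k)"
    and [measurable]: "\<And>s. s \<in> {1, -1} \<Longrightarrow> P a1 a2 \<Psi>0 s \<in> borel_measurable borel" "h \<in> borel_measurable borel"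
    and per: "\<And>s k. P a1 a2 \<Psi>0 s (k + (2 * pi, 0)) = P a1 a2 \<Psi>0 s k"
      "\<And>s k. P a1 a2 \<Psi>0 s (k + (0, 2 * pi)) = P a1 a2 \<Psi>0 s k"
  shows "integrable lebesgue (\<lambda>v. h v * limit_density a1 a2 \<Psi>0 v)"
    and "(LINT v|lebesgue. h v * limit_density a1 a2 \<Psi>0 v)
      = 1 / (4 * pi\<^sup>2) * (\<Sum>s\<in>{1,-1}. LINT k:torus|lborel. h (s *\<^sub>R vel k) * P a1 a2 \<Psi>0 s k)"
proof -
  define H where "H s k = h (s *\<^sub>R vel k) * P a1 a2 \<Psi>0 s k" for s k
  have mH: "H s \<in> borel_measurable borel" if "s \<in> {1, -1}" for s
    using assms(2)[OF that] unfolding H_def by measurable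
  have lper: "l1 (k + (2 * pi, 0)) = l1 k + 2 * pi" "l2 (k + (2 * pi, 0)) = l2 k - 2 * pi"
     "l1 (k + (0, 2 * pi)) = l1 k + 2 * pi" "l2 (k + (0, 2 * pi)) = l2 k + 2 * pi" for k
    by (simp_all add: l1_def l2_def)
  have vper: "vel (k + (2 * pi, 0)) = vel k" "vel (k + (0, 2 * pi)) = vel k" for k
    by (simp_all add: velocity_def \<tau>_def lper sin_diff cos_diff)
  have perH: "H s (k + (2 * pi, 0)) = H s k" "H s (k + (0, 2 * pi)) = H s k" for s k
    by (simp_all add: H_def vper per)
  have intH: "set_integrable lborel torus (H s)" if "s \<in> {1,-1}" for s
    using P[OF that] by (simp add: H_def[abs_def])
  note tor = integral_torus_eq_tiles[OF perH mH intH]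
  have ip: "set_integrable lborel (piece \<mu> \<nu> \<xi>) (H s)"
    if "s \<in> {1,-1}" "\<mu> \<in> {0,1}" "\<nu> \<in> {0,1}" "\<xi> \<in> {0,1}" for s \<mu> \<nu> \<xi>
  proof (rule set_integrable_subset[OF tor(1)[OF that(1,1)]])
    show "piece \<mu> \<nu> \<xi> \<in> sets lborel" using sets_piece that by simp
    show "piece \<mu> \<nu> \<xi> \<subseteq> tiles 0 \<union> tiles 1" using that(2) by (auto simp: piece_def K_iff)
  qed
  have sumH: "(\<Sum>\<mu>\<in>{0,1}. \<Sum>\<nu>\<in>{0,1}. \<Sum>\<xi>\<in>{0,1}. LINT k:piece \<mu> \<nu> \<xi>|lborel. H s k) = (LINT k:torus|lborel. H s k)"
    if s: "s \<in> {1,-1}" for s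
  proof -
    have "(\<Sum>\<mu>\<in>{0,1}. \<Sum>\<nu>\<in>{0,1}. \<Sum>\<xi>\<in>{0,1}. LINT k:piece \<mu> \<nu> \<xi>|lborel. H s k)
      = (LINT k|lborel. (\<Sum>\<mu>\<in>{0,1}. \<Sum>\<nu>\<in>{0,1}. \<Sum>\<xi>\<in>{0,1}. indicator (piece \<mu> \<nu> \<xi>) k * H s k))"
      using ip[OF s] unfolding set_lebesgue_integral_def set_integrable_def
      by (subst integral_triple_sum) (auto simp only: real_scaleR_def)
    also have "\<dots> = (LINT k|lborel. indicator (tiles 0 \<union> tiles 1) k * H s k)"
    proof (rule integral_cong_AE)
      have "(\<lambda>k. indicator (piece \<mu> \<nu> \<xi>) k * H s k) \<in> borel_measurable lborel"
        if "\<mu> \<in> {0,1}" "\<nu> \<in> {0,1}" "\<xi> \<in> {0,1}" for \<mu> \<nu> \<xi>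
        using mH[OF s] sets_piece[OF that] by (intro borel_measurable_times borel_measurable_indicator) simp_all
      then show "(\<lambda>k. \<Sum>\<mu>\<in>{0,1}. \<Sum>\<nu>\<in>{0,1}. \<Sum>\<xi>\<in>{0,1}. indicator (piece \<mu> \<nu> \<xi>) k * H s k) \<in> borel_measurable lborel"
        by (intro borel_measurable_sum) auto
      show "(\<lambda>k. indicator (tiles 0 \<union> tiles 1) k * H s k) \<in> borel_measurable lborel"
        using mH[OF s] by measurable
      show "AE k in lborel. (\<Sum>\<mu>\<in>{0,1}. \<Sum>\<nu>\<in>{0,1}. \<Sum>\<xi>\<in>{0,1}. indicator (piece \<mu> \<nu> \<xi>) k * H s k)
          = indicator (tiles 0 \<union> tiles 1) k * H s k"
        using AE_pieces by eventually_elim (simp only: sum_distrib_right[symmetric])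
    qed
    also have "\<dots> = (LINT k:torus|lborel. H s k)"
      using tor(2)[OF s s] by (simp add: set_lebesgue_integral_def)
    finally show ?thesis .
  qed
  have ib: "integrable lebesgue (\<lambda>v. pi\<^sup>2 * (h v * branch \<Psi>0 s \<mu> \<nu> \<xi> v))"
       "(LINT v|lebesgue. pi\<^sup>2 * (h v * branch \<Psi>0 s \<mu> \<nu> \<xi> v)) = (LINT k:piece \<mu> \<nu> \<xi>|lborel. H s k)"
    if "s \<in> {1,-1}" "\<mu> \<in> {0,1}" "\<nu> \<in> {0,1}" "\<xi> \<in> {0,1}" for s \<mu> \<nu> \<xi>
    using integral_piece[OF that(2,3,4,1)] ip[OF that] by (simp_all add: H_def[abs_def])
  have ld: "h v * limit_density a1 a2 \<Psi>0 v = 1 / (4 * pi\<^sup>2) *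
      (\<Sum>s\<in>{1,-1}. \<Sum>\<mu>\<in>{0,1}. \<Sum>\<nu>\<in>{0,1}. \<Sum>\<xi>\<in>{0,1}. pi\<^sup>2 * (h v * branch \<Psi>0 s \<mu> \<nu> \<xi> v))" for v
    unfolding limit_density_branches sum_distrib_left[symmetric] by simp
  show "integrable lebesgue (\<lambda>v. h v * limit_density a1 a2 \<Psi>0 v)"
    unfolding ld
    by (rule integrable_mult_right, rule Bochner_Integration.integrable_sum, rule integral_triple_sum(2), rule ib(1))
  have "(LINT v|lebesgue. h v * limit_density a1 a2 \<Psi>0 v) = 1 / (4 * pi\<^sup>2) *
      (\<Sum>s\<in>{1,-1}. \<Sum>\<mu>\<in>{0,1}. \<Sum>\<nu>\<in>{0,1}. \<Sum>\<xi>\<in>{0,1}. LINT v|lebesgue. pi\<^sup>2 * (h v * branch \<Psi>0 s \<mu> \<nu> \<xi> v))"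
  proof -
    have "(LINT v|lebesgue. (\<Sum>s\<in>{1,-1}. \<Sum>\<mu>\<in>{0,1}. \<Sum>\<nu>\<in>{0,1}. \<Sum>\<xi>\<in>{0,1}. pi\<^sup>2 * (h v * branch \<Psi>0 s \<mu> \<nu> \<xi> v)))
      = (\<Sum>s\<in>{1,-1}. LINT v|lebesgue. (\<Sum>\<mu>\<in>{0,1}. \<Sum>\<nu>\<in>{0,1}. \<Sum>\<xi>\<in>{0,1}. pi\<^sup>2 * (h v * branch \<Psi>0 s \<mu> \<nu> \<xi> v)))"
      by (rule Bochner_Integration.integral_sum, rule integral_triple_sum(2), rule ib(1))
    also have "\<dots> = (\<Sum>s\<in>{1,-1}. \<Sum>\<mu>\<in>{0,1}. \<Sum>\<nu>\<in>{0,1}. \<Sum>\<xi>\<in>{0,1}. LINT v|lebesgue. pi\<^sup>2 * (h v * branch \<Psi>0 s \<mu> \<nu> \<xi> v))"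
      by (rule sum.cong[OF refl], rule integral_triple_sum(1), rule ib(1))
    finally show ?thesis unfolding ld by (simp only: integral_mult_right_zero)
  qed
  also have "\<dots> = 1 / (4 * pi\<^sup>2) * (\<Sum>s\<in>{1,-1}. LINT k:torus|lborel. H s k)"
  proof -
    have "(\<Sum>\<mu>\<in>{0,1}. \<Sum>\<nu>\<in>{0,1}. \<Sum>\<xi>\<in>{0,1}. LINT v|lebesgue. pi\<^sup>2 * (h v * branch \<Psi>0 s \<mu> \<nu> \<xi> v))
        = (LINT k:torus|lborel. H s k)" if s: "s \<in> {1,-1}" for s
    proof -
      have "(\<Sum>\<mu>\<in>{0,1}. \<Sum>\<nu>\<in>{0,1}. \<Sum>\<xi>\<in>{0,1}. LINT v|lebesgue. pi\<^sup>2 * (h v * branch \<Psi>0 s \<mu> \<nu> \<xi> v))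
        = (\<Sum>\<mu>\<in>{0,1}. \<Sum>\<nu>\<in>{0,1}. \<Sum>\<xi>\<in>{0,1}. LINT k:piece \<mu> \<nu> \<xi>|lborel. H s k)"
        using s by (intro sum.cong[of "{0, 1}"] refl ib(2))
      then show ?thesis using sumH[OF s] by (rule trans)
    qed
    then show ?thesis by (intro arg_cong2[where f = "(*)"] sum.cong refl)
  qed
  finally show "(LINT v|lebesgue. h v * limit_density a1 a2 \<Psi>0 v)
      = 1 / (4 * pi\<^sup>2) * (\<Sum>s\<in>{1,-1}. LINT k:torus|lborel. h (s *\<^sub>R vel k) * P a1 a2 \<Psi>0 s k)"
    by (simp add: H_def)
qed

end

section \<open>Spectral calculus of the walk\<close>

definition cip :: "complex ^ 2 \<Rightarrow> complex ^ 2 \<Rightarrow> complex" where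
  "cip u v = cnj (u $ 1) * v $ 1 + cnj (u $ 2) * v $ 2"

lemma cip_sum_UNIV: "(\<Sum>i\<in>UNIV. cnj (u $ i) * v $ i) = cip u v"
  by (simp add: cip_def UNIV_2)

lemma norm_sq_2: "(norm u)\<^sup>2 = (cmod (u $ 1))\<^sup>2 + (cmod (u $ 2))\<^sup>2" for u :: "complex ^ 2"
  by (simp add: norm_vec_def L2_set_def UNIV_2)

lemma cip_self: "cip u u = of_real ((norm u)\<^sup>2)"
  by (simp add: cip_def norm_sq_2 complex_norm_square mult.commute del: of_real_power)

lemma scaleR_nth: "(r *\<^sub>R u) $ i = of_real r * u $ i" for u :: "complex ^ 2"
  by (simp only: vector_scaleR_component scaleR_conv_of_real[of r "u $ i"])

lemma cip_linear:
  "cip (u + u') v = cip u v + cip u' v" "cip u (v + v') = cip u v + cip u v'"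
  "cip (u - u') v = cip u v - cip u' v" "cip u (v - v') = cip u v - cip u v'"
  "cip (r *\<^sub>R u) v = of_real r * cip u v" "cip u (r *\<^sub>R v) = of_real r * cip u v"
  "cip (z *s u) v = cnj z * cip u v" "cip u (z *s v) = z * cip u v"
  "cip 0 v = 0" "cip u 0 = 0"
  by (simp_all add: cip_def algebra_simps scaleR_nth del: vector_scaleR_component)

lemma cip_sum:
  "cip (\<Sum>x\<in>A. g x) v = (\<Sum>x\<in>A. cip (g x) v)" "cip u (\<Sum>x\<in>A. g x) = (\<Sum>x\<in>A. cip u (g x))"
  by (induction A rule: infinite_finite_induct) (simp_all add: cip_linear)

lemma cip_commute: "cip v u = cnj (cip u v)"
  by (simp add: cip_def)

text \<open>In dimension two, e' completes the unit vector e to an orthonormal basis.\<close>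

lemma cip_basis_expansion:
  assumes "norm e = 1"
  defines "e' \<equiv> vector [- cnj (e $ 2), cnj (e $ 1)]"
  shows "cip u v = cnj (cip e u) * cip e v + cnj (cip e' u) * cip e' v"
proof -
  have e: "cnj (e $ 1) * e $ 1 + cnj (e $ 2) * e $ 2 = 1"
    using cip_self[of e] assms(1) by (simp add: cip_def)
  have "cnj (cip e u) * cip e v + cnj (cip e' u) * cip e' v
      = (cnj (e $ 1) * e $ 1 + cnj (e $ 2) * e $ 2) * cip u v"
    by (simp add: cip_def e'_def algebra_simps)
  then show ?thesis using e by simp
qed

lemma norm_cip_le: "cmod (cip u v) \<le> norm u * norm v"
proof (cases "u = 0")
  case False
  define e where "e = (1 / norm u) *\<^sub>R u"
  have e: "norm e = 1" using False by (simp add: e_def)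
  define e' where "e' = (vector [- cnj (e $ 2), cnj (e $ 1)] :: complex ^ 2)"
  have "of_real ((norm v)\<^sup>2) = cnj (cip e v) * cip e v + cnj (cip e' v) * cip e' v"
    using cip_basis_expansion[OF e, of v v] by (simp add: cip_self e'_def)
  also have "\<dots> = of_real ((cmod (cip e v))\<^sup>2 + (cmod (cip e' v))\<^sup>2)"
    by (simp add: complex_norm_square mult.commute del: of_real_power)
  finally have "(norm v)\<^sup>2 = (cmod (cip e v))\<^sup>2 + (cmod (cip e' v))\<^sup>2" by (simp only: of_real_eq_iff)
  then have "(cmod (cip e v))\<^sup>2 \<le> (norm v)\<^sup>2" by simp
  then have "cmod (cip e v) \<le> norm v" by (rule power2_le_imp_le) simp
  moreover have "cip u v = of_real (norm u) * cip e v" using False by (simp add: e_def cip_linear)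
  ultimately show ?thesis by (simp add: norm_mult mult_left_mono)
qed (simp add: cip_linear)

lemma vector_2_eqI: "u $ 1 = v $ 1 \<Longrightarrow> u $ 2 = v $ 2 \<Longrightarrow> u = (v :: complex ^ 2)"
  by (metis vec_eq_iff exhaust_2)

section \<open>The symbol of the walk as a matrix in SU(2) and its powers\<close>

context walk_params begin

text \<open>\<open>Am\<close> and \<open>Bm\<close> form the first row of the symbol; the second row
  is determined by them as in every SU(2) matrix.\<close>

definition Am :: "real \<times> real \<Rightarrow> complex" where
  "Am k = cis (snd k) * (of_real a * cis (fst k) - of_real b * cis (- fst k))"

definition Bm :: "real \<times> real \<Rightarrow> complex" where
  "Bm k = cis (snd k) * (of_real (a2 * b1) * cis (fst k) + of_real (a1 * b2) * cis (- fst k))"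

abbreviation U :: "real \<times> real \<Rightarrow> complex ^ 2 \<Rightarrow> complex ^ 2" where
  "U k u \<equiv> Uhat a1 a2 k *v u"

lemma U_nth:
  "U k u $ 1 = Am k * u $ 1 + Bm k * u $ 2"
  "U k u $ 2 = - cnj (Bm k) * u $ 1 + cnj (Am k) * u $ 2"
  by (simp_all add: Uhat_def phase_matrix_def coin_def matrix_vector_mult_def matrix_matrix_mult_def sum_2
      Am_def Bm_def prod_a_def prod_b_def cis_cnj algebra_simps)

lemma U_linear: "U k (u + v) = U k u + U k v" "U k (u - v) = U k u - U k v" "U k (r *\<^sub>R u) = r *\<^sub>R U k u" "U k (z *s u) = z *s U k u"
  by (simp_all add: matrix_vector_right_distrib matrix_vector_mult_diff_distrib)
     (auto intro!: vector_2_eqI simp: U_nth algebra_simps)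

lemma Re_Am: "Re (Am k) = \<tau> a1 a2 k"
  by (simp add: Am_def \<tau>_def l1_def l2_def cos_add cos_diff algebra_simps)

lemma Am_Bm: "Am k * cnj (Am k) + Bm k * cnj (Bm k) = 1"
proof -
  have c: "cis x * cnj (cis x) = 1" for x by (simp add: cis_cnj cis_mult)
  define z where "z = cis (fst k)"
  have z: "z * cnj z = 1" "cis (- fst k) = cnj z" by (simp add: z_def c) (simp add: z_def cis_cnj)
  have "Am k * cnj (Am k) + Bm k * cnj (Bm k)
     = (cis (snd k) * cnj (cis (snd k))) * ((of_real a * z - of_real b * cnj z) * (of_real a * cnj z - of_real b * z)
       + (of_real (a2 * b1) * z + of_real (a1 * b2) * cnj z) * (of_real (a2 * b1) * cnj z + of_real (a1 * b2) * z))"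
    by (simp add: Am_def Bm_def z(2) z_def[symmetric] algebra_simps)
  \<comment> \<open>The terms in z^2 and its conjugate cancel, because (a2 b1)(a1 b2) = a b.\<close>
  also have "\<dots> = (z * cnj z) * of_real (a\<^sup>2 + b\<^sup>2 + (a2 * b1)\<^sup>2 + (a1 * b2)\<^sup>2)"
    unfolding c by (simp add: prod_a_def prod_b_def algebra_simps power2_eq_square)
  also have "a\<^sup>2 + b\<^sup>2 + (a2 * b1)\<^sup>2 + (a1 * b2)\<^sup>2 = 1"
    unfolding prod_a_def prod_b_def using coeff_sq by algebra
  finally show ?thesis using z by simp
qed

lemma U_unitary: "cip (U k u) (U k v) = cip u v"
proof -
  have "cip (U k u) (U k v) = (Am k * cnj (Am k) + Bm k * cnj (Bm k)) * cip u v"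
    by (simp add: cip_def U_nth algebra_simps)
  then show ?thesis by (simp add: Am_Bm)
qed

lemma norm_U: "norm (U k u) = norm u"
proof -
  have "complex_of_real ((norm (U k u))\<^sup>2) = of_real ((norm u)\<^sup>2)"
    using U_unitary[of k u u] by (simp only: cip_self)
  then show ?thesis by (simp del: of_real_power)
qed

text \<open>Cayley--Hamilton for determinant 1 and trace 2 \<tau>.\<close>

lemma U_square: "U k (U k u) = (2 * \<tau> a1 a2 k) *\<^sub>R U k u - u"
proof -
  have tr: "Am k + cnj (Am k) = of_real (2 * \<tau> a1 a2 k)" by (simp add: complex_add_cnj Re_Am)
  have "2 * of_real (\<tau> a1 a2 k) = Am k + cnj (Am k)" using tr by simp
  then show ?thesis
    using Am_Bm[of k]
    by (intro vector_2_eqI; simp add: U_nth scaleR_nth del: vector_scaleR_component) algebra+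
qed

text \<open>The generator in U = cos \<omega> + sin \<omega> Y, with Y^2 = -1. Powers of U then obey
  de Moivre's formula without eigenvectors, and Y is continuous in k, which a chosen eigenvector
  need not be.\<close>

definition Y :: "real \<times> real \<Rightarrow> complex ^ 2 \<Rightarrow> complex ^ 2" where
  "Y k u = (1 / sqrt (W k)) *\<^sub>R (U k u - \<tau> a1 a2 k *\<^sub>R u)"

lemma sqrt_W: "sqrt (W k) > 0" "(sqrt (W k))\<^sup>2 = 1 - (\<tau> a1 a2 k)\<^sup>2"
  using W_pos[of k] by (simp_all add: tau_compl_def)

lemma \<tau>_bound: "-1 < \<tau> a1 a2 k" "\<tau> a1 a2 k < 1"
  using W_pos[of k] abs_square_less_1[of "\<tau> a1 a2 k"] by (auto simp: tau_compl_def)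

lemma \<omega>_trig: "cos (\<omega> a1 a2 k) = \<tau> a1 a2 k" "sin (\<omega> a1 a2 k) = sqrt (W k)"
  using \<tau>_bound[of k] by (simp_all add: \<omega>_def sin_arccos tau_compl_def)

lemma U_eq_Y: "U k u = \<tau> a1 a2 k *\<^sub>R u + sqrt (W k) *\<^sub>R Y k u"
  using sqrt_W(1)[of k] by (simp add: Y_def)

lemma U_Y: "U k (Y k u) = \<tau> a1 a2 k *\<^sub>R Y k u - sqrt (W k) *\<^sub>R u"
proof -
  define t r where "t = \<tau> a1 a2 k" and "r = sqrt (W k)"
  have r: "r > 0" "r\<^sup>2 = 1 - t\<^sup>2" using sqrt_W[of k] by (simp_all add: t_def r_def)
  have "U k (Y k u) = (1 / r) *\<^sub>R (U k (U k u) - t *\<^sub>R U k u)"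
    by (simp add: Y_def U_linear t_def r_def)
  also have "U k (U k u) - t *\<^sub>R U k u = t *\<^sub>R U k u - u"
    unfolding U_square t_def by (simp add: scaleR_2[symmetric] algebra_simps flip: scaleR_scaleR)
  also have "\<dots> = (t * r) *\<^sub>R Y k u - r\<^sup>2 *\<^sub>R u"
    unfolding r(2) by (subst U_eq_Y) (simp add: t_def r_def algebra_simps power2_eq_square)
  also have "(1 / r) *\<^sub>R \<dots> = t *\<^sub>R Y k u - r *\<^sub>R u"
    using r(1) by (simp add: scaleR_right_diff_distrib power2_eq_square)
  finally show ?thesis by (simp add: t_def r_def)
qed

lemma U_power:
  "(U k ^^ t) u = cos (t * \<omega> a1 a2 k) *\<^sub>R u + sin (t * \<omega> a1 a2 k) *\<^sub>R Y k u"
proof (induction t)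
  case (Suc t)
  have "(U k ^^ Suc t) u = U k (cos (t * \<omega> a1 a2 k) *\<^sub>R u + sin (t * \<omega> a1 a2 k) *\<^sub>R Y k u)"
    using Suc by simp
  also have "\<dots> = cos (t * \<omega> a1 a2 k) *\<^sub>R (\<tau> a1 a2 k *\<^sub>R u + sqrt (W k) *\<^sub>R Y k u)
      + sin (t * \<omega> a1 a2 k) *\<^sub>R (\<tau> a1 a2 k *\<^sub>R Y k u - sqrt (W k) *\<^sub>R u)"
    by (simp only: U_linear U_Y) (simp only: U_eq_Y)
  also have "\<dots> = cos (Suc t * \<omega> a1 a2 k) *\<^sub>R u + sin (Suc t * \<omega> a1 a2 k) *\<^sub>R Y k u"
    by (simp add: \<omega>_trig[symmetric] distrib_right cos_add sin_add algebra_simps)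
  finally show ?case .
qed simp

text \<open>The Hermitian form of - i Y: the weight of u on the eigenspace for cis \<omega> minus
  its weight on the other one.\<close>

definition Dm :: "real \<times> real \<Rightarrow> complex ^ 2 \<Rightarrow> real" where
  "Dm k u = Im (cip u (U k u)) / sqrt (W k)"

lemma cip_U: "cip u (U k u) = of_real (\<tau> a1 a2 k * (norm u)\<^sup>2) + \<i> * of_real (Dm k u * sqrt (W k))"
proof -
  have "cip u (U k u) + cnj (cip u (U k u)) = (Am k + cnj (Am k)) * cip u u"
    by (simp add: cip_def U_nth algebra_simps)
  then have "2 * Re (cip u (U k u)) = 2 * \<tau> a1 a2 k * (norm u)\<^sup>2"
    by (simp add: complex_add_cnj Re_Am cip_self flip: of_real_mult of_real_power)
  then show ?thesis using sqrt_W(1)[of k] by (simp add: complex_eq_iff Dm_def)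
qed

lemma cip_Y: "cip u (Y k u) = \<i> * of_real (Dm k u)" "cip (Y k u) u = - \<i> * of_real (Dm k u)"
proof -
  show 1: "cip u (Y k u) = \<i> * of_real (Dm k u)"
    using sqrt_W(1)[of k] by (simp add: Y_def cip_linear cip_U cip_self)
  show "cip (Y k u) u = - \<i> * of_real (Dm k u)"
    by (subst cip_commute) (simp add: 1)
qed

lemma cip_Y_Y: "cip (Y k u) (Y k u) = of_real ((norm u)\<^sup>2)"
proof -
  define t r where "t = \<tau> a1 a2 k" and "r = sqrt (W k)"
  have r: "r > 0" "r\<^sup>2 = 1 - t\<^sup>2" using sqrt_W[of k] by (simp_all add: t_def r_def)
  have "of_real ((norm u)\<^sup>2) = cip (U k u) (U k u)" by (simp only: norm_U cip_self)
  also have "\<dots> = of_real (t\<^sup>2 * (norm u)\<^sup>2) + of_real (r\<^sup>2) * cip (Y k u) (Y k u)"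
    unfolding U_eq_Y t_def[symmetric] r_def[symmetric] cip_linear cip_Y cip_self[of u]
    by (simp add: algebra_simps power2_eq_square)
  finally have "of_real (r\<^sup>2) * cip (Y k u) (Y k u) = of_real (r\<^sup>2 * (norm u)\<^sup>2)"
    unfolding r(2) by (simp add: algebra_simps)
  then show ?thesis using r(1) by simp
qed

lemma norm_Y: "norm (Y k u) = norm u"
proof -
  have "complex_of_real ((norm (Y k u))\<^sup>2) = of_real ((norm u)\<^sup>2)"
    using cip_Y_Y[of k u] by (simp only: cip_self)
  then show ?thesis by (simp del: of_real_power)
qed

text \<open>The squared norm of the spectral component of u, written without choosing an
  eigenvector; continuity and measurability in k can thus be read off.\<close>

definition Q :: "real \<Rightarrow> real \<times> real \<Rightarrow> complex ^ 2 \<Rightarrow> real" where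
  "Q s k u = ((norm u)\<^sup>2 + s * Dm k u) / 2"

text \<open>Shows that the choice in \<open>eigvec\<close> is not vacuous. By Cayley--Hamilton (U -
  z)(U - cnj z) = 0, so every nonzero value of U - cnj z is an eigenvector for z.\<close>

lemma eigvec:
  assumes s: "s \<in> {1, -1}"
  shows "norm (eigvec a1 a2 s k) = 1 \<and> U k (eigvec a1 a2 s k) = cis (s * \<omega> a1 a2 k) *s eigvec a1 a2 s k"
proof -
  define z where "z = cis (s * \<omega> a1 a2 k)"
  have z: "z * cnj z = 1" "z + cnj z = of_real (2 * \<tau> a1 a2 k)"
    using s by (auto simp: z_def cis_cnj cis_mult complex_eq_iff \<omega>_trig)
  have zi: "Im z \<noteq> 0" using s \<omega>_trig(2)[of k] sqrt_W(1)[of k] by (auto simp: z_def)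
  \<comment> \<open>Otherwise both diagonal entries, which are conjugate to each other, would equal
    cnj z, although z is not real.\<close>
  have ex: "\<exists>x. U k x - cnj z *s x \<noteq> 0"
  proof (rule ccontr)
    assume "\<not> (\<exists>x. U k x - cnj z *s x \<noteq> 0)"
    then have all: "U k x = cnj z *s x" for x by (metis eq_iff_diff_eq_0)
    from arg_cong[OF all[of "axis 1 1"], of "\<lambda>u. u $ 1"] arg_cong[OF all[of "axis 2 1"], of "\<lambda>u. u $ 2"]
    have "Am k = cnj z" "cnj (Am k) = cnj z" by (simp_all add: U_nth axis_def)
    then have "Im (cnj z) = 0" by (metis complex_cnj_cancel_iff complex_cnj_cnj zi Im_complex_of_real cnj.simps(2) neg_equal_zero)
    then show False using zi by simp
  qed
  then obtain x where x: "U k x - cnj z *s x \<noteq> 0" by blast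
  define y where "y = U k x - cnj z *s x"
  have "U k y = z *s y"
    unfolding y_def U_linear U_square using z
    by (intro vector_2_eqI; simp add: scaleR_nth del: vector_scaleR_component) algebra+
  then have "norm ((1 / norm y) *\<^sub>R y) = 1 \<and> U k ((1 / norm y) *\<^sub>R y) = z *s ((1 / norm y) *\<^sub>R y)"
    using x by (auto simp: y_def[symmetric] U_linear intro!: vector_2_eqI)
  then show ?thesis
    unfolding eigvec_def z_def by (rule someI)
qed

text \<open>The orthogonal companion e' is an eigenvector for cnj z. In the basis e, e' the
  imaginary part of the form of U is Im z times the difference of the two weights, and the squared
  norm is their sum.\<close>

lemma P_eq_Q:
  assumes s: "s \<in> {1, -1}"
  shows "P a1 a2 \<Psi>0 s k = Q s k (fourier_transform \<Psi>0 k)"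
    and "(cmod (cip (eigvec a1 a2 s k) u))\<^sup>2 = Q s k u"
    and "(cmod (cip (eigvec a1 a2 s k) u))\<^sup>2 \<le> (norm u)\<^sup>2"
proof -
  define e where "e = eigvec a1 a2 s k"
  define z where "z = cis (s * \<omega> a1 a2 k)"
  have e: "norm e = 1" "U k e = z *s e" using eigvec[OF s, of k] by (simp_all add: e_def z_def)
  define e' where "e' = (vector [- cnj (e $ 2), cnj (e $ 1)] :: complex ^ 2)"
  have zz: "z * cnj z = 1" by (simp add: z_def cis_cnj cis_mult)
  have c: "cnj (z * e $ 1) = cnj (Am k) * cnj (e $ 1) + cnj (Bm k) * cnj (e $ 2)"
     "cnj (z * e $ 2) = - Bm k * cnj (e $ 1) + Am k * cnj (e $ 2)"
    using arg_cong[OF e(2), of "\<lambda>u. cnj (u $ 1)"] arg_cong[OF e(2), of "\<lambda>u. cnj (u $ 2)"]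
    by (simp_all add: U_nth)
  have e': "U k e' = cnj z *s e'"
    using c by (intro vector_2_eqI) (simp_all add: e'_def U_nth algebra_simps)
  have key: "cip x (U k u) = w * cip x u" if "U k x = w *s x" "w * cnj w = 1" for x w u
  proof -
    have "cip x u = cip (U k x) (U k u)" by (simp add: U_unitary)
    also have "\<dots> = cnj w * cip x (U k u)" by (simp add: that cip_linear)
    finally have "w * cip x u = (w * cnj w) * cip x (U k u)" by simp
    then show ?thesis using that by simp
  qed
  have g: "(cmod (cip e u))\<^sup>2 = Q s k u \<and> (cmod (cip e u))\<^sup>2 \<le> (norm u)\<^sup>2" for u
  proof -
    define p q where "p = (cmod (cip e u))\<^sup>2" and "q = (cmod (cip e' u))\<^sup>2"
    have pq: "cnj (cip e u) * cip e u = of_real p" "cnj (cip e' u) * cip e' u = of_real q"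
      by (simp_all add: p_def q_def complex_norm_square mult.commute del: of_real_power)
    have "cip u u = of_real (p + q)"
      using cip_basis_expansion[OF e(1), of u u] by (simp add: e'_def[symmetric] pq)
    then have n: "(norm u)\<^sup>2 = p + q" unfolding cip_self by (simp only: of_real_eq_iff)
    have "cip u (U k u) = z * of_real p + cnj z * of_real q"
      using cip_basis_expansion[OF e(1), of u "U k u"] key[OF e(2) zz, of u] key[OF e', of u] zz
      by (simp add: e'_def[symmetric] pq[symmetric] mult_ac)
    then have "Im (cip u (U k u)) = Im z * (p - q)" by (simp add: algebra_simps)
    moreover have "Im z = s * sqrt (W k)" using s by (auto simp: z_def \<omega>_trig)
    ultimately have "Dm k u = s * (p - q)" using sqrt_W(1)[of k] by (simp add: Dm_def)
    then have "Q s k u = p" using s n by (auto simp: Q_def)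
    then show ?thesis using n by (simp add: p_def q_def)
  qed
  then show "(cmod (cip (eigvec a1 a2 s k) u))\<^sup>2 = Q s k u"
    and "(cmod (cip (eigvec a1 a2 s k) u))\<^sup>2 \<le> (norm u)\<^sup>2" unfolding e_def by blast+
  show "P a1 a2 \<Psi>0 s k = Q s k (fourier_transform \<Psi>0 k)"
    using g by (simp add: P_def cip_sum_UNIV e_def)
qed

lemma has_derivative_\<omega>: "(\<omega> a1 a2 has_derivative (\<lambda>h. - (h \<bullet> vel k))) (at k)"
proof -
  have "(arccos has_derivative (\<lambda>x. x * inverse (- sqrt (1 - (\<tau> a1 a2 k)\<^sup>2)))) (at (\<tau> a1 a2 k))"
    using DERIV_arccos[OF \<tau>_bound[of k]] unfolding has_field_derivative_def
    by (rule has_derivative_eq_rhs) auto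
  from has_derivative_compose[OF has_derivative_\<tau> this]
  have "(\<omega> a1 a2 has_derivative (\<lambda>h. dtau k h * inverse (- sqrt (1 - (\<tau> a1 a2 k)\<^sup>2)))) (at k)"
    by (simp add: \<omega>_def[abs_def])
  moreover have "dtau k h * inverse (- sqrt (1 - (\<tau> a1 a2 k)\<^sup>2)) = - (h \<bullet> vel k)" for h
    using sqrt_W(1)[of k]
    by (simp add: dtau_def velocity_def l1_def l2_def inner_prod_def tau_compl_def field_simps)
  ultimately show ?thesis by simp
qed

lemma \<omega>_difference_quotient:
  "(\<lambda>t. real t * (\<omega> a1 a2 (k - (1 / real t) *\<^sub>R \<xi>) - \<omega> a1 a2 k)) \<longlonglongrightarrow> \<xi> \<bullet> vel k"
proof -
  have "((\<lambda>r. k - r *\<^sub>R \<xi>) has_derivative (\<lambda>r. - (r *\<^sub>R \<xi>))) (at 0)"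
    by (auto intro!: derivative_eq_intros)
  from has_derivative_compose[OF this, of "\<omega> a1 a2" "\<lambda>h. - (h \<bullet> vel k)"]
  have "((\<lambda>r. \<omega> a1 a2 (k - r *\<^sub>R \<xi>)) has_derivative (\<lambda>r. - (- (r *\<^sub>R \<xi>) \<bullet> vel k))) (at 0)"
    using has_derivative_\<omega>[of k] by simp
  then have "((\<lambda>r. \<omega> a1 a2 (k - r *\<^sub>R \<xi>)) has_real_derivative (\<xi> \<bullet> vel k)) (at 0)"
    by (simp add: has_field_derivative_def mult.commute[of _ "\<xi> \<bullet> vel k"] inner_minus_left)
  then have lim: "((\<lambda>r. (\<omega> a1 a2 (k - r *\<^sub>R \<xi>) - \<omega> a1 a2 k) / r) \<longlongrightarrow> \<xi> \<bullet> vel k) (at 0)"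
    by (simp add: DERIV_def)
  have "filterlim (\<lambda>t. 1 / real t) (at 0) sequentially"
    unfolding filterlim_at
    using lim_1_over_n by (auto intro!: eventually_sequentiallyI[of 1])
  from filterlim_compose[OF lim this] show ?thesis by (simp add: mult.commute)
qed

end

section \<open>Trigonometric polynomials and Parseval\<close>

lemma cis_2pi_int: "cis (2 * pi * of_int n) = 1"
  by (simp add: cis_multiple_2pi)

lemma integral_double_sum:
  fixes G :: "'i \<Rightarrow> 'j \<Rightarrow> 'a \<Rightarrow> 'b :: {banach, second_countable_topology}"
  assumes "\<And>i j. i \<in> A \<Longrightarrow> j \<in> B \<Longrightarrow> integrable M (G i j)"
  shows "(LINT x|M. (\<Sum>i\<in>A. \<Sum>j\<in>B. G i j x)) = (\<Sum>i\<in>A. \<Sum>j\<in>B. LINT x|M. G i j x)"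
proof -
  have "(LINT x|M. (\<Sum>i\<in>A. \<Sum>j\<in>B. G i j x)) = (\<Sum>i\<in>A. LINT x|M. (\<Sum>j\<in>B. G i j x))"
    using assms by (intro Bochner_Integration.integral_sum Bochner_Integration.integrable_sum)
  also have "\<dots> = (\<Sum>i\<in>A. \<Sum>j\<in>B. LINT x|M. G i j x)"
    using assms by (intro sum.cong refl Bochner_Integration.integral_sum)
  finally show ?thesis .
qed

lemma has_integral_cis_int:
  "((\<lambda>x. cis (of_int n * x)) has_integral (if n = 0 then of_real (2 * pi) else 0)) {-pi..pi}"
proof (cases "n = 0")
  case True
  then show ?thesis
    using has_integral_const_real[of "1 :: complex" "-pi" pi] by (simp add: scaleR_conv_of_real)
next
  case False
  have "((\<lambda>x. cis (of_int n * x)) has_integral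
      (cis (of_int n * pi) / (\<i> * of_int n) - cis (of_int n * - pi) / (\<i> * of_int n))) {-pi..pi}"
  proof (rule fundamental_theorem_of_calculus)
    fix x :: real
    have "((\<lambda>x. cis (of_int n * x)) has_vector_derivative (of_int n * \<i> * cis (of_int n * x))) (at x within {-pi..pi})"
      by (auto intro!: derivative_eq_intros has_vector_derivative_real_field
          simp: has_vector_derivative_def scaleR_conv_of_real algebra_simps)
    from has_vector_derivative_divide[OF this, of "\<i> * of_int n"] False
    show "((\<lambda>x. cis (of_int n * x) / (\<i> * of_int n)) has_vector_derivative cis (of_int n * x)) (at x within {-pi..pi})"
      by (simp add: field_simps)
  qed simp
  moreover have "cis (of_int n * pi) = cis (of_int n * - pi)"
  proof -
    have "cis (of_int n * pi) = cis (of_int n * - pi + 2 * pi * of_int n)"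
      by (rule arg_cong[where f = cis]) (simp add: algebra_simps)
    also have "\<dots> = cis (of_int n * - pi) * cis (2 * pi * of_int n)" by (simp only: cis_mult)
    finally show ?thesis by (simp only: cis_2pi_int mult_1_right)
  qed
  ultimately show ?thesis using False by simp
qed

lemma torus_cbox: "torus = cbox (-pi, -pi) (pi, pi)"
  by (simp add: torus_def cbox_Pair_eq)

lemma continuous_integrable_torus:
  fixes g :: "real \<times> real \<Rightarrow> 'b :: euclidean_space"
  assumes "continuous_on UNIV g"
  shows "set_integrable lborel torus g"
  unfolding torus_cbox
  using continuous_on_subset[OF assms subset_UNIV] by (intro borel_integrable_compact[of _ g, simplified set_integrable_def[symmetric]]) auto

lemma integral_torus_character:
  fixes m n :: int
  shows "(LINT k:torus|lborel. cis (of_int m * fst k) * cis (of_int n * snd k))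
    = (if m = 0 \<and> n = 0 then of_real (4 * pi\<^sup>2) else 0)"
proof -
  have c: "continuous_on S (\<lambda>k. cis (of_int m * fst k) * cis (of_int n * snd k))" for S
    by (intro continuous_intros)
  have 1: "integral {-pi..pi} (\<lambda>x. cis (of_int n * x)) = (if n = 0 then of_real (2 * pi) else 0)" for n
    using has_integral_cis_int by (rule integral_unique)
  have "(LINT k:torus|lborel. cis (of_int m * fst k) * cis (of_int n * snd k))
      = integral torus (\<lambda>k. cis (of_int m * fst k) * cis (of_int n * snd k))"
    by (intro set_borel_integral_eq_integral continuous_integrable_torus c)
  also have "\<dots> = integral (cbox (-pi) pi) (\<lambda>x. integral (cbox (-pi) pi) (\<lambda>y. cis (of_int m * x) * cis (of_int n * y)))"
    unfolding torus_cbox using integral_prod_continuous[of "-pi" "-pi" pi pi "\<lambda>k. cis (of_int m * fst k) * cis (of_int n * snd k)", OF c]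
    by simp
  also have "\<dots> = (if m = 0 \<and> n = 0 then of_real (4 * pi\<^sup>2) else 0)"
    by (simp add: 1 power2_eq_square)
  finally show ?thesis .
qed

abbreviation dotk :: "real \<times> real \<Rightarrow> int \<times> int \<Rightarrow> real" where
  "dotk k x \<equiv> fst k * of_int (fst x) + snd k * of_int (snd x)"

definition trig :: "(int \<times> int) set \<Rightarrow> state \<Rightarrow> real \<times> real \<Rightarrow> complex ^ 2" where
  "trig A \<Psi> k = (\<Sum>x\<in>A. cis (- dotk k x) *s \<Psi> x)"

lemma continuous_trig: "continuous_on S (trig A \<Psi>)"
proof -
  have "continuous_on S (\<lambda>k. cis (- dotk k x) *s \<Psi> x)" for x
  proof (rule continuous_on_vec_lambda[of S "\<lambda>i k. cis (- dotk k x) * \<Psi> x $ i", folded vector_scalar_mult_def])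
    fix i show "continuous_on S (\<lambda>k. cis (- dotk k x) * \<Psi> x $ i)" by (intro continuous_intros)
  qed
  then show ?thesis unfolding trig_def[abs_def] by (intro continuous_intros)
qed

lemma trig_periodic:
  "trig A \<Psi> (k + (2 * pi, 0)) = trig A \<Psi> k" "trig A \<Psi> (k + (0, 2 * pi)) = trig A \<Psi> k"
proof -
  have "cis (- dotk (k + (2 * pi, 0)) x) = cis (- dotk k x)" for x
  proof -
    have "- dotk (k + (2 * pi, 0)) x = - dotk k x + 2 * pi * of_int (- fst x)"
      by (simp add: algebra_simps)
    then have "cis (- dotk (k + (2 * pi, 0)) x) = cis (- dotk k x) * cis (2 * pi * of_int (- fst x))"
      by (simp only: cis_mult)
    then show ?thesis by (simp only: cis_2pi_int mult_1_right)
  qed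
  then show "trig A \<Psi> (k + (2 * pi, 0)) = trig A \<Psi> k" by (simp add: trig_def)
  have "cis (- dotk (k + (0, 2 * pi)) x) = cis (- dotk k x)" for x
  proof -
    have "- dotk (k + (0, 2 * pi)) x = - dotk k x + 2 * pi * of_int (- snd x)"
      by (simp add: algebra_simps)
    then have "cis (- dotk (k + (0, 2 * pi)) x) = cis (- dotk k x) * cis (2 * pi * of_int (- snd x))"
      by (simp only: cis_mult)
    then show ?thesis by (simp only: cis_2pi_int mult_1_right)
  qed
  then show "trig A \<Psi> (k + (0, 2 * pi)) = trig A \<Psi> k" by (simp add: trig_def)
qed

lemma continuous_cip:
  assumes "continuous_on S g" "continuous_on S h"
  shows "continuous_on S (\<lambda>k. cip (g k) (h k))"
  unfolding cip_def using assms by (intro continuous_intros)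

lemma parseval_trig:
  assumes "finite A"
  shows "(LINT k:torus|lborel. cip (trig A \<alpha> k) (trig A \<beta> k)) = of_real (4 * pi\<^sup>2) * (\<Sum>x\<in>A. cip (\<alpha> x) (\<beta> x))"
proof -
  define ch :: "int \<Rightarrow> int \<Rightarrow> real \<times> real \<Rightarrow> complex" where
    "ch m n k = cis (of_int m * fst k) * cis (of_int n * snd k)" for m n k
  have e: "cip (trig A \<alpha> k) (trig A \<beta> k) =
      (\<Sum>x\<in>A. \<Sum>y\<in>A. ch (fst x - fst y) (snd x - snd y) k * cip (\<alpha> x) (\<beta> y))" for k
  proof -
    have "cnj (cis (- dotk k x)) * cis (- dotk k y) = ch (fst x - fst y) (snd x - snd y) k" for x y
      by (simp add: ch_def cis_cnj cis_mult algebra_simps)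
    then show ?thesis
      unfolding trig_def cip_sum cip_linear sum_distrib_left mult.assoc[symmetric]
      by (subst sum.swap) (simp add: mult.commute)
  qed
  have ich: "set_integrable lborel torus (\<lambda>k. ch m n k * z)" for m n z
    unfolding ch_def by (intro continuous_integrable_torus continuous_intros)
  have "(LINT k:torus|lborel. cip (trig A \<alpha> k) (trig A \<beta> k))
    = (\<Sum>x\<in>A. \<Sum>y\<in>A. LINT k:torus|lborel. ch (fst x - fst y) (snd x - snd y) k * cip (\<alpha> x) (\<beta> y))"
    unfolding e using ich unfolding set_lebesgue_integral_def set_integrable_def scaleR_sum_right
    by (intro integral_double_sum) blast
  also have "\<dots> = (\<Sum>x\<in>A. \<Sum>y\<in>A. if x = y then of_real (4 * pi\<^sup>2) * cip (\<alpha> x) (\<beta> y) else 0)"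
  proof (intro sum.cong refl)
    fix x y
    have "(LINT k:torus|lborel. ch (fst x - fst y) (snd x - snd y) k) = (if x = y then of_real (4 * pi\<^sup>2) else 0)"
      using integral_torus_character[of "fst x - fst y" "snd x - snd y"] unfolding ch_def by (simp add: prod_eq_iff)
    then show "(LINT k:torus|lborel. ch (fst x - fst y) (snd x - snd y) k * cip (\<alpha> x) (\<beta> y))
        = (if x = y then of_real (4 * pi\<^sup>2) * cip (\<alpha> x) (\<beta> y) else 0)"
      by simp
  qed
  also have "\<dots> = of_real (4 * pi\<^sup>2) * (\<Sum>x\<in>A. cip (\<alpha> x) (\<beta> x))"
    using assms by (simp add: sum.delta' sum_distrib_left)
  finally show ?thesis .
qed

lemma norm_trig_integral:
  assumes "finite A"
  shows "(LINT k:torus|lborel. (norm (trig A \<alpha> k))\<^sup>2) = 4 * pi\<^sup>2 * (\<Sum>x\<in>A. (norm (\<alpha> x))\<^sup>2)"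
proof -
  have "complex_of_real (LINT k:torus|lborel. (norm (trig A \<alpha> k))\<^sup>2) = (LINT k:torus|lborel. cip (trig A \<alpha> k) (trig A \<alpha> k))"
    by (simp only: cip_self) (rule set_integral_complex_of_real[symmetric])
  also have "\<dots> = of_real (4 * pi\<^sup>2 * (\<Sum>x\<in>A. (norm (\<alpha> x))\<^sup>2))"
    unfolding parseval_trig[OF assms] by (simp only: cip_self of_real_mult of_real_sum)
  finally show ?thesis by (simp only: of_real_eq_iff)
qed

section \<open>Finite propagation and the action of one step on transforms\<close>

definition supp_le :: "nat \<Rightarrow> state \<Rightarrow> bool" where
  "supp_le n \<Psi> \<longleftrightarrow> (\<forall>x. \<Psi> x \<noteq> 0 \<longrightarrow> \<bar>fst x\<bar> \<le> int n \<and> \<bar>snd x\<bar> \<le> int n)"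

definition lbox :: "nat \<Rightarrow> (int \<times> int) set" where
  "lbox n = {- int n..int n} \<times> {- int n..int n}"

lemma finite_lbox [simp]: "finite (lbox n)"
  by (simp add: lbox_def)

lemma mem_lbox: "x \<in> lbox n \<longleftrightarrow> \<bar>fst x\<bar> \<le> int n \<and> \<bar>snd x\<bar> \<le> int n"
  by (auto simp: lbox_def mem_Times_iff)

lemma supp_le_D: "supp_le n \<Psi> \<Longrightarrow> x \<notin> lbox n \<Longrightarrow> \<Psi> x = 0"
  unfolding supp_le_def mem_lbox by blast

lemma shift_nth: "shift e \<Psi> x $ 1 = \<Psi> (x + e) $ 1" "shift e \<Psi> x $ 2 = \<Psi> (x - e) $ 2"
  by (simp_all add: shift_def)

lemma vec2_eq_0_iff: "(u :: complex ^ 2) = 0 \<longleftrightarrow> u $ 1 = 0 \<and> u $ 2 = 0"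
  by (auto intro: vector_2_eqI)

lemma supp_le_shift:
  assumes "supp_le n \<Psi>" "\<bar>fst e\<bar> + \<bar>snd e\<bar> \<le> 1"
  shows "supp_le (Suc n) (shift e \<Psi>)"
  unfolding supp_le_def
proof (intro allI impI)
  fix x assume "shift e \<Psi> x \<noteq> 0"
  then have "\<Psi> (x + e) \<noteq> 0 \<or> \<Psi> (x - e) \<noteq> 0"
    unfolding vec2_eq_0_iff shift_nth by auto
  then have "\<bar>fst (x + e)\<bar> \<le> int n \<and> \<bar>snd (x + e)\<bar> \<le> int n \<or> \<bar>fst (x - e)\<bar> \<le> int n \<and> \<bar>snd (x - e)\<bar> \<le> int n"
    using assms(1) unfolding supp_le_def by blast
  then show "\<bar>fst x\<bar> \<le> int (Suc n) \<and> \<bar>snd x\<bar> \<le> int (Suc n)"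
    using assms(2) by (auto simp: abs_if split: if_splits)
qed

lemma supp_le_coin: "supp_le n \<Psi> \<Longrightarrow> supp_le n (coin_op \<alpha> \<Psi>)"
  unfolding supp_le_def coin_op_def by (metis matrix_vector_mult_0_right)

text \<open>A shift enlarges the support by at most one site, so the sum on the left runs over a
  larger box and no translated term is lost; the two components move in opposite directions and get
  conjugate phases.\<close>

lemma trig_shift:
  assumes "supp_le n \<Psi>" "\<bar>fst e\<bar> + \<bar>snd e\<bar> \<le> 1" "m \<ge> Suc n"
  shows "trig (lbox m) (shift e \<Psi>) k = phase_matrix (dotk k e) *v trig (lbox n) \<Psi> k"
proof -
  have g: "(\<Sum>x\<in>lbox m. cis (- dotk k x) * \<Psi> (x + d) $ i) = cis (dotk k d) * (\<Sum>x\<in>lbox n. cis (- dotk k x) * \<Psi> x $ i)"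
    if d: "\<bar>fst d\<bar> + \<bar>snd d\<bar> \<le> 1" for d i
  proof -
    have "(\<Sum>x\<in>lbox m. cis (- dotk k x) * \<Psi> (x + d) $ i) = (\<Sum>z\<in>(\<lambda>x. x + d) ` lbox m. cis (- dotk k (z - d)) * \<Psi> z $ i)"
      by (subst sum.reindex) (auto intro: inj_onI)
    also have "\<dots> = (\<Sum>z\<in>lbox n. cis (- dotk k (z - d)) * \<Psi> z $ i)"
    proof (rule sum.mono_neutral_right)
      show "lbox n \<subseteq> (\<lambda>x. x + d) ` lbox m"
      proof
        fix z assume "z \<in> lbox n"
        then have "z - d \<in> lbox m" using d assms(3) unfolding mem_lbox by auto
        then show "z \<in> (\<lambda>x. x + d) ` lbox m" by (rule rev_image_eqI) simp
      qed
    qed (auto dest: supp_le_D[OF assms(1)])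
    also have "\<dots> = cis (dotk k d) * (\<Sum>x\<in>lbox n. cis (- dotk k x) * \<Psi> x $ i)"
      unfolding sum_distrib_left mult.assoc[symmetric] cis_mult by (simp add: algebra_simps)
    finally show ?thesis .
  qed
  show ?thesis
    using g[of e 1] g[of "- e" 2] assms(2)
    by (intro vector_2_eqI)
       (simp_all add: trig_def shift_nth phase_matrix_def matrix_vector_mult_def sum_2)
qed

lemma matrix_vector_mult_sum: "M *v (\<Sum>x\<in>A. g x) = (\<Sum>x\<in>A. M *v g x)" for M :: "complex ^ 2 ^ 2"
  by (induction A rule: infinite_finite_induct) (simp_all add: matrix_vector_right_distrib)

lemma matrix_vector_mult_smult: "M *v (z *s u) = z *s (M *v u)" for M :: "complex ^ 2 ^ 2"
  by (intro vector_2_eqI) (simp_all add: matrix_vector_mult_def sum_2 algebra_simps)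

lemma trig_coin: "trig A (coin_op \<alpha> \<Psi>) k = coin \<alpha> *v trig A \<Psi> k"
  by (simp add: trig_def coin_op_def matrix_vector_mult_sum matrix_vector_mult_smult)

text \<open>One step contains two shifts, each enlarging the box by one. The resulting speed bound 2
  is the source of the test square for the scaled positions.\<close>

lemma supp_le_walk: "supp_le n \<Psi> \<Longrightarrow> supp_le (n + 2) (walk a1 a2 \<Psi>)"
  using supp_le_shift[OF supp_le_coin[OF supp_le_shift[OF supp_le_coin, of n \<Psi> "(1,0)" a1]], of "(0,1)" a2]
  by (simp add: walk_def numeral_2_eq_2)

lemma trig_walk:
  assumes "supp_le n \<Psi>"
  shows "trig (lbox (n + 2)) (walk a1 a2 \<Psi>) k = Uhat a1 a2 k *v trig (lbox n) \<Psi> k"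
proof -
  define \<Phi> where "\<Phi> = shift (1, 0) (coin_op a1 \<Psi>)"
  have s1: "supp_le (Suc n) \<Phi>"
    unfolding \<Phi>_def by (intro supp_le_shift supp_le_coin assms) simp
  have 1: "trig (lbox (Suc n)) \<Phi> k = phase_matrix (fst k) *v (coin a1 *v trig (lbox n) \<Psi> k)"
    unfolding \<Phi>_def using trig_shift[OF supp_le_coin[OF assms], of "(1,0)" "Suc n" a1 k]
    by (simp add: trig_coin)
  have "trig (lbox (n + 2)) (walk a1 a2 \<Psi>) k = phase_matrix (snd k) *v (coin a2 *v trig (lbox (Suc n)) \<Phi> k)"
    using trig_shift[OF supp_le_coin[OF s1], of "(0,1)" "n + 2" a2 k] by (simp add: trig_coin walk_def \<Phi>_def)
  then show ?thesis
    unfolding 1 by (simp add: Uhat_def matrix_vector_mul_assoc matrix_mul_assoc)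
qed

section \<open>Finitely supported initial states\<close>

definition scaled :: "nat \<Rightarrow> int \<times> int \<Rightarrow> real \<times> real" where
  "scaled t x = (of_int (fst x) / of_nat t, of_int (snd x) / of_nat t)"

context walk_params begin

abbreviation evolve :: "nat \<Rightarrow> state \<Rightarrow> state" where
  "evolve t \<Psi> \<equiv> (walk a1 a2 ^^ t) \<Psi>"

lemma supp_le_evolve: "supp_le n \<Psi> \<Longrightarrow> supp_le (n + 2 * t) (evolve t \<Psi>)"
proof (induction t)
  case (Suc t)
  then show ?case using supp_le_walk[of "n + 2 * t" "evolve t \<Psi>" a1 a2] by simp
qed simp

lemma trig_evolve:
  assumes "supp_le n \<Psi>"
  shows "trig (lbox (n + 2 * t)) (evolve t \<Psi>) k = (U k ^^ t) (trig (lbox n) \<Psi> k)"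
proof (induction t)
  case (Suc t)
  show ?case using trig_walk[OF supp_le_evolve[OF assms, of t], of a1 a2 k] Suc by simp
qed simp

lemma norm_U_power: "norm ((U k ^^ t) u) = norm u"
  by (induction t) (simp_all add: norm_U)

lemma evolve_norm_sum:
  assumes "supp_le n \<Psi>"
  shows "(\<Sum>x\<in>lbox (n + 2 * t). (norm (evolve t \<Psi> x))\<^sup>2) = (\<Sum>x\<in>lbox n. (norm (\<Psi> x))\<^sup>2)"
  using norm_trig_integral[of "lbox (n + 2 * t)" "evolve t \<Psi>"] norm_trig_integral[of "lbox n" \<Psi>]
  unfolding trig_evolve[OF assms] norm_U_power by simp

text \<open>Parseval, with the character of the scaled position absorbed into the second factor,
  where it translates the wave vector by \<xi> / t.\<close>

lemma characteristic_sum: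
  assumes "supp_le n \<Psi>" "t > 0"
  shows "(\<Sum>x\<in>lbox (n + 2 * t). cis (\<xi> \<bullet> scaled t x) * of_real ((norm (evolve t \<Psi> x))\<^sup>2))
    = 1 / (4 * pi\<^sup>2) * (LINT k:torus|lborel. cip ((U k ^^ t) (trig (lbox n) \<Psi> k))
        ((U (k - (1 / real t) *\<^sub>R \<xi>) ^^ t) (trig (lbox n) \<Psi> (k - (1 / real t) *\<^sub>R \<xi>))))"
proof -
  define A where "A = lbox (n + 2 * t)"
  define \<beta> where "\<beta> x = cis (\<xi> \<bullet> scaled t x) *s evolve t \<Psi> x" for x
  have \<beta>: "trig A \<beta> k = trig A (evolve t \<Psi>) (k - (1 / real t) *\<^sub>R \<xi>)" for k
  proof -
    have "- dotk (k - (1 / real t) *\<^sub>R \<xi>) x = - dotk k x + \<xi> \<bullet> scaled t x" for x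
      by (simp add: scaled_def inner_prod_def algebra_simps)
    then have "cis (- dotk (k - (1 / real t) *\<^sub>R \<xi>) x) = cis (- dotk k x) * cis (\<xi> \<bullet> scaled t x)" for x
      by (simp only: cis_mult)
    then show ?thesis by (simp only: trig_def \<beta>_def vector_smult_assoc)
  qed
  have "cip (evolve t \<Psi> x) (\<beta> x) = cis (\<xi> \<bullet> scaled t x) * of_real ((norm (evolve t \<Psi> x))\<^sup>2)" for x
    by (simp only: \<beta>_def cip_linear cip_self)
  then have "(\<Sum>x\<in>A. cis (\<xi> \<bullet> scaled t x) * of_real ((norm (evolve t \<Psi> x))\<^sup>2)) = (\<Sum>x\<in>A. cip (evolve t \<Psi> x) (\<beta> x))"
    by (simp only:)
  also have "\<dots> = 1 / (4 * pi\<^sup>2) * (LINT k:torus|lborel. cip (trig A (evolve t \<Psi>) k) (trig A \<beta> k))"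
    using parseval_trig[of A "evolve t \<Psi>" \<beta>] by (simp add: A_def)
  finally show ?thesis unfolding \<beta> unfolding A_def trig_evolve[OF assms(1)] .
qed

lemma continuous_U:
  assumes "continuous_on S g"
  shows "continuous_on S (\<lambda>k. U k (g k))"
proof -
  have A: "continuous_on S Am" "continuous_on S Bm"
    unfolding Am_def[abs_def] Bm_def[abs_def] by (intro continuous_intros)+
  have "(\<lambda>k. U k (g k)) = (\<lambda>k. \<chi> i. if i = 1 then Am k * g k $ 1 + Bm k * g k $ 2 else - cnj (Bm k) * g k $ 1 + cnj (Am k) * g k $ 2)"
    by (intro ext vector_2_eqI) (simp_all add: U_nth)
  moreover have "continuous_on S (\<lambda>k. \<chi> i::2. if i = 1 then Am k * g k $ 1 + Bm k * g k $ 2 else - cnj (Bm k) * g k $ 1 + cnj (Am k) * g k $ 2)"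
  proof (rule continuous_on_vec_lambda)
    fix i :: 2
    show "continuous_on S (\<lambda>k. if i = 1 then Am k * g k $ 1 + Bm k * g k $ 2 else - cnj (Bm k) * g k $ 1 + cnj (Am k) * g k $ 2)"
      by (cases "i = 1") (auto intro!: continuous_intros A assms)
  qed
  ultimately show ?thesis by (simp only:)
qed

lemma continuous_\<tau>: "continuous_on S (\<tau> a1 a2)"
  unfolding \<tau>_def[abs_def] by (intro continuous_intros)

lemma continuous_Y:
  assumes "continuous_on S g"
  shows "continuous_on S (\<lambda>k. Y k (g k))"
  unfolding Y_def using sqrt_W(1)
  by (intro continuous_intros continuous_U continuous_\<tau> continuous_W assms) (auto simp: less_le)

lemma continuous_\<omega>: "continuous_on S (\<omega> a1 a2)"
  using has_derivative_\<omega> by (meson continuous_at_imp_continuous_on has_derivative_continuous)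

lemma continuous_Dm:
  assumes "continuous_on S g"
  shows "continuous_on S (\<lambda>k. Dm k (g k))"
  unfolding Dm_def using sqrt_W(1)
  by (intro continuous_intros continuous_cip continuous_U continuous_W assms) (auto simp: less_le)

lemma continuous_U_power:
  assumes "continuous_on S g"
  shows "continuous_on S (\<lambda>k. (U k ^^ t) (g k))"
  unfolding U_power by (intro continuous_intros continuous_\<omega> continuous_Y assms)

text \<open>For the same k both powers rotate in the plane of u and Y u; since
  \<open>cip u (Y k u)\<close> is purely imaginary and Y preserves the norm, only the difference of
  the angles survives.\<close>

lemma cip_rotation:
  "cip (cos x *\<^sub>R u + sin x *\<^sub>R Y k u) (cos y *\<^sub>R u + sin y *\<^sub>R Y k u)
    = of_real (cos (y - x) * (norm u)\<^sup>2) + \<i> * of_real (sin (y - x) * Dm k u)"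
  unfolding cip_linear cip_Y cip_Y_Y cip_self
  by (simp add: norm_Y cos_diff sin_diff algebra_simps)

text \<open>Equals cis (\<xi> \<bullet> v) times the + weight plus cis (- \<xi> \<bullet> v) times
  the - weight, v being the velocity at k.\<close>

definition char_limit :: "(real \<times> real \<Rightarrow> complex ^ 2) \<Rightarrow> real \<times> real \<Rightarrow> real \<times> real \<Rightarrow> complex" where
  "char_limit u \<xi> k = of_real (cos (\<xi> \<bullet> vel k) * (norm (u k))\<^sup>2) + \<i> * of_real (sin (\<xi> \<bullet> vel k) * Dm k (u k))"

lemma cip_power_tendsto:
  assumes u: "continuous_on UNIV u"
  shows "(\<lambda>t. cip ((U k ^^ t) (u k)) ((U (k - (1 / real t) *\<^sub>R \<xi>) ^^ t) (u (k - (1 / real t) *\<^sub>R \<xi>))))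
    \<longlonglongrightarrow> char_limit u \<xi> k"
proof -
  define kt where "kt t = k - (1 / real t) *\<^sub>R \<xi>" for t :: nat
  have kt: "kt \<longlonglongrightarrow> k"
    unfolding kt_def[abs_def] using tendsto_diff[OF tendsto_const tendsto_scaleR[OF lim_1_over_n tendsto_const]]
    by fastforce
  define w where "w t = (U k ^^ t) (u k)" for t
  \<comment> \<open>Only the rapidly turning phase keeps the translated wave vector; u and Y are
    frozen at k. The inner product with \<open>w\<close> is then explicit, and the error needs only
    continuity of u and Y, because cosine and sine are bounded whatever t is.\<close>
  define y where "y t = cos (t * \<omega> a1 a2 (kt t)) *\<^sub>R u k + sin (t * \<omega> a1 a2 (kt t)) *\<^sub>R Y k (u k)" for t :: nat
  define z where "z t = (U (kt t) ^^ t) (u (kt t))" for t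
  have "(\<lambda>t. cip (w t) (y t)) = (\<lambda>t. of_real (cos (t * (\<omega> a1 a2 (kt t) - \<omega> a1 a2 k)) * (norm (u k))\<^sup>2)
      + \<i> * of_real (sin (t * (\<omega> a1 a2 (kt t) - \<omega> a1 a2 k)) * Dm k (u k)))"
    by (simp add: w_def y_def U_power cip_rotation right_diff_distrib)
  moreover have "\<dots> \<longlonglongrightarrow> char_limit u \<xi> k"
    unfolding char_limit_def using \<omega>_difference_quotient[of k \<xi>]
    by (auto intro!: tendsto_intros simp: kt_def)
  ultimately have main: "(\<lambda>t. cip (w t) (y t)) \<longlonglongrightarrow> char_limit u \<xi> k" by simp
  have zy: "norm (z t - y t) \<le> norm (u (kt t) - u k) + norm (Y (kt t) (u (kt t)) - Y k (u k))" for t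
  proof -
    have "z t - y t = cos (t * \<omega> a1 a2 (kt t)) *\<^sub>R (u (kt t) - u k)
        + sin (t * \<omega> a1 a2 (kt t)) *\<^sub>R (Y (kt t) (u (kt t)) - Y k (u k))"
      by (simp add: z_def y_def U_power algebra_simps)
    also have "norm \<dots> \<le> \<bar>cos (t * \<omega> a1 a2 (kt t))\<bar> * norm (u (kt t) - u k)
        + \<bar>sin (t * \<omega> a1 a2 (kt t))\<bar> * norm (Y (kt t) (u (kt t)) - Y k (u k))"
      by (rule norm_triangle_le) simp
    also have "\<dots> \<le> 1 * norm (u (kt t) - u k) + 1 * norm (Y (kt t) (u (kt t)) - Y k (u k))"
      by (intro add_mono mult_right_mono) auto
    finally show ?thesis by simp
  qed
  have ic: "isCont u k" "isCont (\<lambda>k. Y k (u k)) k"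
    using u continuous_Y[OF u] unfolding continuous_on_eq_continuous_at[OF open_UNIV] by blast+
  have c: "(\<lambda>t. u (kt t)) \<longlonglongrightarrow> u k" "(\<lambda>t. Y (kt t) (u (kt t))) \<longlonglongrightarrow> Y k (u k)"
    by (rule isCont_tendsto_compose[OF ic(1) kt], rule isCont_tendsto_compose[OF ic(2) kt])
  have "(\<lambda>t. norm (u k) * (norm (u (kt t) - u k) + norm (Y (kt t) (u (kt t)) - Y k (u k)))) \<longlonglongrightarrow>
      norm (u k) * (norm (u k - u k) + norm (Y k (u k) - Y k (u k)))"
    by (intro tendsto_intros c)
  then have "(\<lambda>t. norm (u k) * (norm (u (kt t) - u k) + norm (Y (kt t) (u (kt t)) - Y k (u k)))) \<longlonglongrightarrow> 0" by simp
  note z0 = this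
  have le: "norm (cip (w t) (z t) - cip (w t) (y t)) \<le> norm (u k) * (norm (u (kt t) - u k) + norm (Y (kt t) (u (kt t)) - Y k (u k)))" for t
  proof -
    have "norm (cip (w t) (z t) - cip (w t) (y t)) = norm (cip (w t) (z t - y t))" by (simp add: cip_linear)
    also have "\<dots> \<le> norm (w t) * norm (z t - y t)" by (rule norm_cip_le)
    also have "\<dots> \<le> norm (u k) * (norm (u (kt t) - u k) + norm (Y (kt t) (u (kt t)) - Y k (u k)))"
      using zy by (simp add: w_def norm_U_power mult_left_mono)
    finally show ?thesis .
  qed
  have "(\<lambda>t. cip (w t) (z t) - cip (w t) (y t)) \<longlonglongrightarrow> 0"
    by (rule Lim_null_comparison[OF always_eventually[OF allI[OF le]] z0])
  from tendsto_add[OF this main] show ?thesis by (simp add: w_def z_def kt_def)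
qed

lemma norm_trig_le: "norm (trig A \<Psi> k) \<le> (\<Sum>x\<in>A. norm (\<Psi> x))"
proof -
  have "norm (cis r *s v) = norm v" for r and v :: "complex ^ 2"
  proof -
    have "(norm (cis r *s v))\<^sup>2 = (norm v)\<^sup>2" by (simp add: norm_sq_2 norm_mult)
    then show ?thesis by simp
  qed
  then show ?thesis unfolding trig_def by (intro order_trans[OF norm_sum]) simp
qed

lemma characteristic_tendsto:
  assumes "supp_le n \<Psi>"
  shows "(\<lambda>t. \<Sum>x\<in>lbox (n + 2 * t). cis (\<xi> \<bullet> scaled t x) * of_real ((norm (evolve t \<Psi> x))\<^sup>2))
    \<longlonglongrightarrow> 1 / (4 * pi\<^sup>2) * (LINT k:torus|lborel. char_limit (trig (lbox n) \<Psi>) \<xi> k)"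
proof -
  define u where "u = trig (lbox n) \<Psi>"
  have u: "continuous_on UNIV u" unfolding u_def by (rule continuous_trig)
  define C where "C = (\<Sum>x\<in>lbox n. norm (\<Psi> x))"
  have C: "norm (u k) \<le> C" "0 \<le> C" for k unfolding u_def C_def by (auto intro: norm_trig_le sum_nonneg)
  define G where "G t k = cip ((U k ^^ t) (u k)) ((U (k - (1 / real t) *\<^sub>R \<xi>) ^^ t) (u (k - (1 / real t) *\<^sub>R \<xi>)))" for t k
  have cG: "continuous_on UNIV (G t)" for t
  proof -
    have "continuous_on UNIV (\<lambda>k. (U k ^^ t) (u k))" by (rule continuous_U_power[OF u])
    moreover have "continuous_on UNIV (\<lambda>k. k - (1 / real t) *\<^sub>R \<xi>)" by (intro continuous_intros)
    ultimately have "continuous_on UNIV (\<lambda>k. (U (k - (1 / real t) *\<^sub>R \<xi>) ^^ t) (u (k - (1 / real t) *\<^sub>R \<xi>)))"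
      by (rule continuous_on_compose2) simp
    then show ?thesis unfolding G_def[abs_def] by (intro continuous_cip continuous_U_power u)
  qed
  have cL: "continuous_on UNIV (char_limit u \<xi>)"
    unfolding char_limit_def[abs_def] by (intro continuous_intros continuous_vel continuous_Dm u)
  have bound: "norm (G t k) \<le> C\<^sup>2" for t k
  proof -
    have "norm (G t k) \<le> norm (u k) * norm (u (k - (1 / real t) *\<^sub>R \<xi>))"
      unfolding G_def by (rule order_trans[OF norm_cip_le]) (simp add: norm_U_power)
    also have "\<dots> \<le> C * C" using C by (intro mult_mono) auto
    finally show ?thesis by (simp add: power2_eq_square)
  qed
  have "(\<lambda>t. LINT k:torus|lborel. G t k) \<longlonglongrightarrow> (LINT k:torus|lborel. char_limit u \<xi> k)"
    unfolding set_lebesgue_integral_def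
  proof (rule integral_dominated_convergence)
    show "(\<lambda>k. indicator torus k *\<^sub>R char_limit u \<xi> k) \<in> borel_measurable lborel"
      using borel_measurable_continuous_onI[OF cL] by measurable
    show "(\<lambda>k. indicator torus k *\<^sub>R G t k) \<in> borel_measurable lborel" for t
      using borel_measurable_continuous_onI[OF cG[of t]] by measurable
    have "set_integrable lborel torus (\<lambda>k. C\<^sup>2)" by (intro continuous_integrable_torus continuous_intros)
    then show "integrable lborel (\<lambda>k. indicator torus k * C\<^sup>2)" by (simp add: set_integrable_def)
    show "AE k in lborel. (\<lambda>t. indicator torus k *\<^sub>R G t k) \<longlonglongrightarrow> indicator torus k *\<^sub>R char_limit u \<xi> k"
      unfolding G_def by (intro AE_I2 tendsto_scaleR tendsto_const cip_power_tendsto u)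
    show "AE k in lborel. norm (indicator torus k *\<^sub>R G t k) \<le> indicator torus k * C\<^sup>2" for t
      using bound by (auto simp: indicator_def)
  qed
  then have lim: "(\<lambda>t. 1 / (4 * pi\<^sup>2) * (LINT k:torus|lborel. G t k)) \<longlonglongrightarrow> 1 / (4 * pi\<^sup>2) * (LINT k:torus|lborel. char_limit u \<xi> k)"
    by (intro tendsto_intros)
  have "eventually (\<lambda>t. 1 / (4 * pi\<^sup>2) * (LINT k:torus|lborel. G t k)
      = (\<Sum>x\<in>lbox (n + 2 * t). cis (\<xi> \<bullet> scaled t x) * of_real ((norm (evolve t \<Psi> x))\<^sup>2))) sequentially"
    using eventually_gt_at_top[of 0]
  proof eventually_elim
    case (elim t)
    then show ?case using characteristic_sum[OF assms, of t \<xi>] by (simp add: G_def u_def)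
  qed
  from Lim_transform_eventually[OF lim this] show ?thesis by (simp only: u_def)
qed

text \<open>The limit expectation of h before the change to velocity coordinates.\<close>

definition limit_functional :: "(real \<times> real \<Rightarrow> real) \<Rightarrow> (real \<times> real \<Rightarrow> complex ^ 2) \<Rightarrow> real" where
  "limit_functional h u = 1 / (4 * pi\<^sup>2) * (\<Sum>s\<in>{1, -1}. LINT k:torus|lborel. h (s *\<^sub>R vel k) * Q s k (u k))"

definition expectation :: "nat \<Rightarrow> (real \<times> real \<Rightarrow> real) \<Rightarrow> state \<Rightarrow> real" where
  "expectation t h \<Psi> = (LINT x|count_space UNIV. h (scaled t x) * (norm (evolve t \<Psi> x))\<^sup>2)"

lemma expectation_finite:
  assumes "supp_le n \<Psi>"
  shows "expectation t h \<Psi> = (\<Sum>x\<in>lbox (n + 2 * t). h (scaled t x) * (norm (evolve t \<Psi> x))\<^sup>2)"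
proof -
  have s: "{x. h (scaled t x) * (norm (evolve t \<Psi> x))\<^sup>2 \<noteq> 0} \<subseteq> lbox (n + 2 * t)"
    using supp_le_D[OF supp_le_evolve[OF assms]] by fastforce
  have "expectation t h \<Psi> = (\<Sum>x | h (scaled t x) * (norm (evolve t \<Psi> x))\<^sup>2 \<noteq> 0. h (scaled t x) * (norm (evolve t \<Psi> x))\<^sup>2)"
    unfolding expectation_def
    using finite_subset[OF s finite_lbox]
    by (subst lebesgue_integral_count_space_finite_support) (simp_all only: UNIV_I simp_thms)
  also have "\<dots> = (\<Sum>x\<in>lbox (n + 2 * t). h (scaled t x) * (norm (evolve t \<Psi> x))\<^sup>2)"
    using s by (intro sum.mono_neutral_left) auto
  finally show ?thesis .
qed

end

text \<open>Cosines with a free phase include constants and sines, so sums of them form a real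
  algebra, as the Stone--Weierstrass theorem requires.\<close>

inductive_set trigfun :: "(real \<times> real \<Rightarrow> real) set" where
  cos: "(\<lambda>v. c * cos (\<xi> \<bullet> v + \<eta>)) \<in> trigfun"
| add: "g \<in> trigfun \<Longrightarrow> h \<in> trigfun \<Longrightarrow> (\<lambda>v. g v + h v) \<in> trigfun"

lemma trigfun_mult_cos: "h \<in> trigfun \<Longrightarrow> (\<lambda>v. (c * cos (\<xi> \<bullet> v + \<eta>)) * h v) \<in> trigfun"
proof (induction rule: trigfun.induct)
  case (cos c' \<xi>' \<eta>')
  have prod: "(\<lambda>v. (c * cos (\<xi> \<bullet> v + \<eta>)) * (c' * cos (\<xi>' \<bullet> v + \<eta>')))
      = (\<lambda>v. (c * c' / 2) * cos ((\<xi> - \<xi>') \<bullet> v + (\<eta> - \<eta>')) + (c * c' / 2) * cos ((\<xi> + \<xi>') \<bullet> v + (\<eta> + \<eta>')))"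
  proof
    fix v
    have e: "(\<xi> - \<xi>') \<bullet> v + (\<eta> - \<eta>') = (\<xi> \<bullet> v + \<eta>) - (\<xi>' \<bullet> v + \<eta>')" "(\<xi> + \<xi>') \<bullet> v + (\<eta> + \<eta>') = (\<xi> \<bullet> v + \<eta>) + (\<xi>' \<bullet> v + \<eta>')"
      by (simp_all add: inner_add_left inner_diff_left)
    show "(c * cos (\<xi> \<bullet> v + \<eta>)) * (c' * cos (\<xi>' \<bullet> v + \<eta>'))
      = (c * c' / 2) * cos ((\<xi> - \<xi>') \<bullet> v + (\<eta> - \<eta>')) + (c * c' / 2) * cos ((\<xi> + \<xi>') \<bullet> v + (\<eta> + \<eta>'))"
      unfolding e cos_add[of "\<xi> \<bullet> v + \<eta>" "\<xi>' \<bullet> v + \<eta>'"] cos_diff[of "\<xi> \<bullet> v + \<eta>" "\<xi>' \<bullet> v + \<eta>'"]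
      by (simp add: field_simps)
  qed
  show ?case unfolding prod by (intro trigfun.intros)
next
  case (add g h)
  then show ?case using trigfun.add by (auto simp: distrib_left)
qed

lemma trigfun_mult: "g \<in> trigfun \<Longrightarrow> h \<in> trigfun \<Longrightarrow> (\<lambda>v. g v * h v) \<in> trigfun"
proof (induction rule: trigfun.induct)
  case (cos c \<xi> \<eta>)
  then show ?case by (intro trigfun_mult_cos)
next
  case (add g g')
  then show ?case using trigfun.add by (auto simp: distrib_right)
qed

lemma trigfun_continuous: "g \<in> trigfun \<Longrightarrow> continuous_on S g"
  by (induction rule: trigfun.induct) (auto intro!: continuous_intros)

lemma trigfun_approx:
  assumes "continuous_on UNIV h" "e > 0"
  obtains g where "g \<in> trigfun" "\<And>v. v \<in> cbox (- 3, - 3) (3, 3) \<Longrightarrow> \<bar>h v - g v\<bar> < e"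
proof -
  interpret function_ring_on trigfun "cbox (- 3, - 3) (3, 3)"
  proof
    show "(\<lambda>_. c) \<in> trigfun" for c using trigfun.cos[of c 0 0] by simp
    fix x y :: "real \<times> real" assume "x \<noteq> y"
    define d where "d = y - x"
    have d: "d \<bullet> d > 0" using \<open>x \<noteq> y\<close> by (simp add: d_def)
    \<comment> \<open>The frequency for which the phases at x and y differ by exactly pi, so that
      the cosine takes the values 1 and -1.\<close>
    define \<xi> where "\<xi> = (pi / (d \<bullet> d)) *\<^sub>R d"
    have "\<xi> \<bullet> y + (- (\<xi> \<bullet> x)) = \<xi> \<bullet> d" by (simp add: d_def inner_diff_right)
    also have "\<xi> \<bullet> d = pi" using d by (simp add: \<xi>_def)
    finally have "1 * cos (\<xi> \<bullet> x + (- (\<xi> \<bullet> x))) \<noteq> 1 * cos (\<xi> \<bullet> y + (- (\<xi> \<bullet> x)))" by simp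
    then show "\<exists>f\<in>trigfun. f x \<noteq> f y" using trigfun.cos[of 1 \<xi> "- (\<xi> \<bullet> x)"] by (intro bexI)
  qed (auto intro: trigfun_continuous trigfun.add trigfun_mult)
  show thesis
    using Stone_Weierstrass_basic[OF continuous_on_subset[OF assms(1)] assms(2)] that by auto
qed

section \<open>From trigonometric to continuous test functions\<close>

context walk_params begin

lemma continuous_Q:
  assumes "continuous_on S u"
  shows "continuous_on S (\<lambda>k. Q s k (u k))"
  unfolding Q_def by (intro continuous_intros continuous_Dm assms) simp

lemma integrable_limit_functional:
  assumes "continuous_on UNIV u" "continuous_on UNIV h"
  shows "set_integrable lborel torus (\<lambda>k. h (s *\<^sub>R vel k) * Q s k (u k))"
proof -
  have "continuous_on UNIV (\<lambda>k. h (s *\<^sub>R vel k))"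
    by (rule continuous_on_compose2[OF assms(2)]) (auto intro!: continuous_intros continuous_vel)
  then show ?thesis by (intro continuous_integrable_torus continuous_intros continuous_Q assms)
qed

lemma limit_functional_add:
  assumes "continuous_on UNIV u" "continuous_on UNIV g" "continuous_on UNIV h"
  shows "limit_functional (\<lambda>v. g v + h v) u = limit_functional g u + limit_functional h u"
  using integrable_limit_functional[OF assms(1,2)] integrable_limit_functional[OF assms(1,3)]
  by (simp add: limit_functional_def distrib_right set_integral_add algebra_simps add_divide_distrib)

lemma limit_functional_cos:
  assumes "continuous_on UNIV u"
  shows "limit_functional (\<lambda>v. c * cos (\<xi> \<bullet> v + \<eta>)) u
    = c * Re (cis \<eta> * (1 / (4 * pi\<^sup>2) * (LINT k:torus|lborel. char_limit u \<xi> k)))"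
proof -
  define T where "T v = c * cos (\<xi> \<bullet> v + \<eta>)" for v
  have cT: "continuous_on UNIV T" unfolding T_def[abs_def] by (intro continuous_intros)
  have cL: "continuous_on UNIV (char_limit u \<xi>)"
    unfolding char_limit_def[abs_def] by (intro continuous_intros continuous_vel continuous_Dm assms)
  have e: "T (1 *\<^sub>R vel k) * Q 1 k (u k) + T ((-1) *\<^sub>R vel k) * Q (-1) k (u k) = Re (of_real c * cis \<eta> * char_limit u \<xi> k)" for k
    by (simp add: T_def Q_def char_limit_def cos_add cos_diff field_simps inner_minus_right)
  have "(\<Sum>s\<in>{1, -1}. LINT k:torus|lborel. T (s *\<^sub>R vel k) * Q s k (u k))
     = (LINT k:torus|lborel. T (1 *\<^sub>R vel k) * Q 1 k (u k) + T ((-1) *\<^sub>R vel k) * Q (-1) k (u k))"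
    using set_integral_add(2)[OF integrable_limit_functional[OF assms cT, of 1] integrable_limit_functional[OF assms cT, of "-1"]]
    by simp
  also have "\<dots> = (LINT k:torus|lborel. Re (of_real c * cis \<eta> * char_limit u \<xi> k))"
    by (simp only: e)
  also have "\<dots> = Re (LINT k:torus|lborel. of_real c * cis \<eta> * char_limit u \<xi> k)"
  proof -
    have "set_integrable lborel torus (\<lambda>k. of_real c * cis \<eta> * char_limit u \<xi> k)"
      by (intro continuous_integrable_torus continuous_intros cL)
    then show ?thesis
      unfolding set_lebesgue_integral_def set_integrable_def
      by (subst integral_Re[symmetric]) simp_all
  qed
  also have "\<dots> = Re (of_real c * cis \<eta> * (LINT k:torus|lborel. char_limit u \<xi> k))" by simp
  finally show ?thesis
    unfolding limit_functional_def T_def by (simp add: field_simps)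
qed

lemma trigfun_tendsto:
  assumes "g \<in> trigfun" "supp_le n \<Psi>"
  shows "(\<lambda>t. expectation t g \<Psi>) \<longlonglongrightarrow> limit_functional g (trig (lbox n) \<Psi>)"
  using assms(1)
proof (induction rule: trigfun.induct)
  case (cos c \<xi> \<eta>)
  have "expectation t (\<lambda>v. c * cos (\<xi> \<bullet> v + \<eta>)) \<Psi> =
     c * Re (cis \<eta> * (\<Sum>x\<in>lbox (n + 2 * t). cis (\<xi> \<bullet> scaled t x) * of_real ((norm (evolve t \<Psi> x))\<^sup>2)))" for t
    unfolding expectation_finite[OF assms(2)] sum_distrib_left Re_sum
    by (intro sum.cong refl) (simp add: cos_add algebra_simps del: of_real_power)
  then show ?case
    unfolding limit_functional_cos[OF continuous_trig]
    by (simp only:) (intro tendsto_intros characteristic_tendsto assms(2))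
next
  case (add g h)
  have "expectation t (\<lambda>v. g v + h v) \<Psi> = expectation t g \<Psi> + expectation t h \<Psi>" for t
    unfolding expectation_finite[OF assms(2)] by (simp add: distrib_right sum.distrib)
  moreover have "limit_functional (\<lambda>v. g v + h v) (trig (lbox n) \<Psi>) = limit_functional g (trig (lbox n) \<Psi>) + limit_functional h (trig (lbox n) \<Psi>)"
    using add by (intro limit_functional_add continuous_trig trigfun_continuous)
  ultimately show ?case using add by (simp add: tendsto_add)
qed

lemma vel_bounded:
  assumes "s \<in> {1, -1}"
  shows "s *\<^sub>R vel k \<in> cbox (- 3, - 3) (3, 3)"
proof -
  have E: "0 \<le> F a1 (vel k)" using velocity_in_E[of k] by (simp add: E_def)
  define p q where "p = (fst (vel k) + snd (vel k)) / 2" and "q = (fst (vel k) - snd (vel k)) / 2"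
  have "p\<^sup>2 / a1\<^sup>2 + q\<^sup>2 / b1\<^sup>2 \<le> 1" using E by (simp add: F_half p_def q_def)
  moreover have "p\<^sup>2 \<le> p\<^sup>2 / a1\<^sup>2" "q\<^sup>2 \<le> q\<^sup>2 / b1\<^sup>2"
    using coeff_pos coeff_sq mult_left_mono[of "a1\<^sup>2" 1 "p\<^sup>2"] mult_left_mono[of "b1\<^sup>2" 1 "q\<^sup>2"]
    by (simp_all add: field_simps) (smt (verit) zero_le_power2)+
  ultimately have "p\<^sup>2 \<le> 1" "q\<^sup>2 \<le> 1" using zero_le_power2[of p] zero_le_power2[of q]
    by (smt (verit) zero_le_divide_iff zero_le_power2)+
  then have "\<bar>p\<bar> \<le> 1" "\<bar>q\<bar> \<le> 1" by (simp_all add: abs_square_le_1)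
  moreover have "vel k = (p + q, p - q)" by (simp add: p_def q_def prod_eq_iff field_simps)
  ultimately show ?thesis using assms by (auto simp: cbox_Pair_eq)
qed

lemma Q_nonneg: "s \<in> {1, -1} \<Longrightarrow> 0 \<le> Q s k u"
  using P_eq_Q(2)[of s k u] by (metis zero_le_power2)

lemma Q_sum: "Q 1 k u + Q (-1) k u = (norm u)\<^sup>2"
  by (simp add: Q_def field_simps)

text \<open>A uniform approximation on the test square costs at most e times the total mass, and by
  Parseval that mass is the same N for the walk and for the limit functional.\<close>

lemma finite_support_tendsto:
  assumes h: "continuous_on UNIV h" and supp: "supp_le n \<Psi>"
  shows "(\<lambda>t. expectation t h \<Psi>) \<longlonglongrightarrow> limit_functional h (trig (lbox n) \<Psi>)"
proof (rule LIMSEQ_I)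
  fix r :: real assume r: "r > 0"
  define u where "u = trig (lbox n) \<Psi>"
  have u: "continuous_on UNIV u" unfolding u_def by (rule continuous_trig)
  define N where "N = (\<Sum>x\<in>lbox n. (norm (\<Psi> x))\<^sup>2)"
  have N: "N \<ge> 0" unfolding N_def by (intro sum_nonneg) simp
  \<comment> \<open>The summand 1 covers the zero state, for which N = 0.\<close>
  define e where "e = r / (3 * (N + 1))"
  have e: "e > 0" "e * N < r / 3"
    using r N by (auto simp: e_def field_simps)
  obtain g where g: "g \<in> trigfun" "\<And>v. v \<in> cbox (- 3, - 3) (3, 3) \<Longrightarrow> \<bar>h v - g v\<bar> < e"
    using trigfun_approx[OF h e(1)] by blast
  have cg: "continuous_on UNIV g" using g(1) by (rule trigfun_continuous)
  have ex: "\<bar>expectation t h \<Psi> - expectation t g \<Psi>\<bar> \<le> e * N" if t: "t \<ge> n" "t > 0" for t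
  proof -
    have "\<bar>expectation t h \<Psi> - expectation t g \<Psi>\<bar> = \<bar>\<Sum>x\<in>lbox (n + 2 * t). (h (scaled t x) - g (scaled t x)) * (norm (evolve t \<Psi> x))\<^sup>2\<bar>"
      unfolding expectation_finite[OF supp] by (simp add: sum_subtractf left_diff_distrib)
    also have "\<dots> \<le> (\<Sum>x\<in>lbox (n + 2 * t). e * (norm (evolve t \<Psi> x))\<^sup>2)"
    proof (rule order_trans[OF sum_abs], rule sum_mono)
      fix x assume "x \<in> lbox (n + 2 * t)"
      \<comment> \<open>Once t \<ge> n, the support radius n + 2 t is at most 3 t; hence the square
        with half side 3.\<close>
      then have "\<bar>fst x\<bar> \<le> int (3 * t)" "\<bar>snd x\<bar> \<le> int (3 * t)" using t by (auto simp: mem_lbox)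
      then have "\<bar>real_of_int (fst x)\<bar> \<le> 3 * real t" "\<bar>real_of_int (snd x)\<bar> \<le> 3 * real t"
        by linarith+
      then have "scaled t x \<in> cbox (- 3, - 3) (3, 3)"
        using t by (auto simp: scaled_def cbox_Pair_eq abs_le_iff field_simps)
      then show "\<bar>(h (scaled t x) - g (scaled t x)) * (norm (evolve t \<Psi> x))\<^sup>2\<bar> \<le> e * (norm (evolve t \<Psi> x))\<^sup>2"
        unfolding abs_mult using less_imp_le[OF g(2)] by (simp add: mult_right_mono)
    qed
    also have "\<dots> = e * N"
      unfolding sum_distrib_left[symmetric] evolve_norm_sum[OF supp] N_def ..
    finally show ?thesis .
  qed
  have lf: "\<bar>limit_functional h u - limit_functional g u\<bar> \<le> e * N"
  proof -
    have i: "set_integrable lborel torus (\<lambda>k. h (s *\<^sub>R vel k) * Q s k (u k))" "set_integrable lborel torus (\<lambda>k. g (s *\<^sub>R vel k) * Q s k (u k))"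
       "set_integrable lborel torus (\<lambda>k. e * Q s k (u k))" for s
      using integrable_limit_functional[OF u h] integrable_limit_functional[OF u cg]
        integrable_limit_functional[OF u continuous_on_const[of UNIV e]] by blast+
    have b: "\<bar>(LINT k:torus|lborel. h (s *\<^sub>R vel k) * Q s k (u k)) - (LINT k:torus|lborel. g (s *\<^sub>R vel k) * Q s k (u k))\<bar>
       \<le> (LINT k:torus|lborel. e * Q s k (u k))" if s: "s \<in> {1, -1}" for s
    proof -
      have "(LINT k:torus|lborel. h (s *\<^sub>R vel k) * Q s k (u k)) - (LINT k:torus|lborel. g (s *\<^sub>R vel k) * Q s k (u k))
        = (LINT k:torus|lborel. h (s *\<^sub>R vel k) * Q s k (u k) - g (s *\<^sub>R vel k) * Q s k (u k))"
        using set_integral_diff(2)[OF i(1)[of s] i(2)[of s]] by simp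
      also have "\<bar>\<dots>\<bar> \<le> (LINT k:torus|lborel. e * Q s k (u k))"
        unfolding set_lebesgue_integral_def
      proof (rule integral_abs_bound_integral)
        show "integrable lborel (\<lambda>k. indicator torus k *\<^sub>R (h (s *\<^sub>R vel k) * Q s k (u k) - g (s *\<^sub>R vel k) * Q s k (u k)))"
          using set_integral_diff(1)[OF i(1)[of s] i(2)[of s]] by (simp add: set_integrable_def)
        show "integrable lborel (\<lambda>k. indicator torus k *\<^sub>R (e * Q s k (u k)))" using i(3)[of s] by (simp add: set_integrable_def)
        fix k
        have "\<bar>h (s *\<^sub>R vel k) * Q s k (u k) - g (s *\<^sub>R vel k) * Q s k (u k)\<bar> = \<bar>h (s *\<^sub>R vel k) - g (s *\<^sub>R vel k)\<bar> * Q s k (u k)"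
          using Q_nonneg[OF s] by (simp add: left_diff_distrib[symmetric] abs_mult)
        also have "\<dots> \<le> e * Q s k (u k)"
          by (rule mult_right_mono[OF less_imp_le[OF g(2)[OF vel_bounded[OF s]]] Q_nonneg[OF s]])
        finally show "\<bar>indicator torus k *\<^sub>R (h (s *\<^sub>R vel k) * Q s k (u k) - g (s *\<^sub>R vel k) * Q s k (u k))\<bar>
          \<le> indicator torus k *\<^sub>R (e * Q s k (u k))"
          by (simp add: indicator_def)
      qed
      finally show ?thesis .
    qed
    have "\<bar>limit_functional h u - limit_functional g u\<bar> \<le> 1 / (4 * pi\<^sup>2) * ((LINT k:torus|lborel. e * Q 1 k (u k)) + (LINT k:torus|lborel. e * Q (-1) k (u k)))"
      using b[of 1] b[of "-1"]
      by (simp add: limit_functional_def diff_divide_distrib[symmetric] divide_right_mono abs_mult)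
    also have "(LINT k:torus|lborel. e * Q 1 k (u k)) + (LINT k:torus|lborel. e * Q (-1) k (u k)) = (LINT k:torus|lborel. e * (norm (u k))\<^sup>2)"
      unfolding set_integral_add(2)[OF i(3)[of 1] i(3)[of "-1"], symmetric] distrib_left[symmetric] Q_sum ..
    also have "\<dots> = e * (4 * pi\<^sup>2 * N)"
      using norm_trig_integral[of "lbox n" \<Psi>] by (simp add: u_def N_def)
    finally show ?thesis by simp
  qed
  obtain t0 where t0: "\<And>t. t \<ge> t0 \<Longrightarrow> \<bar>expectation t g \<Psi> - limit_functional g u\<bar> < r / 3"
    using LIMSEQ_D[OF trigfun_tendsto[OF g(1) supp], of "r / 3"] r by (auto simp: u_def)
  show "\<exists>no. \<forall>t\<ge>no. norm (expectation t h \<Psi> - limit_functional h (trig (lbox n) \<Psi>)) < r"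
  proof (intro exI[of _ "max t0 (Suc n)"] allI impI)
    fix t assume "t \<ge> max t0 (Suc n)"
    then have "\<bar>expectation t h \<Psi> - expectation t g \<Psi>\<bar> \<le> e * N" "\<bar>expectation t g \<Psi> - limit_functional g u\<bar> < r / 3"
      using ex t0 by auto
    then show "norm (expectation t h \<Psi> - limit_functional h (trig (lbox n) \<Psi>)) < r"
      using lf e(2) unfolding u_def[symmetric] real_norm_def by linarith
  qed
qed

end

section \<open>Fourier transform of square summable states\<close>

lemma normalized_integral:
  assumes "normalized \<Psi>"
  shows "integrable (count_space UNIV) (\<lambda>x. (norm (\<Psi> x))\<^sup>2)"
    and "(LINT x|count_space UNIV. (norm (\<Psi> x))\<^sup>2) = 1"
proof -
  have hs: "((\<lambda>x. (norm (\<Psi> x))\<^sup>2) has_sum 1) UNIV" using assms by (simp add: normalized_def)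
  then have "(\<lambda>x. (norm (\<Psi> x))\<^sup>2) summable_on UNIV" by (rule has_sum_imp_summable)
  then have s: "Infinite_Set_Sum.abs_summable_on (\<lambda>x. (norm (\<Psi> x))\<^sup>2) UNIV"
    by (simp only: abs_summable_equivalent[symmetric] summable_on_iff_abs_summable_on_real[symmetric])
  then show "integrable (count_space UNIV) (\<lambda>x. (norm (\<Psi> x))\<^sup>2)"
    by (simp add: Infinite_Set_Sum.abs_summable_on_def)
  have "(LINT x|count_space UNIV. (norm (\<Psi> x))\<^sup>2) = infsum (\<lambda>x. (norm (\<Psi> x))\<^sup>2) UNIV"
    using infsetsum_infsum[OF s] by (simp add: infsetsum_def)
  then show "(LINT x|count_space UNIV. (norm (\<Psi> x))\<^sup>2) = 1" using hs by (simp add: infsumI)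
qed

text \<open>The weighted terms are bounded, so d decays at least like the geometric sequence with
  ratio 1 / sqrt 2.\<close>

lemma summable_of_weighted_squares:
  fixes d :: "nat \<Rightarrow> real"
  assumes "(\<Sum>j. ennreal (2 ^ j * (d j)\<^sup>2)) \<noteq> \<infinity>" "\<And>j. 0 \<le> d j"
  shows "summable d"
proof -
  have "summable (\<lambda>j. 2 ^ j * (d j)\<^sup>2)"
    using assms(1) by (intro summable_suminf_not_top) (auto simp: top_ennreal_def infinity_ennreal_def)
  then have "(\<lambda>j. 2 ^ j * (d j)\<^sup>2) \<longlonglongrightarrow> 0" by (rule summable_LIMSEQ_zero)
  then have "Bseq (\<lambda>j. 2 ^ j * (d j)\<^sup>2)" by (intro convergent_imp_Bseq convergentI)
  then obtain C where C: "C > 0" "\<And>j. \<bar>2 ^ j * (d j)\<^sup>2\<bar> \<le> C" by (auto simp: Bseq_def)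
  have "d j \<le> sqrt C * (1 / sqrt 2) ^ j" for j
  proof -
    have "2 ^ j * (d j)\<^sup>2 \<le> C" using C(2)[of j] by simp
    then have "(d j)\<^sup>2 \<le> C * (1 / 2) ^ j" by (simp add: field_simps power_one_over)
    then have "sqrt ((d j)\<^sup>2) \<le> sqrt (C * (1 / 2) ^ j)" by (rule real_sqrt_le_mono)
    then show ?thesis using assms(2)[of j] by (simp add: real_sqrt_mult real_sqrt_power real_sqrt_divide)
  qed
  then have "norm (d j) \<le> sqrt C * (1 / sqrt 2) ^ j" for j using assms(2)[of j] by simp
  moreover have "summable (\<lambda>j. sqrt C * (1 / sqrt 2) ^ j)" by (intro summable_mult summable_geometric) simp
  ultimately show ?thesis using summable_comparison_test'[of _ 0 d] by blast
qed

lemma nn_integral_trig: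
  assumes "finite A"
  shows "(\<integral>\<^sup>+k\<in>torus. ennreal ((norm (trig A \<Psi> k))\<^sup>2) \<partial>lborel) = ennreal (4 * pi\<^sup>2 * (\<Sum>x\<in>A. (norm (\<Psi> x))\<^sup>2))"
proof -
  have "set_integrable lborel torus (\<lambda>k. (norm (trig A \<Psi> k))\<^sup>2)"
    by (intro continuous_integrable_torus continuous_intros continuous_trig)
  then have "(\<integral>\<^sup>+k. ennreal (indicator torus k * (norm (trig A \<Psi> k))\<^sup>2) \<partial>lborel) = ennreal (LINT k:torus|lborel. (norm (trig A \<Psi> k))\<^sup>2)"
    unfolding set_lebesgue_integral_def set_integrable_def
    by (subst nn_integral_eq_integral) (auto simp: indicator_def)
  moreover have "ennreal (indicator torus k * (norm (trig A \<Psi> k))\<^sup>2) = ennreal ((norm (trig A \<Psi> k))\<^sup>2) * indicator torus k" for k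
    by (simp add: indicator_def)
  ultimately show ?thesis by (simp add: norm_trig_integral[OF assms])
qed

lemma trig_diff:
  assumes "finite A" "B \<subseteq> A"
  shows "trig A \<Psi> k - trig B \<Psi> k = trig (A - B) \<Psi> k"
  unfolding trig_def using assms by (simp add: sum_diff)

lemma measurable_trig [measurable]: "trig A \<Psi> \<in> borel_measurable borel"
  by (intro borel_measurable_continuous_onI continuous_trig)

lemma finite_subset_lbox:
  assumes "finite A"
  shows "\<exists>n. A \<subseteq> lbox n"
proof -
  define M where "M = Max (insert 0 ((\<lambda>x. nat (max \<bar>fst x\<bar> \<bar>snd x\<bar>)) ` A))"
  have M: "nat (max \<bar>fst x\<bar> \<bar>snd x\<bar>) \<le> M" if "x \<in> A" for x
    unfolding M_def using assms that by (intro Max_ge) auto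
  have "A \<subseteq> lbox M"
  proof
    fix x assume "x \<in> A"
    from M[OF this] show "x \<in> lbox M" by (auto simp: mem_lbox)
  qed
  then show ?thesis by blast
qed

lemma lbox_mono: "m \<le> n \<Longrightarrow> lbox m \<subseteq> lbox n"
  by (auto simp: mem_lbox)

lemma filterlim_lbox: "filterlim lbox (finite_subsets_at_top UNIV) sequentially"
  unfolding filterlim_finite_subsets_at_top
proof (intro allI impI)
  fix X :: "(int \<times> int) set" assume "finite X \<and> X \<subseteq> UNIV"
  then obtain n where n: "X \<subseteq> lbox n" using finite_subset_lbox by blast
  show "\<forall>\<^sub>F y in sequentially. finite (lbox y) \<and> X \<subseteq> lbox y \<and> lbox y \<subseteq> UNIV"
    using eventually_ge_at_top[of n]
  proof eventually_elim
    case (elim y)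
    then show ?case using n lbox_mono[OF elim] by auto
  qed
qed

lemma mass_sums:
  assumes "normalized \<Psi>"
  shows "((\<lambda>A. \<Sum>x\<in>A. (norm (\<Psi> x))\<^sup>2) \<longlongrightarrow> 1) (finite_subsets_at_top UNIV)"
    and "finite A \<Longrightarrow> (\<Sum>x\<in>A. (norm (\<Psi> x))\<^sup>2) \<le> 1"
proof -
  have hs: "((\<lambda>x. (norm (\<Psi> x))\<^sup>2) has_sum 1) UNIV" using assms by (simp add: normalized_def)
  then show "((\<lambda>A. \<Sum>x\<in>A. (norm (\<Psi> x))\<^sup>2) \<longlongrightarrow> 1) (finite_subsets_at_top UNIV)"
    by (simp add: has_sum_def)
  show "finite A \<Longrightarrow> (\<Sum>x\<in>A. (norm (\<Psi> x))\<^sup>2) \<le> 1"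
    using finite_sum_le_has_sum[OF hs, of A] by auto
qed

text \<open>The rate (1 / 4)^j is chosen so that the increments remain summable in mean square after
  multiplication by 2^j.\<close>

lemma rapid_boxes:
  assumes "normalized \<Psi>"
  obtains N :: "nat \<Rightarrow> nat" where "strict_mono N"
    "\<And>j. 1 - (1 / 4) ^ j < (\<Sum>x\<in>lbox (N j). (norm (\<Psi> x))\<^sup>2)"
proof -
  have lim: "(\<lambda>n. \<Sum>x\<in>lbox n. (norm (\<Psi> x))\<^sup>2) \<longlonglongrightarrow> 1"
    using filterlim_compose[OF mass_sums(1)[OF assms] filterlim_lbox] .
  have ex: "\<exists>n>m. 1 - (1 / 4) ^ j < (\<Sum>x\<in>lbox n. (norm (\<Psi> x))\<^sup>2)" for m j :: nat
  proof -
    have "\<forall>\<^sub>F n in sequentially. 1 - (1 / 4) ^ j < (\<Sum>x\<in>lbox n. (norm (\<Psi> x))\<^sup>2)"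
      by (rule order_tendstoD(1)[OF lim]) simp
    from eventually_conj[OF this eventually_gt_at_top[of m]] show ?thesis
      by (auto dest!: eventually_happens)
  qed
  have "\<exists>N. \<forall>j. 1 - (1 / 4) ^ j < (\<Sum>x\<in>lbox (N j). (norm (\<Psi> x))\<^sup>2) \<and> N j < N (Suc j)"
    by (rule dependent_nat_choice[where P = "\<lambda>j n. 1 - (1 / 4) ^ j < (\<Sum>x\<in>lbox n. (norm (\<Psi> x))\<^sup>2)"
          and Q = "\<lambda>_ m n. m < n"]) (use ex in blast)+
  then show thesis using that by (auto simp: strict_mono_Suc_iff)
qed

text \<open>Riesz--Fischer: along sufficiently sparse boxes the partial sums converge almost everywhere,
  and Fatou's lemma identifies the limit as the limit in mean square over all finite sets.\<close>

lemma fourier_transform_exists: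
  assumes "normalized \<Psi>"
  shows "\<exists>g. is_fourier_transform \<Psi> g"
proof -
  define T where "T A = (\<Sum>x\<in>A. (norm (\<Psi> x))\<^sup>2)" for A
  obtain N where N: "strict_mono N" "\<And>j. 1 - (1 / 4) ^ j < T (lbox (N j))"
    using rapid_boxes[OF assms] unfolding T_def by blast
  have T1: "T A \<le> 1" if "finite A" for A unfolding T_def using mass_sums(2)[OF assms that] .
  have Tdiff: "(\<Sum>x\<in>A - B. (norm (\<Psi> x))\<^sup>2) = T A - T B" if "finite A" "B \<subseteq> A" for A B
    unfolding T_def using that by (simp add: sum_diff)
  define S where "S j = trig (lbox (N j)) \<Psi>" for j
  have [measurable]: "S j \<in> borel_measurable borel" for j unfolding S_def by measurable
  \<comment> \<open>As a pointwise \<open>lim\<close> of periodic continuous functions, g is Borel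
    and exactly periodic everywhere, including where the sequence diverges.\<close>
  define g where "g k = lim (\<lambda>j. S j k)" for k
  have g [measurable]: "g \<in> borel_measurable borel" unfolding g_def by measurable
  define d where "d j k = norm (S (Suc j) k - S j k)" for j k
  have [measurable]: "d j \<in> borel_measurable borel" for j unfolding d_def by measurable
  have sub: "lbox (N j) \<subseteq> lbox (N (Suc j))" for j
    using N(1) by (intro lbox_mono) (simp add: strict_mono_Suc_iff less_imp_le)
  have dint: "(\<integral>\<^sup>+k\<in>torus. ennreal ((d j k)\<^sup>2) \<partial>lborel) \<le> ennreal (4 * pi\<^sup>2 * (1 / 4) ^ j)" for j
  proof -
    have "(\<integral>\<^sup>+k\<in>torus. ennreal ((d j k)\<^sup>2) \<partial>lborel) = ennreal (4 * pi\<^sup>2 * (T (lbox (N (Suc j))) - T (lbox (N j))))"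
      unfolding d_def S_def by (simp add: trig_diff sub nn_integral_trig Tdiff)
    also have "\<dots> \<le> ennreal (4 * pi\<^sup>2 * (1 / 4) ^ j)"
      using N(2)[of j] T1[of "lbox (N (Suc j))"] by (intro ennreal_leI mult_left_mono) auto
    finally show ?thesis .
  qed
  have "(\<integral>\<^sup>+k. (\<Sum>j. ennreal (2 ^ j * (d j k)\<^sup>2) * indicator torus k) \<partial>lborel)
      = (\<Sum>j. \<integral>\<^sup>+k. ennreal (2 ^ j * (d j k)\<^sup>2) * indicator torus k \<partial>lborel)"
    by (intro nn_integral_suminf) measurable
  \<comment> \<open>The weight 2^j against increments of size (1 / 4)^j leaves a convergent
    geometric series, so the weighted sum is finite at almost every k.\<close>
  also have "\<dots> \<le> (\<Sum>j. ennreal (4 * pi\<^sup>2 * (1 / 2) ^ j))"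
  proof (intro suminf_le allI)
    fix j
    have "(\<integral>\<^sup>+k. ennreal (2 ^ j * (d j k)\<^sup>2) * indicator torus k \<partial>lborel) = ennreal (2 ^ j) * (\<integral>\<^sup>+k\<in>torus. ennreal ((d j k)\<^sup>2) \<partial>lborel)"
      by (subst nn_integral_cmult[symmetric]) (auto simp: ennreal_mult mult.assoc)
    also have "\<dots> \<le> ennreal (2 ^ j) * ennreal (4 * pi\<^sup>2 * (1 / 4) ^ j)"
      using dint by (intro mult_left_mono) auto
    also have "\<dots> = ennreal (4 * pi\<^sup>2 * (1 / 2) ^ j)"
    proof -
      have "(2::real) ^ j * (1 / 4) ^ j = (1 / 2) ^ j" by (simp add: power_mult_distrib[symmetric])
      then have "(2::real) ^ j * (4 * pi\<^sup>2 * (1 / 4) ^ j) = 4 * pi\<^sup>2 * (1 / 2) ^ j" by (simp add: mult_ac)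
      moreover have "ennreal (2 ^ j) * ennreal (4 * pi\<^sup>2 * (1 / 4) ^ j) = ennreal (2 ^ j * (4 * pi\<^sup>2 * (1 / 4) ^ j))"
        by (rule ennreal_mult[symmetric]) auto
      ultimately show ?thesis by (simp only:)
    qed
    finally show "(\<integral>\<^sup>+k. ennreal (2 ^ j * (d j k)\<^sup>2) * indicator torus k \<partial>lborel) \<le> ennreal (4 * pi\<^sup>2 * (1 / 2) ^ j)" .
  qed auto
  also have "\<dots> < \<infinity>"
  proof -
    have "summable (\<lambda>j. 4 * pi\<^sup>2 * (1 / 2 :: real) ^ j)" by (intro summable_mult summable_geometric) simp
    then have "(\<Sum>j. ennreal (4 * pi\<^sup>2 * (1 / 2) ^ j)) = ennreal (\<Sum>j. 4 * pi\<^sup>2 * (1 / 2) ^ j)"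
      by (intro suminf_ennreal2) auto
    then show ?thesis by simp
  qed
  finally have "AE k in lborel. (\<Sum>j. ennreal (2 ^ j * (d j k)\<^sup>2) * indicator torus k) \<noteq> \<infinity>"
    by (intro nn_integral_noteq_infinite) auto
  then have conv: "AE k in lborel. k \<in> torus \<longrightarrow> (\<lambda>j. S j k) \<longlonglongrightarrow> g k"
  proof eventually_elim
    case (elim k)
    show ?case
    proof
      assume "k \<in> torus"
      then have "summable (\<lambda>j. d j k)"
        using elim by (intro summable_of_weighted_squares) (simp_all add: d_def)
      then have "summable (\<lambda>j. S (Suc j) k - S j k)" unfolding d_def by (rule summable_norm_cancel)
      then have "convergent (\<lambda>n. \<Sum>j<n. S (Suc j) k - S j k)" by (simp only: summable_iff_convergent)
      then have "convergent (\<lambda>n. (\<Sum>j<n. S (Suc j) k - S j k) + S 0 k)" by (intro convergent_add convergent_const)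
      then have "convergent (\<lambda>j. S j k)" by (simp add: sum_lessThan_telescope[of "\<lambda>j. S j k"])
      then show "(\<lambda>j. S j k) \<longlonglongrightarrow> g k" unfolding g_def by (rule convergent_LIMSEQ_iff[THEN iffD1])
    qed
  qed
  have bound: "(\<integral>\<^sup>+k\<in>torus. ennreal ((norm (g k - trig A \<Psi> k))\<^sup>2) \<partial>lborel) \<le> ennreal (4 * pi\<^sup>2 * (1 - T A))" if A: "finite A" for A
  proof -
    obtain n where n: "A \<subseteq> lbox n" using finite_subset_lbox[OF A] by blast
    have "(\<integral>\<^sup>+k\<in>torus. ennreal ((norm (g k - trig A \<Psi> k))\<^sup>2) \<partial>lborel)
      = (\<integral>\<^sup>+k. liminf (\<lambda>j. ennreal ((norm (S j k - trig A \<Psi> k))\<^sup>2) * indicator torus k) \<partial>lborel)"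
    proof (rule nn_integral_cong_AE)
      show "AE k in lborel. ennreal ((norm (g k - trig A \<Psi> k))\<^sup>2) * indicator torus k
        = liminf (\<lambda>j. ennreal ((norm (S j k - trig A \<Psi> k))\<^sup>2) * indicator torus k)"
        using conv
      proof eventually_elim
        case (elim k)
        have "(\<lambda>j. ennreal ((norm (S j k - trig A \<Psi> k))\<^sup>2) * indicator torus k) \<longlonglongrightarrow>
            ennreal ((norm (g k - trig A \<Psi> k))\<^sup>2) * indicator torus k"
        proof (cases "k \<in> torus")
          case True
          then have "(\<lambda>j. (norm (S j k - trig A \<Psi> k))\<^sup>2) \<longlonglongrightarrow> (norm (g k - trig A \<Psi> k))\<^sup>2"
            using elim by (intro tendsto_intros) auto
          then show ?thesis using True by (simp add: tendsto_ennrealI)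
        qed simp
        from lim_imp_Liminf[OF _ this] show ?case by simp
      qed
    qed
    also have "\<dots> \<le> liminf (\<lambda>j. \<integral>\<^sup>+k. ennreal ((norm (S j k - trig A \<Psi> k))\<^sup>2) * indicator torus k \<partial>lborel)"
      by (intro nn_integral_liminf) measurable
    also have "\<dots> \<le> liminf (\<lambda>j. ennreal (4 * pi\<^sup>2 * (1 - T A)))"
    proof (rule Liminf_mono)
      show "\<forall>\<^sub>F j in sequentially. (\<integral>\<^sup>+k. ennreal ((norm (S j k - trig A \<Psi> k))\<^sup>2) * indicator torus k \<partial>lborel) \<le> ennreal (4 * pi\<^sup>2 * (1 - T A))"
        using eventually_ge_at_top[of n]
      proof eventually_elim
        case (elim j)
        then have "A \<subseteq> lbox (N j)"
          using n lbox_mono[of n "N j"] strict_mono_imp_increasing[OF N(1), of j] by auto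
        then have "(\<integral>\<^sup>+k. ennreal ((norm (S j k - trig A \<Psi> k))\<^sup>2) * indicator torus k \<partial>lborel) = ennreal (4 * pi\<^sup>2 * (T (lbox (N j)) - T A))"
          unfolding S_def using A by (simp add: trig_diff nn_integral_trig Tdiff)
        also have "\<dots> \<le> ennreal (4 * pi\<^sup>2 * (1 - T A))"
          using T1[of "lbox (N j)"] by (intro ennreal_leI mult_left_mono) auto
        finally show ?case .
      qed
    qed
    also have "\<dots> = ennreal (4 * pi\<^sup>2 * (1 - T A))" by (simp add: Liminf_const)
    finally show ?thesis .
  qed
  have "((\<lambda>A. ennreal (4 * pi\<^sup>2 * (1 - T A))) \<longlongrightarrow> ennreal (4 * pi\<^sup>2 * (1 - 1))) (finite_subsets_at_top UNIV)"
    using mass_sums(1)[OF assms] unfolding T_def by (intro tendsto_ennrealI tendsto_intros)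
  then have "((\<lambda>A. ennreal (4 * pi\<^sup>2 * (1 - T A))) \<longlongrightarrow> 0) (finite_subsets_at_top UNIV)" by simp
  then have "((\<lambda>A. \<integral>\<^sup>+k\<in>torus. ennreal ((norm (g k - trig A \<Psi> k))\<^sup>2) \<partial>lborel) \<longlongrightarrow> 0) (finite_subsets_at_top UNIV)"
    by (rule tendsto_sandwich[OF _ _ tendsto_const, rotated 2])
       (use bound in \<open>auto intro!: eventually_finite_subsets_at_top_weakI\<close>)
  moreover have "g (k1 + 2 * pi, k2) = g (k1, k2) \<and> g (k1, k2 + 2 * pi) = g (k1, k2)" for k1 k2
    using trig_periodic[of _ \<Psi> "(k1, k2)"] by (simp add: g_def S_def)
  ultimately have "is_fourier_transform \<Psi> g"
    unfolding is_fourier_transform_def torus_def trig_def using g by auto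
  then show ?thesis by blast
qed

section \<open>General initial states\<close>

text \<open>Absorbs the cross term when a mean square is perturbed, which replaces the Cauchy--Schwarz
  inequality for integrals.\<close>

lemma square_diff_le:
  fixes x y d \<eta> :: real
  assumes "0 \<le> x" "0 \<le> y" "\<bar>x - y\<bar> \<le> d" "0 < \<eta>"
  shows "\<bar>x\<^sup>2 - y\<^sup>2\<bar> \<le> \<eta> * x\<^sup>2 + (1 + 1 / \<eta>) * d\<^sup>2"
proof -
  have "0 \<le> (sqrt \<eta> * x - d / sqrt \<eta>)\<^sup>2" by simp
  then have amgm: "2 * x * d \<le> \<eta> * x\<^sup>2 + d\<^sup>2 / \<eta>"
    using assms(4) by (simp add: power2_diff power_mult_distrib power_divide)
  have "\<bar>x\<^sup>2 - y\<^sup>2\<bar> = \<bar>x - y\<bar> * (x + y)"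
    using assms(1,2) by (simp add: power2_eq_square square_diff_square_factored abs_mult mult.commute)
  also have "\<dots> \<le> d * (2 * x + d)"
    using assms by (intro mult_mono) auto
  also have "\<dots> = 2 * x * d + d\<^sup>2" by (simp add: algebra_simps power2_eq_square)
  also have "\<dots> \<le> \<eta> * x\<^sup>2 + (1 + 1 / \<eta>) * d\<^sup>2"
    using amgm by (simp add: algebra_simps)
  finally show ?thesis .
qed

lemma norm_square_diff_le:
  fixes u v :: "'a :: real_normed_vector"
  assumes "0 < \<eta>"
  shows "\<bar>(norm u)\<^sup>2 - (norm v)\<^sup>2\<bar> \<le> \<eta> * (norm u)\<^sup>2 + (1 + 1 / \<eta>) * (norm (u - v))\<^sup>2"
  by (intro square_diff_le norm_ge_zero norm_triangle_ineq3 assms)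

lemma shift_diff: "shift e (\<lambda>x. \<Psi> x - \<Phi> x) = (\<lambda>x. shift e \<Psi> x - shift e \<Phi> x)"
  by (intro ext vector_2_eqI) (simp_all add: shift_nth)

lemma coin_op_diff: "coin_op \<alpha> (\<lambda>x. \<Psi> x - \<Phi> x) = (\<lambda>x. coin_op \<alpha> \<Psi> x - coin_op \<alpha> \<Phi> x)"
  by (simp add: coin_op_def matrix_vector_mult_diff_distrib)

lemma nn_integral_shift:
  "(\<integral>\<^sup>+x. ennreal ((norm (shift e \<Psi> x))\<^sup>2) \<partial>count_space UNIV) = (\<integral>\<^sup>+x. ennreal ((norm (\<Psi> x))\<^sup>2) \<partial>count_space UNIV)"
proof -
  have tr: "(\<integral>\<^sup>+x. G (x + d) \<partial>count_space UNIV) = (\<integral>\<^sup>+x. G x \<partial>count_space UNIV)" for G :: "int \<times> int \<Rightarrow> ennreal" and d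
    by (rule nn_integral_bij_count_space) (auto intro!: bij_betwI[of _ _ _ "\<lambda>x. x - d"])
  have "(\<integral>\<^sup>+x. ennreal ((norm (shift e \<Psi> x))\<^sup>2) \<partial>count_space UNIV)
    = (\<integral>\<^sup>+x. ennreal ((cmod (\<Psi> (x + e) $ 1))\<^sup>2) + ennreal ((cmod (\<Psi> (x + (- e)) $ 2))\<^sup>2) \<partial>count_space UNIV)"
    by (simp add: norm_sq_2 shift_nth)
  also have "\<dots> = (\<integral>\<^sup>+x. ennreal ((cmod (\<Psi> x $ 1))\<^sup>2) \<partial>count_space UNIV) + (\<integral>\<^sup>+x. ennreal ((cmod (\<Psi> x $ 2))\<^sup>2) \<partial>count_space UNIV)"
    by (subst nn_integral_add) (simp_all only: tr[of "\<lambda>x. ennreal ((cmod (\<Psi> x $ 1))\<^sup>2)"] tr[of "\<lambda>x. ennreal ((cmod (\<Psi> x $ 2))\<^sup>2)"] measurable_count_space_eq1 simp_thms space_borel UNIV_I Pi_UNIV)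
  also have "\<dots> = (\<integral>\<^sup>+x. ennreal ((norm (\<Psi> x))\<^sup>2) \<partial>count_space UNIV)"
    by (subst nn_integral_add[symmetric]) (simp_all add: norm_sq_2)
  finally show ?thesis .
qed

lemma norm_coin:
  assumes "0 \<le> \<alpha>" "\<alpha> \<le> 1"
  shows "norm (coin \<alpha> *v u) = norm u"
proof -
  have c: "\<alpha>\<^sup>2 + (compl_coeff \<alpha>)\<^sup>2 = 1"
    using assms by (simp add: compl_coeff_def power_le_one)
  have "complex_of_real \<alpha> * of_real \<alpha> + of_real (compl_coeff \<alpha>) * of_real (compl_coeff \<alpha>) = of_real (\<alpha>\<^sup>2 + (compl_coeff \<alpha>)\<^sup>2)"
    by (simp add: power2_eq_square)
  then have c': "complex_of_real \<alpha> * of_real \<alpha> + of_real (compl_coeff \<alpha>) * of_real (compl_coeff \<alpha>) = 1"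
    by (simp only: c of_real_1)
  have "cip (coin \<alpha> *v u) (coin \<alpha> *v u) = (complex_of_real \<alpha> * of_real \<alpha> + of_real (compl_coeff \<alpha>) * of_real (compl_coeff \<alpha>)) * cip u u"
    by (simp add: cip_def coin_def matrix_vector_mult_def sum_2 algebra_simps)
  then have "complex_of_real ((norm (coin \<alpha> *v u))\<^sup>2) = of_real ((norm u)\<^sup>2)"
    by (simp only: c' cip_self mult_1_left)
  then show ?thesis by (simp del: of_real_power)
qed

section \<open>Mass conservation and perturbation estimates\<close>

context walk_params begin

lemma evolve_diff: "evolve t (\<lambda>x. \<Psi> x - \<Phi> x) = (\<lambda>x. evolve t \<Psi> x - evolve t \<Phi> x)"
  by (induction t) (simp_all add: walk_def shift_diff coin_op_diff)

text \<open>In extended nonnegative form, conservation of mass also transfers integrability to later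
  times.\<close>

lemma nn_integral_evolve:
  "(\<integral>\<^sup>+x. ennreal ((norm (evolve t \<Psi> x))\<^sup>2) \<partial>count_space UNIV) = (\<integral>\<^sup>+x. ennreal ((norm (\<Psi> x))\<^sup>2) \<partial>count_space UNIV)"
proof (induction t)
  case (Suc t)
  have c: "(norm (coin_op \<alpha> \<Phi> x))\<^sup>2 = (norm (\<Phi> x))\<^sup>2" if "0 \<le> \<alpha>" "\<alpha> \<le> 1" for \<alpha> \<Phi> x
    using norm_coin[OF that] by (simp add: coin_op_def)
  have "(\<integral>\<^sup>+x. ennreal ((norm (evolve (Suc t) \<Psi> x))\<^sup>2) \<partial>count_space UNIV) = (\<integral>\<^sup>+x. ennreal ((norm (evolve t \<Psi> x))\<^sup>2) \<partial>count_space UNIV)"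
    by (simp add: walk_def nn_integral_shift c a1 a2)
  then show ?case using Suc by simp
qed simp

lemma evolve_integral:
  assumes "integrable (count_space UNIV) (\<lambda>x. (norm (\<Psi> x))\<^sup>2)"
  shows "integrable (count_space UNIV) (\<lambda>x. (norm (evolve t \<Psi> x))\<^sup>2)"
    and "(LINT x|count_space UNIV. (norm (evolve t \<Psi> x))\<^sup>2) = (LINT x|count_space UNIV. (norm (\<Psi> x))\<^sup>2)"
proof -
  show i: "integrable (count_space UNIV) (\<lambda>x. (norm (evolve t \<Psi> x))\<^sup>2)"
    using assms nn_integral_evolve[of t \<Psi>] by (simp add: integrable_iff_bounded)
  show "(LINT x|count_space UNIV. (norm (evolve t \<Psi> x))\<^sup>2) = (LINT x|count_space UNIV. (norm (\<Psi> x))\<^sup>2)"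
    using nn_integral_evolve[of t \<Psi>] by (simp add: integral_eq_nn_integral)
qed

lemma scaled_law_integral:
  assumes [measurable]: "h \<in> borel_measurable borel"
  shows "(LINT v|scaled_position_law a1 a2 \<Psi> t. h v) = expectation t h \<Psi>"
  unfolding scaled_position_law_def position_law_def expectation_def
  by (subst integral_distr) (auto simp: integral_density scaled_def mult.commute)

text \<open>The bound is independent of t because the walk is linear and conserves the mass of both
  the state and the difference. This uniformity permits truncating before t tends to
  infinity.\<close>

lemma expectation_perturb:
  assumes i: "integrable (count_space UNIV) (\<lambda>x. (norm (\<Psi> x))\<^sup>2)" "integrable (count_space UNIV) (\<lambda>x. (norm (\<Phi> x))\<^sup>2)"
      "integrable (count_space UNIV) (\<lambda>x. (norm (\<Psi> x - \<Phi> x))\<^sup>2)"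
    and h: "\<And>v. \<bar>h v\<bar> \<le> C" and \<eta>: "0 < \<eta>"
  shows "\<bar>expectation t h \<Psi> - expectation t h \<Phi>\<bar> \<le> C * (\<eta> * (LINT x|count_space UNIV. (norm (\<Psi> x))\<^sup>2)
    + (1 + 1 / \<eta>) * (LINT x|count_space UNIV. (norm (\<Psi> x - \<Phi> x))\<^sup>2))"
proof -
  have C: "0 \<le> C" using h[of 0] by simp
  have bi: "integrable (count_space UNIV) (\<lambda>x. h (scaled t x) * (norm (evolve t \<Theta> x))\<^sup>2)"
    if "integrable (count_space UNIV) (\<lambda>x. (norm (\<Theta> x))\<^sup>2)" for \<Theta>
  proof (rule Bochner_Integration.integrable_bound)
    show "integrable (count_space UNIV) (\<lambda>x. C * (norm (evolve t \<Theta> x))\<^sup>2)"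
      using evolve_integral(1)[OF that] by simp
    show "AE x in count_space UNIV. norm (h (scaled t x) * (norm (evolve t \<Theta> x))\<^sup>2) \<le> norm (C * (norm (evolve t \<Theta> x))\<^sup>2)"
    proof (rule AE_I2)
      fix x
      have "\<bar>h (scaled t x)\<bar> * (norm (evolve t \<Theta> x))\<^sup>2 \<le> C * (norm (evolve t \<Theta> x))\<^sup>2"
        by (rule mult_right_mono[OF h]) simp
      then show "norm (h (scaled t x) * (norm (evolve t \<Theta> x))\<^sup>2) \<le> norm (C * (norm (evolve t \<Theta> x))\<^sup>2)"
        using C by (simp add: abs_mult)
    qed
  qed simp
  define D where "D = (\<lambda>x. \<Psi> x - \<Phi> x)"
  have iD: "integrable (count_space UNIV) (\<lambda>x. (norm (D x))\<^sup>2)" using i(3) by (simp add: D_def)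
  have eD: "evolve t D x = evolve t \<Psi> x - evolve t \<Phi> x" for x unfolding D_def evolve_diff ..
  have "\<bar>expectation t h \<Psi> - expectation t h \<Phi>\<bar>
      = \<bar>LINT x|count_space UNIV. h (scaled t x) * (norm (evolve t \<Psi> x))\<^sup>2 - h (scaled t x) * (norm (evolve t \<Phi> x))\<^sup>2\<bar>"
    unfolding expectation_def using bi[OF i(1)] bi[OF i(2)] by simp
  also have "\<dots> \<le> (LINT x|count_space UNIV. C * (\<eta> * (norm (evolve t \<Psi> x))\<^sup>2 + (1 + 1 / \<eta>) * (norm (evolve t D x))\<^sup>2))"
  proof (rule order_trans[OF integral_abs_bound integral_mono])
    fix x
    have "\<bar>h (scaled t x) * (norm (evolve t \<Psi> x))\<^sup>2 - h (scaled t x) * (norm (evolve t \<Phi> x))\<^sup>2\<bar>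
      = \<bar>h (scaled t x)\<bar> * \<bar>(norm (evolve t \<Psi> x))\<^sup>2 - (norm (evolve t \<Phi> x))\<^sup>2\<bar>"
      by (simp add: right_diff_distrib[symmetric] abs_mult)
    also have "\<dots> \<le> C * (\<eta> * (norm (evolve t \<Psi> x))\<^sup>2 + (1 + 1 / \<eta>) * (norm (evolve t D x))\<^sup>2)"
      unfolding eD using h C norm_square_diff_le[OF \<eta>] by (intro mult_mono) auto
    finally show "\<bar>h (scaled t x) * (norm (evolve t \<Psi> x))\<^sup>2 - h (scaled t x) * (norm (evolve t \<Phi> x))\<^sup>2\<bar> \<le> \<dots>" .
  qed (use bi[OF i(1)] bi[OF i(2)] evolve_integral(1)[OF i(1)] evolve_integral(1)[OF iD] in auto)
  also have "\<dots> = C * (\<eta> * (LINT x|count_space UNIV. (norm (\<Psi> x))\<^sup>2) + (1 + 1 / \<eta>) * (LINT x|count_space UNIV. (norm (D x))\<^sup>2))"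
    using evolve_integral[OF i(1), of t] evolve_integral[OF iD, of t] by simp
  finally show ?thesis by (simp add: D_def)
qed

lemma measurable_vec_nth_complex: "(\<lambda>u :: complex ^ 2. u $ i) \<in> borel_measurable borel"
  by (intro borel_measurable_continuous_onI continuous_intros)

lemma measurable_Q [measurable]:
  assumes [measurable]: "u \<in> borel_measurable borel"
  shows "(\<lambda>k. Q s k (u k)) \<in> borel_measurable borel"
proof -
  have [measurable]: "(\<lambda>k. u k $ i) \<in> borel_measurable borel" for i
    using measurable_compose[OF assms measurable_vec_nth_complex] .
  have [measurable]: "Am \<in> borel_measurable borel" "Bm \<in> borel_measurable borel"
    unfolding Am_def[abs_def] Bm_def[abs_def] by (intro borel_measurable_continuous_onI continuous_intros)+
  have [measurable]: "W \<in> borel_measurable borel" by (intro borel_measurable_continuous_onI continuous_W)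
  have [measurable]: "cnj \<in> borel_measurable borel" by (intro borel_measurable_continuous_onI continuous_intros)
  have "(\<lambda>k. cip (u k) (U k (u k))) \<in> borel_measurable borel"
    unfolding cip_def U_nth by measurable
  then have [measurable]: "(\<lambda>k. Dm k (u k)) \<in> borel_measurable borel"
    unfolding Dm_def by measurable
  show ?thesis unfolding Q_def by measurable
qed

lemma Q_le: "s \<in> {1, -1} \<Longrightarrow> Q s k u \<le> (norm u)\<^sup>2"
  using P_eq_Q(2,3)[of s k u] by simp

text \<open>Here the eigenvector form is convenient: \<open>Q\<close> is the squared modulus of a
  linear functional of norm at most 1.\<close>

lemma Q_perturb:
  assumes s: "s \<in> {1, -1}" and \<eta>: "0 < \<eta>"
  shows "\<bar>Q s k u - Q s k v\<bar> \<le> \<eta> * (norm u)\<^sup>2 + (1 + 1 / \<eta>) * (norm (u - v))\<^sup>2"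
proof -
  define e where "e = eigvec a1 a2 s k"
  have "\<bar>(norm (cip e u))\<^sup>2 - (norm (cip e v))\<^sup>2\<bar> \<le> \<eta> * (norm (cip e u))\<^sup>2 + (1 + 1 / \<eta>) * (norm (cip e u - cip e v))\<^sup>2"
    by (rule norm_square_diff_le[OF \<eta>])
  also have "cip e u - cip e v = cip e (u - v)" by (simp add: cip_linear)
  finally have "\<bar>Q s k u - Q s k v\<bar> \<le> \<eta> * Q s k u + (1 + 1 / \<eta>) * Q s k (u - v)"
    by (simp add: e_def P_eq_Q(2)[OF s])
  also have "\<dots> \<le> \<eta> * (norm u)\<^sup>2 + (1 + 1 / \<eta>) * (norm (u - v))\<^sup>2"
    using Q_le[OF s] \<eta> by (intro add_mono mult_left_mono) auto
  finally show ?thesis .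
qed

lemma integrable_hQ:
  assumes [measurable]: "u \<in> borel_measurable borel" "h \<in> borel_measurable borel"
    and i: "set_integrable lborel torus (\<lambda>k. (norm (u k))\<^sup>2)" and h: "\<And>v. \<bar>h v\<bar> \<le> C" and s: "s \<in> {1, -1}"
  shows "set_integrable lborel torus (\<lambda>k. h (s *\<^sub>R vel k) * Q s k (u k))"
  unfolding set_integrable_def
proof (rule Bochner_Integration.integrable_bound)
  show "integrable lborel (\<lambda>k. C * (indicator torus k *\<^sub>R (norm (u k))\<^sup>2))"
    using i unfolding set_integrable_def by simp
  show "(\<lambda>k. indicator torus k *\<^sub>R (h (s *\<^sub>R vel k) * Q s k (u k))) \<in> borel_measurable lborel"
    by measurable
  have C: "0 \<le> C" using h[of 0] by simp
  have "\<bar>h (s *\<^sub>R vel k) * Q s k (u k)\<bar> \<le> C * (norm (u k))\<^sup>2" for k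
    unfolding abs_mult abs_of_nonneg[OF Q_nonneg[OF s]] by (rule mult_mono[OF h Q_le[OF s] C Q_nonneg[OF s]])
  then show "AE k in lborel. norm (indicator torus k *\<^sub>R (h (s *\<^sub>R vel k) * Q s k (u k))) \<le> norm (C * (indicator torus k *\<^sub>R (norm (u k))\<^sup>2))"
    using C by (auto simp: indicator_def)
qed

lemma limit_functional_perturb:
  assumes [measurable]: "u \<in> borel_measurable borel" "u' \<in> borel_measurable borel" "h \<in> borel_measurable borel"
    and i: "set_integrable lborel torus (\<lambda>k. (norm (u k))\<^sup>2)" "set_integrable lborel torus (\<lambda>k. (norm (u' k))\<^sup>2)"
      "set_integrable lborel torus (\<lambda>k. (norm (u k - u' k))\<^sup>2)"
    and h: "\<And>v. \<bar>h v\<bar> \<le> C" and \<eta>: "0 < \<eta>"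
  shows "\<bar>limit_functional h u - limit_functional h u'\<bar> \<le> C * (\<eta> * (LINT k:torus|lborel. (norm (u k))\<^sup>2)
    + (1 + 1 / \<eta>) * (LINT k:torus|lborel. (norm (u k - u' k))\<^sup>2))"
proof -
  define R where "R = C * (\<eta> * (LINT k:torus|lborel. (norm (u k))\<^sup>2)
    + (1 + 1 / \<eta>) * (LINT k:torus|lborel. (norm (u k - u' k))\<^sup>2))"
  have C: "0 \<le> C" using h[of 0] by simp
  have b: "\<bar>(LINT k:torus|lborel. h (s *\<^sub>R vel k) * Q s k (u k)) - (LINT k:torus|lborel. h (s *\<^sub>R vel k) * Q s k (u' k))\<bar> \<le> R"
    if s: "s \<in> {1, -1}" for s
  proof -
    note i1 = integrable_hQ[OF assms(1,3) i(1) h s] and i2 = integrable_hQ[OF assms(2,3) i(2) h s]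
    have bi: "set_integrable lborel torus (\<lambda>k. C * (\<eta> * (norm (u k))\<^sup>2 + (1 + 1 / \<eta>) * (norm (u k - u' k))\<^sup>2))"
      using i(1,3) by (intro set_integrable_mult_right set_integral_add(1)) auto
    have "\<bar>(LINT k:torus|lborel. h (s *\<^sub>R vel k) * Q s k (u k)) - (LINT k:torus|lborel. h (s *\<^sub>R vel k) * Q s k (u' k))\<bar>
        = \<bar>LINT k:torus|lborel. h (s *\<^sub>R vel k) * Q s k (u k) - h (s *\<^sub>R vel k) * Q s k (u' k)\<bar>"
      by (simp only: set_integral_diff(2)[OF i1 i2])
    also have "\<dots> \<le> (LINT k:torus|lborel. C * (\<eta> * (norm (u k))\<^sup>2 + (1 + 1 / \<eta>) * (norm (u k - u' k))\<^sup>2))"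
      unfolding set_lebesgue_integral_def
    proof (rule integral_abs_bound_integral)
      show "integrable lborel (\<lambda>k. indicator torus k *\<^sub>R (h (s *\<^sub>R vel k) * Q s k (u k) - h (s *\<^sub>R vel k) * Q s k (u' k)))"
        using set_integral_diff(1)[OF i1 i2] by (simp only: set_integrable_def)
      show "integrable lborel (\<lambda>k. indicator torus k *\<^sub>R (C * (\<eta> * (norm (u k))\<^sup>2 + (1 + 1 / \<eta>) * (norm (u k - u' k))\<^sup>2)))"
        using bi by (simp only: set_integrable_def)
      fix k
      have "\<bar>h (s *\<^sub>R vel k) * Q s k (u k) - h (s *\<^sub>R vel k) * Q s k (u' k)\<bar> = \<bar>h (s *\<^sub>R vel k)\<bar> * \<bar>Q s k (u k) - Q s k (u' k)\<bar>"
        by (simp add: right_diff_distrib[symmetric] abs_mult)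
      also have "\<dots> \<le> C * (\<eta> * (norm (u k))\<^sup>2 + (1 + 1 / \<eta>) * (norm (u k - u' k))\<^sup>2)"
        using h C Q_perturb[OF s \<eta>] by (intro mult_mono) auto
      finally show "\<bar>indicator torus k *\<^sub>R (h (s *\<^sub>R vel k) * Q s k (u k) - h (s *\<^sub>R vel k) * Q s k (u' k))\<bar>
         \<le> indicator torus k *\<^sub>R (C * (\<eta> * (norm (u k))\<^sup>2 + (1 + 1 / \<eta>) * (norm (u k - u' k))\<^sup>2))"
        by (simp add: indicator_def)
    qed
    also have "\<dots> = R"
    proof -
      have "(LINT k:torus|lborel. \<eta> * (norm (u k))\<^sup>2 + (1 + 1 / \<eta>) * (norm (u k - u' k))\<^sup>2)
          = (LINT k:torus|lborel. \<eta> * (norm (u k))\<^sup>2) + (LINT k:torus|lborel. (1 + 1 / \<eta>) * (norm (u k - u' k))\<^sup>2)"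
        using i(1,3) by (intro set_integral_add(2) set_integrable_mult_right) auto
      then show ?thesis by (simp only: set_integral_mult_right R_def)
    qed
    finally show ?thesis .
  qed
  have R0: "0 \<le> R" using b[of 1] by simp
  define X where "X s w = (LINT k:torus|lborel. h (s *\<^sub>R vel k) * Q s k (w k))" for s w
  have bX: "\<bar>X s u - X s u'\<bar> \<le> R" if "s \<in> {1, -1}" for s using b[OF that] by (simp only: X_def)
  have lf: "limit_functional h w = 1 / (4 * pi\<^sup>2) * (X 1 w + X (-1) w)" for w
    unfolding limit_functional_def X_def[symmetric] by simp
  have "limit_functional h u - limit_functional h u' = 1 / (4 * pi\<^sup>2) * ((X 1 u - X 1 u') + (X (-1) u - X (-1) u'))"
    unfolding lf right_diff_distrib[symmetric] by simp
  then have "\<bar>limit_functional h u - limit_functional h u'\<bar> = 1 / (4 * pi\<^sup>2) * \<bar>(X 1 u - X 1 u') + (X (-1) u - X (-1) u')\<bar>"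
    by (simp only: abs_mult) simp
  also have "\<dots> \<le> 1 / (4 * pi\<^sup>2) * (R + R)"
    using bX[of 1] bX[of "-1"] by (intro mult_left_mono order_trans[OF abs_triangle_ineq] add_mono) auto
  \<comment> \<open>The two eigenvalue signs contribute R each, and 2 / (4 pi^2) is at most
    1.\<close>
  also have "\<dots> \<le> 1 * R"
  proof -
    have "1 \<le> pi\<^sup>2" using pi_ge_two by (simp add: one_le_power)
    then have "2 / (4 * pi\<^sup>2) \<le> 1" by (simp add: divide_simps)
    then have "(2 / (4 * pi\<^sup>2)) * R \<le> 1 * R" using R0 by (intro mult_right_mono) auto
    then show ?thesis by (simp add: field_simps)
  qed
  finally show ?thesis by (simp add: R_def)
qed

end

section \<open>Truncation to boxes and properties of the chosen transform\<close>

definition truncate :: "nat \<Rightarrow> state \<Rightarrow> state" where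
  "truncate n \<Psi> x = (if x \<in> lbox n then \<Psi> x else 0)"

lemma supp_le_truncate: "supp_le n (truncate n \<Psi>)"
  by (auto simp: supp_le_def truncate_def mem_lbox)

lemma trig_truncate: "trig (lbox n) (truncate n \<Psi>) = trig (lbox n) \<Psi>"
  by (auto simp: trig_def truncate_def intro!: sum.cong)

lemma truncation_error:
  assumes "normalized \<Psi>"
  shows "integrable (count_space UNIV) (\<lambda>x. (norm (truncate n \<Psi> x))\<^sup>2)"
    and "integrable (count_space UNIV) (\<lambda>x. (norm (\<Psi> x - truncate n \<Psi> x))\<^sup>2)"
    and "(LINT x|count_space UNIV. (norm (\<Psi> x - truncate n \<Psi> x))\<^sup>2) = 1 - (\<Sum>x\<in>lbox n. (norm (\<Psi> x))\<^sup>2)"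
proof -
  note ni = normalized_integral[OF assms]
  have s: "{x. (norm (truncate n \<Psi> x))\<^sup>2 \<noteq> 0} \<subseteq> lbox n"
    by (auto simp: truncate_def)
  show it: "integrable (count_space UNIV) (\<lambda>x. (norm (truncate n \<Psi> x))\<^sup>2)"
    by (rule Bochner_Integration.integrable_bound[OF ni(1)]) (simp_all add: truncate_def)
  have e: "(norm (\<Psi> x - truncate n \<Psi> x))\<^sup>2 = (norm (\<Psi> x))\<^sup>2 - (norm (truncate n \<Psi> x))\<^sup>2" for x
    by (simp add: truncate_def)
  show "integrable (count_space UNIV) (\<lambda>x. (norm (\<Psi> x - truncate n \<Psi> x))\<^sup>2)"
    unfolding e using ni(1) it by simp
  have "(LINT x|count_space UNIV. (norm (truncate n \<Psi> x))\<^sup>2) = (\<Sum>x | (norm (truncate n \<Psi> x))\<^sup>2 \<noteq> 0. (norm (truncate n \<Psi> x))\<^sup>2)"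
    using finite_subset[OF s finite_lbox]
    by (subst lebesgue_integral_count_space_finite_support) (simp_all only: UNIV_I simp_thms)
  also have "\<dots> = (\<Sum>x\<in>lbox n. (norm (truncate n \<Psi> x))\<^sup>2)"
    using s by (intro sum.mono_neutral_left) auto
  also have "\<dots> = (\<Sum>x\<in>lbox n. (norm (\<Psi> x))\<^sup>2)"
    by (simp add: truncate_def)
  finally show "(LINT x|count_space UNIV. (norm (\<Psi> x - truncate n \<Psi> x))\<^sup>2) = 1 - (\<Sum>x\<in>lbox n. (norm (\<Psi> x))\<^sup>2)"
    unfolding e using ni it by simp
qed

text \<open>The defining mean square limit is in nonnegative extended integrals. It makes the error
  eventually finite, which gives the integrability in the fifth claim; without that, the Bochner
  integrals in the sixth could be 0 by convention. Square integrability of the transform follows by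
  comparison with one partial sum.\<close>

lemma fourier_transform_properties:
  assumes "normalized \<Psi>"
  shows "fourier_transform \<Psi> \<in> borel_measurable borel"
    and "fourier_transform \<Psi> (k + (2 * pi, 0)) = fourier_transform \<Psi> k"
    and "fourier_transform \<Psi> (k + (0, 2 * pi)) = fourier_transform \<Psi> k"
    and "set_integrable lborel torus (\<lambda>k. (norm (fourier_transform \<Psi> k))\<^sup>2)"
    and "\<forall>\<^sub>F n in sequentially. set_integrable lborel torus (\<lambda>k. (norm (fourier_transform \<Psi> k - trig (lbox n) \<Psi> k))\<^sup>2)"
    and "(\<lambda>n. LINT k:torus|lborel. (norm (fourier_transform \<Psi> k - trig (lbox n) \<Psi> k))\<^sup>2) \<longlonglongrightarrow> 0"
proof -
  define u where "u = fourier_transform \<Psi>"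
  have ft: "is_fourier_transform \<Psi> u"
    unfolding u_def fourier_transform_def using fourier_transform_exists[OF assms] by (rule someI_ex)
  have u [measurable]: "u \<in> borel_measurable borel" using ft by (simp add: is_fourier_transform_def)
  then show "fourier_transform \<Psi> \<in> borel_measurable borel" by (simp add: u_def)
  show "fourier_transform \<Psi> (k + (2 * pi, 0)) = fourier_transform \<Psi> k" "fourier_transform \<Psi> (k + (0, 2 * pi)) = fourier_transform \<Psi> k"
  proof -
    have "u (k1 + 2 * pi, k2) = u (k1, k2)" "u (k1, k2 + 2 * pi) = u (k1, k2)" for k1 k2
      using ft unfolding is_fourier_transform_def by blast+
    then show "fourier_transform \<Psi> (k + (2 * pi, 0)) = fourier_transform \<Psi> k"
        "fourier_transform \<Psi> (k + (0, 2 * pi)) = fourier_transform \<Psi> k"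
      unfolding u_def[symmetric] by (cases k; simp)+
  qed
  define I where "I n = (\<integral>\<^sup>+k\<in>torus. ennreal ((norm (u k - trig (lbox n) \<Psi> k))\<^sup>2) \<partial>lborel)" for n
  have "((\<lambda>A. \<integral>\<^sup>+k\<in>torus. ennreal ((norm (u k - trig A \<Psi> k))\<^sup>2) \<partial>lborel) \<longlongrightarrow> 0) (finite_subsets_at_top UNIV)"
    using ft unfolding is_fourier_transform_def torus_def trig_def by blast
  from filterlim_compose[OF this filterlim_lbox] have I0: "I \<longlonglongrightarrow> 0" by (simp add: I_def[abs_def])
  have I: "I n = (\<integral>\<^sup>+k. ennreal (indicator torus k * (norm (u k - trig (lbox n) \<Psi> k))\<^sup>2) \<partial>lborel)" for n
    unfolding I_def by (intro nn_integral_cong) (simp add: indicator_def)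
  have ev: "\<forall>\<^sub>F n in sequentially. set_integrable lborel torus (\<lambda>k. (norm (u k - trig (lbox n) \<Psi> k))\<^sup>2)"
    using order_tendstoD(2)[OF I0 zero_less_one]
  proof eventually_elim
    case (elim n)
    then show ?case
      unfolding set_integrable_def I by (intro integrableI_nonneg) (auto simp: less_top[symmetric] intro: less_trans)
  qed
  then show "\<forall>\<^sub>F n in sequentially. set_integrable lborel torus (\<lambda>k. (norm (fourier_transform \<Psi> k - trig (lbox n) \<Psi> k))\<^sup>2)"
    by (simp add: u_def)
  have L: "(LINT k:torus|lborel. (norm (u k - trig (lbox n) \<Psi> k))\<^sup>2) = enn2real (I n)" for n
    unfolding set_lebesgue_integral_def I by (subst integral_eq_nn_integral) auto
  have "(\<lambda>n. enn2real (I n)) \<longlonglongrightarrow> enn2real 0"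
    using I0 by (intro tendsto_enn2real) auto
  then show "(\<lambda>n. LINT k:torus|lborel. (norm (fourier_transform \<Psi> k - trig (lbox n) \<Psi> k))\<^sup>2) \<longlonglongrightarrow> 0"
    unfolding u_def[symmetric] L by simp
  obtain n where n: "set_integrable lborel torus (\<lambda>k. (norm (u k - trig (lbox n) \<Psi> k))\<^sup>2)"
    using eventually_happens'[OF _ ev] by auto
  have t: "set_integrable lborel torus (\<lambda>k. (norm (trig (lbox n) \<Psi> k))\<^sup>2)"
    by (intro continuous_integrable_torus continuous_intros continuous_trig)
  have "integrable lborel (\<lambda>k. indicator torus k *\<^sub>R (norm (u k))\<^sup>2)"
  proof (rule Bochner_Integration.integrable_bound)
    show "integrable lborel (\<lambda>k. 2 * (indicator torus k *\<^sub>R (norm (u k - trig (lbox n) \<Psi> k))\<^sup>2)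
        + 2 * (indicator torus k *\<^sub>R (norm (trig (lbox n) \<Psi> k))\<^sup>2))"
      using n t unfolding set_integrable_def by simp
    have "(norm x)\<^sup>2 \<le> 2 * (norm (x - y))\<^sup>2 + 2 * (norm y)\<^sup>2" for x y :: "complex ^ 2"
    proof -
      have "norm x \<le> norm (x - y) + norm y" by (metis diff_add_cancel norm_triangle_ineq)
      then have "(norm x)\<^sup>2 \<le> (norm (x - y) + norm y)\<^sup>2" by (rule power_mono) simp
      also have "\<dots> \<le> 2 * (norm (x - y))\<^sup>2 + 2 * (norm y)\<^sup>2"
        using sum_squares_bound[of "norm (x - y)" "norm y"] by (simp add: power2_sum)
      finally show ?thesis .
    qed
    then show "AE k in lborel. norm (indicator torus k *\<^sub>R (norm (u k))\<^sup>2)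
      \<le> norm (2 * (indicator torus k *\<^sub>R (norm (u k - trig (lbox n) \<Psi> k))\<^sup>2) + 2 * (indicator torus k *\<^sub>R (norm (trig (lbox n) \<Psi> k))\<^sup>2))"
      by (auto simp: indicator_def)
  qed measurable
  then show "set_integrable lborel torus (\<lambda>k. (norm (fourier_transform \<Psi> k))\<^sup>2)"
    by (simp add: set_integrable_def u_def)
qed

section \<open>The limit law for all normalized states\<close>

context walk_params begin

theorem expectation_tendsto:
  assumes norm: "normalized \<Psi>" and h: "continuous_on UNIV h" "\<And>v. \<bar>h v\<bar> \<le> C"
  shows "(\<lambda>t. expectation t h \<Psi>) \<longlonglongrightarrow> limit_functional h (fourier_transform \<Psi>)"
proof (rule LIMSEQ_I)
  fix r :: real assume r: "0 < r"
  define u where "u = fourier_transform \<Psi>"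
  note ft = fourier_transform_properties[OF norm, folded u_def]
  have C: "0 \<le> C" using h(2)[of 0] by simp
  define G where "G = (LINT k:torus|lborel. (norm (u k))\<^sup>2)"
  have G: "0 \<le> G" unfolding G_def set_lebesgue_integral_def by (intro Bochner_Integration.integral_nonneg) simp
  \<comment> \<open>Chosen so that C \<eta> y is at most r / 8 both for the mass 1 of the state and
    for the mass G of its transform. With the truncation errors below r / 8, each replacement costs
    less than r / 4; the added 1s avoid division by zero.\<close>
  define \<eta> where "\<eta> = r / (8 * (C + 1) * (G + 1))"
  have \<eta>: "0 < \<eta>" using r C G by (simp add: \<eta>_def)
  have small: "C * (\<eta> * y) \<le> r / 8" if "0 \<le> y" "y \<le> G + 1" for y
  proof -
    have "C * y \<le> (C + 1) * (G + 1)" using that C G by (intro mult_mono) auto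
    then have "\<eta> * (C * y) \<le> \<eta> * ((C + 1) * (G + 1))" using \<eta> by (intro mult_left_mono) auto
    also have "\<dots> = r / 8"
    proof -
      have "(C + 1) * (G + 1) \<noteq> 0" using C G by simp
      then show ?thesis by (simp only: \<eta>_def mult.assoc) simp
    qed
    finally show ?thesis by (simp add: mult_ac)
  qed
  have mass: "(\<lambda>n. \<Sum>x\<in>lbox n. (norm (\<Psi> x))\<^sup>2) \<longlonglongrightarrow> 1"
    using filterlim_compose[OF mass_sums(1)[OF norm] filterlim_lbox] .
  have "(\<lambda>n. C * ((1 + 1 / \<eta>) * (1 - (\<Sum>x\<in>lbox n. (norm (\<Psi> x))\<^sup>2)))) \<longlonglongrightarrow> C * ((1 + 1 / \<eta>) * (1 - 1))"
    by (intro tendsto_intros mass)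
  then have e1: "\<forall>\<^sub>F n in sequentially. C * ((1 + 1 / \<eta>) * (1 - (\<Sum>x\<in>lbox n. (norm (\<Psi> x))\<^sup>2))) < r / 8"
    using r by (intro order_tendstoD(2)) auto
  have "(\<lambda>n. C * ((1 + 1 / \<eta>) * (LINT k:torus|lborel. (norm (u k - trig (lbox n) \<Psi> k))\<^sup>2))) \<longlonglongrightarrow> C * ((1 + 1 / \<eta>) * 0)"
    by (intro tendsto_intros ft(6))
  then have e2: "\<forall>\<^sub>F n in sequentially. C * ((1 + 1 / \<eta>) * (LINT k:torus|lborel. (norm (u k - trig (lbox n) \<Psi> k))\<^sup>2)) < r / 8"
    using r by (intro order_tendstoD(2)) auto
  obtain n where n: "C * ((1 + 1 / \<eta>) * (1 - (\<Sum>x\<in>lbox n. (norm (\<Psi> x))\<^sup>2))) < r / 8"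
      "C * ((1 + 1 / \<eta>) * (LINT k:torus|lborel. (norm (u k - trig (lbox n) \<Psi> k))\<^sup>2)) < r / 8"
      "set_integrable lborel torus (\<lambda>k. (norm (u k - trig (lbox n) \<Psi> k))\<^sup>2)"
    using eventually_happens'[OF _ eventually_conj[OF e1 eventually_conj[OF e2 ft(5)]]] by auto
  define \<Phi> where "\<Phi> = truncate n \<Psi>"
  have p1: "\<bar>expectation t h \<Psi> - expectation t h \<Phi>\<bar> < r / 4" for t
  proof -
    have "\<bar>expectation t h \<Psi> - expectation t h \<Phi>\<bar> \<le> C * (\<eta> * 1 + (1 + 1 / \<eta>) * (1 - (\<Sum>x\<in>lbox n. (norm (\<Psi> x))\<^sup>2)))"
      using expectation_perturb[OF normalized_integral(1)[OF norm] truncation_error(1,2)[OF norm, of n] h(2) \<eta>, of t]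
      unfolding normalized_integral(2)[OF norm] truncation_error(3)[OF norm] \<Phi>_def .
    also have "\<dots> < r / 4" using small[of 1] n(1) G unfolding distrib_left[of C] by linarith
    finally show ?thesis .
  qed
  have p2: "\<bar>limit_functional h u - limit_functional h (trig (lbox n) \<Phi>)\<bar> < r / 4"
  proof -
    have t: "set_integrable lborel torus (\<lambda>k. (norm (trig (lbox n) \<Psi> k))\<^sup>2)"
      by (intro continuous_integrable_torus continuous_intros continuous_trig)
    have "\<bar>limit_functional h u - limit_functional h (trig (lbox n) \<Psi>)\<bar> \<le> C * (\<eta> * G + (1 + 1 / \<eta>) * (LINT k:torus|lborel. (norm (u k - trig (lbox n) \<Psi> k))\<^sup>2))"
      unfolding G_def
      by (rule limit_functional_perturb[OF ft(1) measurable_trig borel_measurable_continuous_onI[OF h(1)] ft(4) t n(3) h(2) \<eta>])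
    also have "\<dots> < r / 4" using small[of G] n(2) G unfolding distrib_left[of C] by linarith
    finally show ?thesis by (simp add: \<Phi>_def trig_truncate)
  qed
  obtain t0 where t0: "\<And>t. t \<ge> t0 \<Longrightarrow> \<bar>expectation t h \<Phi> - limit_functional h (trig (lbox n) \<Phi>)\<bar> < r / 4"
    using LIMSEQ_D[OF finite_support_tendsto[OF h(1) supp_le_truncate, of n \<Psi>], of "r / 4"] r
    by (auto simp: \<Phi>_def)
  show "\<exists>no. \<forall>t\<ge>no. norm (expectation t h \<Psi> - limit_functional h (fourier_transform \<Psi>)) < r"
  proof (intro exI[of _ t0] allI impI)
    fix t assume "t \<ge> t0"
    then show "norm (expectation t h \<Psi> - limit_functional h (fourier_transform \<Psi>)) < r"
      using p1[of t] p2 t0[of t] r unfolding u_def[symmetric] real_norm_def by linarith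
  qed
qed

lemma P_measurable:
  assumes "normalized \<Psi>" "s \<in> {1, -1}"
  shows "P a1 a2 \<Psi> s \<in> borel_measurable borel"
proof -
  have "P a1 a2 \<Psi> s = (\<lambda>k. Q s k (fourier_transform \<Psi> k))" using P_eq_Q(1)[OF assms(2)] by auto
  then show ?thesis using measurable_Q[OF fourier_transform_properties(1)[OF assms(1)]] by simp
qed

text \<open>\<open>eigvec\<close> inherits exact periodicity because the choice operator is applied
  to the same predicate at k and at its translate.\<close>

lemma P_periodic:
  assumes "normalized \<Psi>"
  shows "P a1 a2 \<Psi> s (k + (2 * pi, 0)) = P a1 a2 \<Psi> s k" "P a1 a2 \<Psi> s (k + (0, 2 * pi)) = P a1 a2 \<Psi> s k"
proof -
  have ph: "phase_matrix (x + 2 * pi) = phase_matrix x" for x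
  proof -
    have "cis (x + 2 * pi) = cis x" "cis (- (x + 2 * pi)) = cis (- x)"
      by (auto simp: complex_eq_iff sin_diff cos_diff)
    then show ?thesis by (simp only: phase_matrix_def)
  qed
  have "Uhat a1 a2 (k + (2 * pi, 0)) = Uhat a1 a2 k" "Uhat a1 a2 (k + (0, 2 * pi)) = Uhat a1 a2 k"
    by (simp_all add: Uhat_def ph)
  moreover have "\<omega> a1 a2 (k + (2 * pi, 0)) = \<omega> a1 a2 k" "\<omega> a1 a2 (k + (0, 2 * pi)) = \<omega> a1 a2 k"
    by (simp_all add: \<omega>_def \<tau>_def l1_def l2_def add.assoc[symmetric] diff_add_eq[symmetric] cos_diff cos_add sin_add)
  ultimately have "eigvec a1 a2 s (k + (2 * pi, 0)) = eigvec a1 a2 s k" "eigvec a1 a2 s (k + (0, 2 * pi)) = eigvec a1 a2 s k"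
    by (simp_all add: eigvec_def)
  then show "P a1 a2 \<Psi> s (k + (2 * pi, 0)) = P a1 a2 \<Psi> s k" "P a1 a2 \<Psi> s (k + (0, 2 * pi)) = P a1 a2 \<Psi> s k"
    by (simp_all add: P_def fourier_transform_properties(2,3)[OF assms])
qed

lemma limit_functional_eq_density:
  assumes norm: "normalized \<Psi>" and [measurable]: "h \<in> borel_measurable borel" and h: "\<And>v. \<bar>h v\<bar> \<le> C"
  shows "integrable lebesgue (\<lambda>v. h v * limit_density a1 a2 \<Psi> v)"
    and "(LINT v|lebesgue. h v * limit_density a1 a2 \<Psi> v) = limit_functional h (fourier_transform \<Psi>)"
proof -
  note ft = fourier_transform_properties[OF norm]
  have i: "set_integrable lborel torus (\<lambda>k. h (s *\<^sub>R vel k) * P a1 a2 \<Psi> s k)" if "s \<in> {1, -1}" for s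
    unfolding P_eq_Q(1)[OF that] by (rule integrable_hQ[OF ft(1) assms(2) ft(4) h that])
  note ld = integral_limit_density[OF i P_measurable[OF norm] assms(2) P_periodic[OF norm]]
  show "integrable lebesgue (\<lambda>v. h v * limit_density a1 a2 \<Psi> v)" by (rule ld(1))
  have eq: "(\<Sum>s\<in>{1, -1}. LINT k:torus|lborel. h (s *\<^sub>R vel k) * P a1 a2 \<Psi> s k)
    = (\<Sum>s\<in>{1, -1}. LINT k:torus|lborel. h (s *\<^sub>R vel k) * Q s k (fourier_transform \<Psi> k))"
    by (intro sum.cong refl) (simp only: P_eq_Q(1))
  have "(LINT v|lebesgue. h v * limit_density a1 a2 \<Psi> v)
      = 1 / (4 * pi\<^sup>2) * (\<Sum>s\<in>{1, -1}. LINT k:torus|lborel. h (s *\<^sub>R vel k) * P a1 a2 \<Psi> s k)"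
    by (rule ld(2))
  also have "\<dots> = limit_functional h (fourier_transform \<Psi>)"
    unfolding limit_functional_def by (rule arg_cong[OF eq])
  finally show "(LINT v|lebesgue. h v * limit_density a1 a2 \<Psi> v) = limit_functional h (fourier_transform \<Psi>)" .
qed

text \<open>The sign of F0 - sqrt (F1 F2) is not visible from the formula. Off the exceptional
  lines, a point with both F values positive is a velocity, and there \<open>f\<close> is the
  reciprocal of pi^2 times a nonnegative Jacobian.\<close>

lemma AE_limit_density_nonneg: "AE v in lebesgue. 0 \<le> limit_density a1 a2 \<Psi> v"
  using AE_lebesgue_components
proof eventually_elim
  case (elim v)
  have f: "0 \<le> f a1 a2 (if \<xi> = 0 then 1 else - 1) v" if \<xi>: "\<xi> \<in> {0, 1::nat}" for \<xi>
  proof (cases "0 < F a1 v \<and> 0 < F a2 v")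
    case True
    then obtain k where k: "k \<in> piece 0 0 \<xi>" "v = vel k"
      using velocity_image[of 0 0 \<xi> 1 v] \<xi> elim by auto
    define \<sigma> :: real where "\<sigma> = (if \<xi> = 0 then 1 else -1)"
    have "jac k * (pi\<^sup>2 * f a1 a2 \<sigma> v) = 1"
      using f_velocity[of k \<sigma>] phi_sign[of 0 \<xi> k 0] k \<xi> by (simp add: piece_def \<sigma>_def)
    then have "0 < jac k * (pi\<^sup>2 * f a1 a2 \<sigma> v)" by simp
    moreover have "0 \<le> jac k" unfolding jac_def using ab_pos by simp
    ultimately show ?thesis by (simp add: \<sigma>_def zero_less_mult_iff)
  qed (simp add: f_eq_0)
  have "0 \<le> w a1 a2 \<Psi> s v" for s
    unfolding w_def by (intro mult_nonneg_nonneg sum_nonneg) (auto simp: P_def)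
  then show ?case
    unfolding limit_density_def using f[of 0] f[of 1] by (intro add_nonneg_nonneg mult_nonneg_nonneg) simp_all
qed

theorem weak_limit:
  assumes norm: "normalized \<Psi>0"
  shows "\<exists>N :: (real \<times> real) measure.
      prob_space N \<and> sets N = sets borel \<and>
      converges_in_distribution (scaled_position_law a1 a2 \<Psi>0) N \<and>
      integrable lebesgue (limit_density a1 a2 \<Psi>0) \<and>
      (\<forall>u1 u2. measure N ({..u1} \<times> {..u2}) =
        (LINT v : {..u1} \<times> {..u2} | lebesgue. limit_density a1 a2 \<Psi>0 v))"
proof -
  define ld where "ld = limit_density a1 a2 \<Psi>0"
  have int: "integrable lebesgue ld"
    using limit_functional_eq_density(1)[OF norm, of "\<lambda>_. 1" 1] by (simp add: ld_def[abs_def])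
  \<comment> \<open>The density is only Lebesgue measurable, while the limit law lives on the Borel
    sets; \<open>G\<close> is a Borel version of it.\<close>
  obtain G where G: "G \<in> borel_measurable lborel" "AE v in lborel. ld v = G v"
    using completion_ex_borel_measurable_real[of ld lborel] int by auto
  note [measurable] = G(1)
  have aeG: "AE v in lborel. 0 \<le> G v"
  proof -
    have "AE v in lborel. 0 \<le> ld v" using AE_limit_density_nonneg[of \<Psi>0] by (simp add: ld_def AE_completion_iff)
    with G(2) show ?thesis by eventually_elim simp
  qed
  have mG: "(\<lambda>v. h v * G v) \<in> borel_measurable lborel" "(\<lambda>v. h v * G v) \<in> borel_measurable lebesgue"
    if [measurable]: "h \<in> borel_measurable borel" for h :: "real \<times> real \<Rightarrow> real"
  proof -
    show m: "(\<lambda>v. h v * G v) \<in> borel_measurable lborel" by measurable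
    show "(\<lambda>v. h v * G v) \<in> borel_measurable lebesgue" by (rule measurable_completion[OF m])
  qed
  have transfer: "(LINT v|lborel. h v * G v) = (LINT v|lebesgue. h v * ld v)" "integrable lborel (\<lambda>v. h v * G v) \<longleftrightarrow> integrable lebesgue (\<lambda>v. h v * ld v)"
    if h [measurable]: "h \<in> borel_measurable borel" for h :: "real \<times> real \<Rightarrow> real"
  proof -
    have ae: "AE v in lebesgue. h v * ld v = h v * G v"
      using AE_completion[OF G(2)] by eventually_elim simp
    have "h \<in> borel_measurable lebesgue" by (rule measurable_completion) simp
    then have m: "(\<lambda>v. h v * ld v) \<in> borel_measurable lebesgue"
      using borel_measurable_integrable[OF int] by (rule borel_measurable_times)
    show "(LINT v|lborel. h v * G v) = (LINT v|lebesgue. h v * ld v)"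
      using integral_cong_AE[OF m mG(2)[OF h] ae] integral_completion[OF mG(1)[OF h]] by simp
    show "integrable lborel (\<lambda>v. h v * G v) \<longleftrightarrow> integrable lebesgue (\<lambda>v. h v * ld v)"
      using integrable_cong_AE[OF m mG(2)[OF h] ae] integrable_completion[OF mG(1)[OF h]] by simp
  qed
  define N where "N = density lborel (\<lambda>v. ennreal (G v))"
  have sets: "sets N = sets borel" by (simp add: N_def)
  have intN: "(LINT v|N. h v) = (LINT v|lebesgue. h v * ld v)" if h [measurable]: "h \<in> borel_measurable borel" for h :: "real \<times> real \<Rightarrow> real"
  proof -
    have "(LINT v|N. h v) = (LINT v|lborel. G v * h v)"
      unfolding N_def using aeG by (subst integral_density) auto
    then show ?thesis using transfer(1)[OF h] by (simp add: mult.commute)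
  qed
  have iG: "integrable lborel G" using transfer(2)[of "\<lambda>_. 1"] int by simp
  have emN: "emeasure N A = ennreal (LINT v|lebesgue. indicator A v * ld v)" if A [measurable]: "A \<in> sets borel" for A
  proof -
    have "emeasure N A = (\<integral>\<^sup>+v. ennreal (indicator A v * G v) \<partial>lborel)"
      unfolding N_def by (subst emeasure_density) (auto intro!: nn_integral_cong simp: indicator_def)
    also have "\<dots> = ennreal (LINT v|lborel. indicator A v * G v)"
    proof (rule nn_integral_eq_integral)
      show "integrable lborel (\<lambda>v. indicator A v * G v)"
        using integrable_mult_indicator[OF _ iG, of A] by simp
      show "AE v in lborel. 0 \<le> indicator A v * G v" using aeG by eventually_elim (simp add: indicator_def)
    qed
    also have "\<dots> = ennreal (LINT v|lebesgue. indicator A v * ld v)"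
      by (subst transfer(1)) simp_all
    finally show ?thesis .
  qed
  have ld0: "0 \<le> (LINT v|lebesgue. indicator A v * ld v)" for A
    using AE_limit_density_nonneg[of \<Psi>0] by (intro integral_nonneg_AE) (auto simp: ld_def indicator_def elim!: eventually_mono)
  have conv: "(\<lambda>t. LINT v|scaled_position_law a1 a2 \<Psi>0 t. h v) \<longlonglongrightarrow> (LINT v|lebesgue. h v * ld v)"
    if h: "continuous_on UNIV h" "\<And>v. \<bar>h v\<bar> \<le> C" for h C
  proof -
    have m: "h \<in> borel_measurable borel" using h(1) by (rule borel_measurable_continuous_onI)
    show ?thesis
      using expectation_tendsto[OF norm h] limit_functional_eq_density(2)[OF norm m h(2)]
      by (simp add: scaled_law_integral[OF m] ld_def)
  qed
  \<comment> \<open>Tested against the constant 1, the expectation is 1 at every time, so its limit,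
    the total mass of the density, is 1 as well.\<close>
  have "(LINT v|lebesgue. ld v) = 1"
  proof -
    have "expectation t (\<lambda>_. 1) \<Psi>0 = 1" for t
      using evolve_integral(2)[OF normalized_integral(1)[OF norm], of t] normalized_integral(2)[OF norm]
      by (simp add: expectation_def)
    moreover have "(\<lambda>t. expectation t (\<lambda>_. 1) \<Psi>0) \<longlonglongrightarrow> (LINT v|lebesgue. 1 * ld v)"
      using conv[of "\<lambda>_. 1" 1] unfolding scaled_law_integral[OF borel_measurable_const] by simp
    ultimately show ?thesis by (simp add: LIMSEQ_const_iff)
  qed
  then have "emeasure N (space N) = 1" using emN[of UNIV] by (simp add: N_def)
  then have prob: "prob_space N" by (rule prob_spaceI)
  have "converges_in_distribution (scaled_position_law a1 a2 \<Psi>0) N"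
    unfolding converges_in_distribution_def
  proof (intro allI impI, elim conjE)
    fix h :: "real \<times> real \<Rightarrow> real"
    assume h: "continuous_on UNIV h" "bounded (range h)"
    then obtain C where "\<And>v. \<bar>h v\<bar> \<le> C" by (auto simp: bounded_iff)
    from conv[OF h(1) this] show "(\<lambda>t. LINT v|scaled_position_law a1 a2 \<Psi>0 t. h v) \<longlonglongrightarrow> (LINT v|N. h v)"
      using intN[OF borel_measurable_continuous_onI[OF h(1)]] by simp
  qed
  moreover have "measure N ({..u1} \<times> {..u2}) = (LINT v : {..u1} \<times> {..u2} | lebesgue. ld v)" for u1 u2
  proof -
    have "{..u1} \<times> {..u2} \<in> sets (borel :: (real \<times> real) measure)"
      by (intro borel_closed closed_Times closed_atMost)
    from emN[OF this] ld0 show ?thesis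
      by (simp add: measure_def set_lebesgue_integral_def)
  qed
  ultimately show ?thesis
    using prob sets int unfolding ld_def by blast
qed

end

theorem theorem4:
  fixes a1 a2 :: real and \<Psi>0 :: state
  assumes "0 \<le> a1" "a1 \<le> 1" "0 \<le> a2" "a2 \<le> 1"
    and "prod_a a1 a2 > 0" "prod_b a1 a2 > 0" "prod_a a1 a2 + prod_b a1 a2 < 1"
    and "normalized \<Psi>0"
  shows "\<exists>N :: (real \<times> real) measure.
      prob_space N \<and> sets N = sets borel \<and>
      converges_in_distribution (scaled_position_law a1 a2 \<Psi>0) N \<and>
      integrable lebesgue (limit_density a1 a2 \<Psi>0) \<and>
      (\<forall>u1 u2. measure N ({..u1} \<times> {..u2}) =
        (LINT v : {..u1} \<times> {..u2} | lebesgue. limit_density a1 a2 \<Psi>0 v))"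
proof -
  interpret walk_params a1 a2 using assms by unfold_locales
  show ?thesis using weak_limit[OF assms(8)] .
qed

end
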